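(* Let $m \ge 3$. Algorithm LPT-REV (defined in the context) runs in $\mathcal{O}(n\log n)$ time on instances of $P_m\|C_{max}$ with $n$ jobs, and for every instance the makespan it returns is at most $\left(\frac{4}{3}-\frac{1}{3(m-1)}\right)C_m^*$, where $C_m^*$ is the optimal makespan.
   Context: Problem $P_m\|C_{max}$: $n$ jobs with processing times $p_1\ge p_2\ge\dots\ge p_n\ge 0$ (jobs indexed in non-increasing order of processing time) must be assigned to $m$ identical parallel machines; the load of a machine is the sum of processing times of its jobs, the makespan is the maximum load, and $C_m^*$ is the minimum possible makespan. List Scheduling (LS) of an ordered list of jobs assigns the jobs one at a time, in list order, to a machine with currently smallest load. LPT is LS applied to the jobs in order $1,\dots,n$. In an LPT schedule, the critical machine is a machine whose load equals the makespan and the critical job $j'$ is the last job assigned to it. For a set $S$ of jobs, $LPT(S)$ first assigns all jobs of $S$ together to one machine and then applies LS to the remaining jobs in non-increasing order of processing time. Algorithm LPT-REV: (1) apply LPT, obtaining makespan $z_1$, critical job $j'$, and $k-1$ jobs on the critical machine before $j'$; (2) apply $LPT'=LPT(\{j'\})$, obtaining makespan $z_2$; (3) apply $LPT''=LPT(\{j'-k+1,\dots,j'\})$, obtaining makespan $z_3$; (4) return the schedule with value $\min\{z_1,z_2,z_3\}$. *)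

theory Defs
  imports Complex_Main "HOL-Library.Multiset" "HOL-Library.Landau_Symbols" "HOL-Library.Monad_Syntax"
begin

section \<open>The problem\<close>

text \<open>
  Jobs are natural numbers, \<open>p j\<close> is the processing time of \<open>j\<close>, and the machines are
  \<open>0, \<dots>, m - 1\<close>.  A (partial) schedule \<open>A\<close> maps each machine to the list of its jobs,
  \<^emph>\<open>most recently assigned job first\<close>.
\<close>

type_synonym job = nat
type_synonym schedule = "nat \<Rightarrow> job list"

definition valid_instance :: "(job \<Rightarrow> real) \<Rightarrow> job list \<Rightarrow> bool" where
  "valid_instance p js \<longleftrightarrow> distinct js \<and> (\<forall>j \<in> set js. 0 \<le> p j)"

definition non_increasing :: "(job \<Rightarrow> real) \<Rightarrow> job list \<Rightarrow> bool" where
  "non_increasing p js \<longleftrightarrow> sorted_wrt (\<lambda>i j. p i \<ge> p j) js"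

definition load :: "(job \<Rightarrow> real) \<Rightarrow> job list \<Rightarrow> real" where
  "load p js = (\<Sum>j\<leftarrow>js. p j)"

definition makespan :: "nat \<Rightarrow> (job \<Rightarrow> real) \<Rightarrow> schedule \<Rightarrow> real" where
  "makespan m p A = Max ((\<lambda>i. load p (A i)) ` {..<m})"

definition is_schedule :: "nat \<Rightarrow> job set \<Rightarrow> schedule \<Rightarrow> bool" where
  "is_schedule m J A \<longleftrightarrow>
     distinct (concat (map A [0..<m])) \<and> set (concat (map A [0..<m])) = J"

definition opt_makespan :: "nat \<Rightarrow> (job \<Rightarrow> real) \<Rightarrow> job set \<Rightarrow> real" where
  "opt_makespan m p J = Min {makespan m p A | A. is_schedule m J A}"

lemma finite_makespans:
  assumes "finite J"
  shows "finite {makespan m p A | A. is_schedule m J A}"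
proof -
  let ?L = "{xs. set xs \<subseteq> J \<and> length xs \<le> card J}"
  have "makespan m p A \<in> (\<lambda>f. makespan m p f) `
      {f. \<forall>i. (i \<in> {..<m} \<longrightarrow> f i \<in> ?L) \<and> (i \<notin> {..<m} \<longrightarrow> f i = [])}"
    if "is_schedule m J A" for A
  proof
    let ?f = "\<lambda>i. if i < m then A i else []"
    show "makespan m p A = makespan m p ?f"
      by (simp add: makespan_def)
    have "A i \<in> ?L" if "i < m" for i
    proof -
      have "A i \<in> set (map A [0..<m])" using that by simp
      then have "distinct (A i)" "set (A i) \<subseteq> J"
        using \<open>is_schedule m J A\<close> unfolding is_schedule_def
        by (blast dest: distinct_concat_iff[THEN iffD1], auto)
      with assms show ?thesis
        by (simp add: card_mono flip: distinct_card)
    qed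
    then show "?f \<in> {f. \<forall>i. (i \<in> {..<m} \<longrightarrow> f i \<in> ?L) \<and> (i \<notin> {..<m} \<longrightarrow> f i = [])}"
      by auto
  qed
  moreover have "finite ?L"
    using assms by (rule finite_lists_length_le)
  then have "finite {f. \<forall>i. (i \<in> {..<m} \<longrightarrow> f i \<in> ?L) \<and> (i \<notin> {..<m} \<longrightarrow> f i = [])}"
    by (intro finite_set_of_finite_funs) auto
  ultimately show ?thesis
    by (elim finite_subset[OF _ finite_imageI, rotated]) auto
qed

lemma mset_concat_machines: "mset (concat (map A [0..<m])) = (\<Sum>i<m. mset (A i))"
  by (induction m) (auto simp: lessThan_Suc)

lemma is_schedule_iff_mset:
  assumes "finite J"
  shows "is_schedule m J A \<longleftrightarrow> (\<Sum>i<m. mset (A i)) = mset_set J"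
proof -
  obtain js where js: "set js = J" "distinct js"
    using finite_distinct_list[OF assms] by blast
  then have "mset_set J = mset js"
    using mset_set_set by blast
  moreover have "distinct xs \<and> set xs = J \<longleftrightarrow> mset xs = mset js" for xs
    by (metis js set_eq_iff_mset_eq_distinct mset_eq_setD mset_eq_imp_distinct_iff)
  ultimately show ?thesis
    by (simp only: is_schedule_def flip: mset_concat_machines)
qed

lemma sum_mset_upd:
  "i < m \<Longrightarrow> (\<Sum>h<m. mset ((A(i := L)) h)) + mset (A i) = (\<Sum>h<m. mset (A h)) + mset L"
  for A :: schedule
  by (simp add: sum.remove[of "{..<m}" i])

lemma is_schedule_exists:
  assumes "m \<ge> 1" "finite J"
  shows "\<exists>A. is_schedule m J A"
proof -
  obtain xs where "set xs = J" "distinct xs" using finite_distinct_list[OF assms(2)] by blast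
  then have "is_schedule m J ((\<lambda>_. [])(0 := xs))"
    using assms sum_mset_upd[of 0 m "\<lambda>_. []" xs] mset_set_set[of xs]
    by (simp add: is_schedule_iff_mset)
  then show ?thesis by blast
qed

lemma opt_makespan_attained:
  assumes "m \<ge> 1" "finite J"
  shows "\<exists>A. is_schedule m J A \<and> makespan m p A = opt_makespan m p J"
proof -
  have "opt_makespan m p J \<in> {makespan m p A | A. is_schedule m J A}"
    unfolding opt_makespan_def
    using finite_makespans[OF assms(2)] is_schedule_exists[OF assms] by (intro Min_in) blast+
  then show ?thesis by force
qed

lemma opt_makespan_le:
  assumes "finite J" "is_schedule m J A"
  shows "opt_makespan m p J \<le> makespan m p A"
  unfolding opt_makespan_def using finite_makespans[OF assms(1)] assms(2) by (intro Min_le) blast+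



section \<open>LS, LPT and LPT-REV\<close>

text \<open>
  The algorithms are described by their sets of possible outcomes: wherever a machine is chosen
  (a machine of smallest load, a machine whose load equals the makespan), every choice is allowed.
  In \<open>LPT\<close>, \<open>LPT_with\<close> and \<open>LPT_REV\<close> the list \<open>js\<close> gives the indexing of the jobs in
  non-increasing order of processing time: \<open>js ! c\<close> is the job with (0-based) index \<open>c\<close>.
\<close>

text \<open>
  \<open>list_scheduling m p A js B\<close>: assigning the jobs \<open>js\<close> in this order, starting from the
  partial schedule \<open>A\<close>, can lead to \<open>B\<close>.
\<close>

inductive list_scheduling ::
    "nat \<Rightarrow> (job \<Rightarrow> real) \<Rightarrow> schedule \<Rightarrow> job list \<Rightarrow> schedule \<Rightarrow> bool"
  for m :: nat and p :: "job \<Rightarrow> real" where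
  LS_Nil: "list_scheduling m p A [] A"
| LS_Cons: "\<lbrakk>i < m; \<forall>h<m. load p (A i) \<le> load p (A h);
      list_scheduling m p (A(i := j # A i)) js B\<rbrakk> \<Longrightarrow> list_scheduling m p A (j # js) B"

definition LPT :: "nat \<Rightarrow> (job \<Rightarrow> real) \<Rightarrow> job list \<Rightarrow> schedule \<Rightarrow> bool" where
  "LPT m p js B \<longleftrightarrow> list_scheduling m p (\<lambda>_. []) js B"

definition LPT_with ::
    "nat \<Rightarrow> (job \<Rightarrow> real) \<Rightarrow> job list \<Rightarrow> job set \<Rightarrow> schedule \<Rightarrow> bool" where
  "LPT_with m p js S B \<longleftrightarrow>
     (\<exists>i L. i < m \<and> distinct L \<and> set L = S \<and>
       list_scheduling m p ((\<lambda>_. [])(i := L)) (filter (\<lambda>j. j \<notin> S) js) B)"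

text \<open>
  The critical job \<open>js ! c\<close> is the head of the job list of the critical machine \<open>i\<close>, whose
  length is \<open>k\<close>.  The critical job is undefined only if there are no jobs.
\<close>

inductive LPT_REV :: "nat \<Rightarrow> (job \<Rightarrow> real) \<Rightarrow> job list \<Rightarrow> schedule \<Rightarrow> bool"
  for m :: nat and p :: "job \<Rightarrow> real" and js :: "job list" where
  no_jobs: "\<lbrakk>js = []; LPT m p js A\<rbrakk> \<Longrightarrow> LPT_REV m p js A"
| run: "\<lbrakk>LPT m p js A1;
      i < m; load p (A1 i) = makespan m p A1; A1 i \<noteq> [];
      c < length js; js ! c = hd (A1 i); k = length (A1 i);
      LPT_with m p js {js ! c} A2;
      LPT_with m p js {js ! d | d. d \<in> {c + 1 - k..c}} A3;
      B \<in> {A1, A2, A3};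
      makespan m p B = Min {makespan m p A1, makespan m p A2, makespan m p A3}\<rbrakk>
    \<Longrightarrow> LPT_REV m p js B"

lemma list_scheduling_mset:
  "list_scheduling m p A js B \<Longrightarrow> (\<Sum>i<m. mset (B i)) = (\<Sum>i<m. mset (A i)) + mset js"
proof (induction rule: list_scheduling.induct)
  case (LS_Cons i A j js B)
  then show ?case using sum_mset_upd[of i m A "j # A i"] by simp
qed simp

lemma LPT_is_schedule:
  assumes "distinct js" "LPT m p js B"
  shows "is_schedule m (set js) B"
  using assms list_scheduling_mset[of m p "\<lambda>_. []" js B]
  by (simp add: LPT_def is_schedule_iff_mset mset_set_set)

lemma LPT_with_is_schedule:
  assumes "distinct js" "S \<subseteq> set js" "LPT_with m p js S B"
  shows "is_schedule m (set js) B"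
proof -
  obtain i L where L: "i < m" "distinct L" "set L = S"
    "list_scheduling m p ((\<lambda>_. [])(i := L)) (filter (\<lambda>j. j \<notin> S) js) B"
    using assms(3) by (auto simp: LPT_with_def)
  have fin: "finite S"
    using L(3) by blast
  have "mset L = mset_set S"
    using mset_set_set[OF L(2)] L(3) by simp
  moreover have "mset (filter (\<lambda>j. j \<notin> S) js) = mset_set (set js - S)"
    using mset_set_set[of "filter (\<lambda>j. j \<notin> S) js"] assms(1)
    by (simp add: set_diff_eq)
  moreover have "mset_set (set js) = mset_set S + mset_set (set js - S)"
    using mset_set_Union[of S "set js - S"] fin assms(2) by (simp add: Un_absorb1)
  moreover have "(\<Sum>h<m. mset (B h)) = mset L + mset (filter (\<lambda>j. j \<notin> S) js)"
    using list_scheduling_mset[OF L(4)] sum_mset_upd[OF L(1), of "\<lambda>_. []" L] by simp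
  ultimately show ?thesis by (simp add: is_schedule_iff_mset)
qed

lemma LPT_REV_is_schedule:
  assumes "distinct js" "LPT_REV m p js B"
  shows "is_schedule m (set js) B"
  using assms(2)
proof cases
  case no_jobs
  then show ?thesis using LPT_is_schedule assms(1) by blast
next
  case (run A1 i c k A2 A3)
  have "{js ! d | d. d \<in> {c + 1 - k..c}} \<subseteq> set js" "{js ! c} \<subseteq> set js"
    using \<open>c < length js\<close> by auto
  then have "is_schedule m (set js) A1" "is_schedule m (set js) A2" "is_schedule m (set js) A3"
    using LPT_is_schedule[OF assms(1) run(1)] LPT_with_is_schedule[OF assms(1) _ run(8)]
      LPT_with_is_schedule[OF assms(1) _ run(9)] by simp_all
  with \<open>B \<in> {A1, A2, A3}\<close> show ?thesis by blast
qed


section \<open>An implementation with step counting\<close>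

text \<open>
  A computation returns its result together with the number of steps taken.  Every call of one
  of the functions below is charged one step by \<open>tick\<close>; besides these calls, the body of
  each function performs only a bounded number of comparisons, additions, look-ups of
  processing times and constructor applications or matches.
\<close>

type_synonym 'a timed = "'a \<times> nat"

definition ret :: "'a \<Rightarrow> 'a timed" where
  "ret x = (x, 0)"

definition tick :: "unit timed" where
  "tick = ((), 1)"

definition bind_timed :: "'a timed \<Rightarrow> ('a \<Rightarrow> 'b timed) \<Rightarrow> 'b timed" where
  "bind_timed t f = (case t of (x, a) \<Rightarrow> case f x of (y, b) \<Rightarrow> (y, a + b))"

adhoc_overloading Monad_Syntax.bind \<rightleftharpoons> bind_timed

abbreviation result :: "'a timed \<Rightarrow> 'a" where "result \<equiv> fst"
abbreviation steps :: "'a timed \<Rightarrow> nat" where "steps \<equiv> snd"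

fun count_jobs :: "job list \<Rightarrow> nat timed" where
  "count_jobs [] = do { tick; ret 0 }"
| "count_jobs (_ # js) = do { tick; n \<leftarrow> count_jobs js; ret (n + 1) }"

fun merge :: "(job \<Rightarrow> real) \<Rightarrow> job list \<Rightarrow> job list \<Rightarrow> job list timed" where
  "merge p [] ys = do { tick; ret ys }"
| "merge p (x # xs) [] = do { tick; ret (x # xs) }"
| "merge p (x # xs) (y # ys) = do {
     tick;
     if p y \<le> p x
     then do { zs \<leftarrow> merge p xs (y # ys); ret (x # zs) }
     else do { zs \<leftarrow> merge p (x # xs) ys; ret (y # zs) } }"

text \<open>\<open>merge_sort p n xs\<close> sorts the first \<open>n\<close> elements of \<open>xs\<close> and also returns the rest.\<close>

function merge_sort :: "(job \<Rightarrow> real) \<Rightarrow> nat \<Rightarrow> job list \<Rightarrow> (job list \<times> job list) timed" where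
  "merge_sort p n xs = do {
     tick;
     if n = 0 then ret ([], xs)
     else if n = 1 then (case xs of [] \<Rightarrow> ret ([], []) | x # xs' \<Rightarrow> ret ([x], xs'))
     else do {
       (as, ys) \<leftarrow> merge_sort p (n div 2) xs;
       (bs, zs) \<leftarrow> merge_sort p (n - n div 2) ys;
       cs \<leftarrow> merge p as bs;
       ret (cs, zs) } }"
  by pat_completeness auto
termination
  by (relation "measure (\<lambda>(p, n, xs). n)") auto

declare merge_sort.simps [simp del]

text \<open>A machine is represented by its load and its jobs, most recently assigned job first.\<close>

type_synonym machine = "real \<times> job list"

fun empty_machines :: "nat \<Rightarrow> machine list timed" where
  "empty_machines 0 = do { tick; ret [] }"
| "empty_machines (Suc m) = do { tick; ms \<leftarrow> empty_machines m; ret ((0, []) # ms) }"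

fun total_time :: "(job \<Rightarrow> real) \<Rightarrow> job list \<Rightarrow> real timed" where
  "total_time p [] = do { tick; ret 0 }"
| "total_time p (j # js) = do { tick; s \<leftarrow> total_time p js; ret (p j + s) }"

fun min_load :: "machine list \<Rightarrow> real timed" where
  "min_load [] = do { tick; ret 0 }"
| "min_load [(l, _)] = do { tick; ret l }"
| "min_load ((l, _) # M # ms) = do {
     tick; l' \<leftarrow> min_load (M # ms); ret (if l \<le> l' then l else l') }"

fun max_load :: "machine list \<Rightarrow> real timed" where
  "max_load [] = do { tick; ret 0 }"
| "max_load [(l, _)] = do { tick; ret l }"
| "max_load ((l, _) # M # ms) = do {
     tick; l' \<leftarrow> max_load (M # ms); ret (if l' \<le> l then l else l') }"

text \<open>\<open>assign p j l\<^sub>0\<close> puts \<open>j\<close> on the first machine of load at most \<open>l\<^sub>0\<close>.\<close>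

fun assign :: "(job \<Rightarrow> real) \<Rightarrow> job \<Rightarrow> real \<Rightarrow> machine list \<Rightarrow> machine list timed" where
  "assign p j l\<^sub>0 [] = do { tick; ret [] }"
| "assign p j l\<^sub>0 ((l, js) # ms) = do {
     tick;
     if l \<le> l\<^sub>0 then ret ((l + p j, j # js) # ms)
     else do { ms' \<leftarrow> assign p j l\<^sub>0 ms; ret ((l, js) # ms') } }"

fun ls :: "(job \<Rightarrow> real) \<Rightarrow> machine list \<Rightarrow> job list \<Rightarrow> machine list timed" where
  "ls p ms [] = do { tick; ret ms }"
| "ls p ms (j # js) = do {
     tick; l \<leftarrow> min_load ms; ms' \<leftarrow> assign p j l ms; ls p ms' js }"

definition lpt_with :: "nat \<Rightarrow> (job \<Rightarrow> real) \<Rightarrow> job list \<Rightarrow> job list \<Rightarrow> machine list timed" where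
  "lpt_with m p block js = do {
     tick;
     l \<leftarrow> total_time p block;
     ms \<leftarrow> empty_machines (m - 1);
     ls p ((l, block) # ms) js }"

fun critical_machine :: "real \<Rightarrow> machine list \<Rightarrow> job list option timed" where
  "critical_machine z [] = do { tick; ret None }"
| "critical_machine z ((l, js) # ms) = do {
     tick; if l = z \<and> js \<noteq> [] then ret (Some js) else critical_machine z ms }"

text \<open>
  \<open>split_at j [] js\<close> returns the jobs of \<open>js\<close> before \<open>j\<close> in reversed order, and the jobs
  after \<open>j\<close>.
\<close>

fun split_at :: "job \<Rightarrow> job list \<Rightarrow> job list \<Rightarrow> (job list \<times> job list) timed" where
  "split_at j pre [] = do { tick; ret (pre, []) }"
| "split_at j pre (x # xs) = do {
     tick; if x = j then ret (pre, xs) else split_at j (x # pre) xs }"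

text \<open>\<open>move n xs ys\<close> moves the first \<open>n\<close> elements of \<open>xs\<close> one by one to the front of \<open>ys\<close>.\<close>

fun move :: "nat \<Rightarrow> job list \<Rightarrow> job list \<Rightarrow> (job list \<times> job list) timed" where
  "move 0 xs ys = do { tick; ret (xs, ys) }"
| "move (Suc n) [] ys = do { tick; ret ([], ys) }"
| "move (Suc n) (x # xs) ys = do { tick; move n xs (x # ys) }"

fun rev_append :: "job list \<Rightarrow> job list \<Rightarrow> job list timed" where
  "rev_append [] ys = do { tick; ret ys }"
| "rev_append (x # xs) ys = do { tick; rev_append xs (x # ys) }"

definition lpt_rev :: "nat \<Rightarrow> (job \<Rightarrow> real) \<Rightarrow> job list \<Rightarrow> machine list timed" where
  "lpt_rev m p J = do {
     tick;
     n \<leftarrow> count_jobs J;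
     (js, _) \<leftarrow> merge_sort p n J;
     ms \<leftarrow> empty_machines m;
     ms1 \<leftarrow> ls p ms js;
     z1 \<leftarrow> max_load ms1;
     crit \<leftarrow> critical_machine z1 ms1;
     case crit of
       None \<Rightarrow> ret ms1
     | Some [] \<Rightarrow> ret ms1
     | Some (j # on_machine_before) \<Rightarrow> do {
         (pre, post) \<leftarrow> split_at j [] js;
         rest2 \<leftarrow> rev_append pre post;
         ms2 \<leftarrow> lpt_with m p [j] rest2;
         z2 \<leftarrow> max_load ms2;
         k' \<leftarrow> count_jobs on_machine_before;
         (pre', block) \<leftarrow> move k' pre [j];
         rest3 \<leftarrow> rev_append pre' post;
         ms3 \<leftarrow> lpt_with m p block rest3;
         z3 \<leftarrow> max_load ms3;
         ret (if z1 \<le> z2 \<and> z1 \<le> z3 then ms1 else if z2 \<le> z3 then ms2 else ms3) } }"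

definition schedule_of :: "machine list \<Rightarrow> schedule" where
  "schedule_of ms i = (if i < length ms then snd (ms ! i) else [])"

end

theory Submission
  imports Defs
begin

text \<open>
  Scale the optimum to 1 and let \<open>q\<close> be the size of the critical job \<open>c\<close> of a failing \<open>LPT\<close>
  schedule, \<open>s\<close> the load under \<open>c\<close>.  Averaging gives \<open>q > threshold m \<ge> 1/4\<close>, and shows that
  every job after \<open>c\<close> is at most \<open>threshold m\<close>, hence harmless in all three schedules; so only the
  jobs up to \<open>c\<close> matter.  Moreover \<open>q \<le> 1/3\<close>.  The target ratio is the averaging bound for \<open>m - 1\<close>
  machines, so every optimal machine load exceeds every \<open>LPT\<close> load before \<open>c\<close>; this forces
  optimal machines to carry two or three jobs and \<open>LPT\<close> machines at least two.

  If there are at least two optimal triples, averaging gives a contradiction for \<open>m \<ge> 5\<close>, and a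
  pigeonhole argument on the \<open>LPT\<close> pairs does for \<open>m \<le> 4\<close>.  So there is exactly one triple and
  \<open>2 * m + 1\<close> jobs, and \<open>LPT\<close> consists of pairs before \<open>c\<close>.  If \<open>c\<close> is not in the triple, \<open>LPT'\<close>
  succeeds; otherwise \<open>LPT''\<close> does.  Both claims are proved by counting jobs with weight 2 if they
  are at least as large as the load under the critical job of the respective schedule, and with
  weight 1 otherwise: an optimal pair or singleton has weight at most 2, the triple at most 1.
\<close>

section \<open>Greedy schedules and averaging\<close>

text \<open>The ratio is Graham's bound for \<open>m - 1\<close> machines: averaging over
  \<open>l\<close> machines with a last job of size \<open>q\<close> gives
  \<open>1 + (1 - 1/l) * q\<close>, and \<open>l = m - 1\<close>, \<open>q = 1/3\<close> yields
  \<open>1 + excess m\<close>. The weights encode that a load of at least \<theta> consists of one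
  heavy job or of two jobs. Because of its triple the optimum has room for weight
  \<open>2 * m - 1\<close> only, while a greedy schedule with weight 2 on every machine and one more
  job needs \<open>2 * m + 1\<close>. The block spoils this count on its own machine. In LPT' that
  machine still holds a job besides \<open>c\<close>, so the loss is 1 and a contradiction remains;
  in LPT'' the loss may be 2 and the count is merely tight, which forces a parity argument. The
  weight bounds require the overflowing job to exceed \<open>excess m + q\<close>, which holds once
  some machine carries a single job at that moment. For LPT'' the number of jobs guarantees such a
  machine; for LPT' the remaining case is argued separately. The block of LPT'' has three jobs
  because the critical machine holds a pair below \<open>c\<close>; being no larger than the triple,
  it fits on one machine.\<close>

text \<open>An assignment \<open>f\<close> of jobs to machines that arises by placing the block \<open>S\<close> first and then
  scheduling the other jobs greedily in the order of their positions \<open>ix\<close>.\<close>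

definition greedy :: "nat \<Rightarrow> ('a \<Rightarrow> real) \<Rightarrow> ('a \<Rightarrow> nat) \<Rightarrow> 'a set \<Rightarrow> 'a set \<Rightarrow> ('a \<Rightarrow> nat) \<Rightarrow> bool" where
  "greedy m p ix S J f \<longleftrightarrow> (\<forall>y\<in>J - S. \<forall>k<m.
     sum p {j \<in> J. (j \<in> S \<or> ix j < ix y) \<and> f j = f y} \<le> sum p {j \<in> J. (j \<in> S \<or> ix j < ix y) \<and> f j = k})"

text \<open>The approximation ratio is \<open>1 + excess m\<close>; a critical job of size at most \<open>threshold m\<close>
  respects it by averaging alone.\<close>

definition excess :: "nat \<Rightarrow> real" where
  "excess m = (real m - 2) / (3 * (real m - 1))"

definition threshold :: "nat \<Rightarrow> real" where
  "threshold m = real m * (real m - 2) / (3 * (real m - 1)\<^sup>2)"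

text \<open>The bound \<open>1/4\<close> is attained at \<open>m = 3\<close>; it keeps a fourth job
  of size at least \<open>q\<close> off every optimal machine. The last identity is the origin of
  \<open>threshold m\<close>: the size \<open>r\<close> at which \<open>(1 - 1/m) * r\<close> equals
  \<open>excess m\<close>.\<close>

lemma excess_bounds:
  assumes "m \<ge> 3"
  shows "excess m \<ge> 1/6" "excess m < 1/3" "threshold m \<ge> 1/4" "excess m * (real m - 1) = (real m - 2) / 3"
    "threshold m * (real m - 1) = excess m * real m"
proof -
  have M: "real m \<ge> 3" using assms by simp
  show "excess m \<ge> 1/6" "excess m < 1/3" using M unfolding excess_def by (simp_all add: field_simps)
  show "excess m * (real m - 1) = (real m - 2) / 3" using M unfolding excess_def by (simp add: field_simps)
  show "threshold m * (real m - 1) = excess m * real m" using M unfolding threshold_def excess_def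
    by (simp add: divide_simps power2_eq_square)
  have "real m * (real m - 2) * 4 - 3 * (real m - 1)\<^sup>2 = (real m - 3) * (real m + 1)"
    by (simp add: power2_eq_square algebra_simps)
  moreover have "(real m - 3) * (real m + 1) \<ge> 0" using M by simp
  ultimately have "real m * (real m - 2) * 4 \<ge> 3 * (real m - 1)\<^sup>2" by linarith
  then show "threshold m \<ge> 1/4" using M unfolding threshold_def by (simp add: field_simps)
qed

text \<open>Amounts to \<open>(m - 1)^3 \<le> m^2 * (m - 2)\<close>, with difference
  \<open>m * (m - 3) + 1\<close>. It serves to exclude a second job above the threshold behind the
  critical one.\<close>

lemma threshold_ge:
  assumes "m \<ge> 3"
  shows "real m * threshold m \<ge> (real m - 1) / 3"
proof -
  have M: "real m \<ge> 3" using assms by simp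
  have "real m * (real m * (real m - 2)) - (real m - 1) ^ 3 = real m * (real m - 3) + 1"
    by (simp add: power3_eq_cube algebra_simps)
  moreover have "real m * (real m - 3) \<ge> 0" using M by simp
  ultimately have "(real m - 1) ^ 3 \<le> real m * (real m * (real m - 2))" by linarith
  then have "(real m - 1) ^ 3 / (3 * (real m - 1)\<^sup>2) \<le> real m * (real m * (real m - 2)) / (3 * (real m - 1)\<^sup>2)"
    by (intro divide_right_mono) auto
  moreover have "(real m - 1) ^ 3 / (3 * (real m - 1)\<^sup>2) = (real m - 1) / 3"
    using M by (simp add: power3_eq_cube power2_eq_square)
  ultimately show ?thesis by (simp add: threshold_def)
qed

lemma excess_bounds4: "excess 4 = 2/9" "threshold 4 = 8/27"
  by (simp_all add: excess_def threshold_def)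

section \<open>Counting and summing over machines\<close>

lemma sum_by_machine:
  assumes "finite K" "\<And>j. j \<in> K \<Longrightarrow> f j < (m::nat)"
  shows "sum w K = (\<Sum>h<m. sum w {j\<in>K. f j = h})"
proof -
  have "f ` K \<subseteq> {..<m}" using assms(2) by auto
  from sum.group[OF assms(1) _ this, of w] show ?thesis by simp
qed

lemma card_by_machine:
  assumes "finite K" "\<And>j. j \<in> K \<Longrightarrow> f j < (m::nat)"
  shows "card K = (\<Sum>h<m. card {j\<in>K. f j = h})"
  using sum_by_machine[of K f m "\<lambda>_. 1::nat"] assms by simp

lemma sum_le_all_eq:
  fixes f g :: "nat \<Rightarrow> nat"
  assumes "\<And>h. h < m \<Longrightarrow> f h \<le> g h" "sum g {..<m} \<le> sum f {..<m}" "h < m"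
  shows "f h = g h"
  using sum_mono_inv[of f "{..<m}" g h] assms sum_mono[of "{..<m}" f g] by force

lemma card2E:
  assumes "card A = 2" "x \<in> A"
  obtains y where "A = {x, y}" "x \<noteq> y"
  using assms by (auto simp: card_2_iff)

lemma card_le_1E:
  assumes "finite A" "A \<noteq> {}" "card A \<le> 1"
  obtains x where "A = {x}"
proof -
  have "card A = 1" using assms by (simp add: le_antisym Suc_le_eq card_gt_0_iff)
  then show ?thesis using that by (auto simp: card_1_singleton_iff)
qed

text \<open>The common part cancels. What remains are two sets of equal size, separated by the
  largest value \<open>\<mu>\<close> on \<open>S - X\<close>.\<close>

lemma sum_le_last:
  fixes p :: "'a \<Rightarrow> real"
  assumes "finite S" "finite X" "card S = card X" "\<And>j k. j \<in> X - S \<Longrightarrow> k \<in> S \<Longrightarrow> p k \<le> p j"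
  shows "sum p S \<le> sum p X"
proof -
  have c: "card (S - X) = card (X - S)"
    using assms(1-3) card_Int_Diff[of S X] card_Int_Diff[of X S] by (simp add: Int_commute)
  have "sum p (S - X) \<le> sum p (X - S)"
  proof (cases "S - X = {}")
    case True
    then have "X - S = {}" using c assms(2) by (metis card_0_eq card.empty finite_Diff)
    then show ?thesis using True by simp
  next
    case False
    define \<mu> where "\<mu> = Max (p ` (S - X))"
    have "\<And>k. k \<in> S - X \<Longrightarrow> p k \<le> \<mu>" using assms(1) by (simp add: \<mu>_def)
    then have "sum p (S - X) \<le> real (card (S - X)) * \<mu>" using sum_bounded_above by blast
    moreover have "\<mu> \<in> p ` (S - X)" unfolding \<mu>_def using False assms(1) by (intro Max_in) auto
    then have "\<And>j. j \<in> X - S \<Longrightarrow> \<mu> \<le> p j" using assms(4) by auto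
    then have "real (card (X - S)) * \<mu> \<le> sum p (X - S)" using sum_bounded_below by blast
    ultimately show ?thesis using c by simp
  qed
  moreover have "sum p S = sum p (S \<inter> X) + sum p (S - X)" using assms(1) by (rule sum.Int_Diff)
  moreover have "sum p X = sum p (S \<inter> X) + sum p (X - S)" using sum.Int_Diff[OF assms(2), of p S] by (simp add: Int_commute)
  ultimately show ?thesis by simp
qed

text \<open>Here \<open>b\<close> is the load under a greedily placed job of size \<open>r\<close>:
  all \<open>m\<close> loads are then at least \<open>b\<close>, and the total is at most
  \<open>m\<close>. Hence \<open>b + r \<le> 1 + (1 - 1/m) * r\<close>, and below the threshold the
  last term is at most \<open>excess m\<close>.\<close>

lemma average_bound:
  assumes "m \<ge> 3" "real m * b + r \<le> real m" "r \<le> threshold m"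
  shows "b + r \<le> 1 + excess m"
proof -
  have M: "real m \<ge> 3" using assms(1) by simp
  have "real m * (b + r) \<le> real m + (real m - 1) * r" using assms(2) by (simp add: algebra_simps)
  also have "(real m - 1) * r \<le> (real m - 1) * threshold m" using assms(3) M by (intro mult_left_mono) auto
  also have "\<dots> = real m * excess m" using excess_bounds(5)[OF assms(1)] by (simp add: mult.commute)
  finally have "real m * (b + r) \<le> real m * (1 + excess m)" by (simp add: algebra_simps)
  then show ?thesis using M by simp
qed

section \<open>A failing LPT schedule\<close>

text \<open>The instance is cut off after the critical job: \<open>c\<close> has the last position,
  so it is a smallest job and all other jobs of \<open>J\<close> are placed before it.\<close>

locale failed_LPT =
  fixes m :: nat and p :: "'a \<Rightarrow> real" and ix :: "'a \<Rightarrow> nat" and J :: "'a set" and c :: 'a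
    and opt lpt :: "'a \<Rightarrow> nat"
  assumes m3: "m \<ge> 3" and fin: "finite J" and cJ: "c \<in> J" and inj: "inj_on ix J"
    and anti: "\<And>j k. j \<in> J \<Longrightarrow> k \<in> J \<Longrightarrow> ix j \<le> ix k \<Longrightarrow> p k \<le> p j"
    and last: "\<And>j. j \<in> J \<Longrightarrow> ix j \<le> ix c"
    and opt_less: "\<And>j. j \<in> J \<Longrightarrow> opt j < m"
    and lpt_less: "\<And>j. j \<in> J \<Longrightarrow> lpt j < m"
    and opt_load: "\<And>h. h < m \<Longrightarrow> sum p {j\<in>J. opt j = h} \<le> 1"
    and lpt_greedy: "greedy m p ix {} J lpt"
    and not_threshold: "threshold m < p c"
    and fails: "1 + excess m < sum p {j\<in>J. lpt j = lpt c}"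
begin

abbreviation "q \<equiv> p c"
abbreviation "\<kappa> \<equiv> excess m"
definition "OPT h = {j\<in>J. opt j = h}"
text \<open>As \<open>c\<close> is last, this is the LPT machine \<open>h\<close> at the moment
  before \<open>c\<close> is placed; \<open>s\<close> is the least of these loads.\<close>

definition "N h = {j\<in>J - {c}. lpt j = h}"
definition "s = sum p (N (lpt c))"

lemma mem_OPT [simp]: "j \<in> OPT h \<longleftrightarrow> j \<in> J \<and> opt j = h"
  by (simp add: OPT_def)

lemma mem_N [simp]: "j \<in> N h \<longleftrightarrow> j \<in> J \<and> j \<noteq> c \<and> lpt j = h"
  by (simp add: N_def)

lemma finO [simp]: "finite (OPT h)" and finN [simp]: "finite (N h)"
  using fin by (auto simp: OPT_def N_def)

lemma sum_OPT: "sum w J = (\<Sum>h<m. sum w (OPT h))"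
  unfolding OPT_def using sum_by_machine[OF fin opt_less] .

lemma sum_N: "sum w J = w c + (\<Sum>h<m. sum w (N h))"
proof -
  have "sum w (J - {c}) = (\<Sum>h<m. sum w (N h))"
    unfolding N_def using fin lpt_less by (intro sum_by_machine) auto
  then show ?thesis using fin cJ by (simp add: sum.remove)
qed

lemma q_le: "j \<in> J \<Longrightarrow> q \<le> p j"
  using anti cJ last by blast

lemma numeric: "\<kappa> \<ge> 1/6" "\<kappa> < 1/3" "q > 1/4" "q > 0"
  using excess_bounds[OF m3] not_threshold by auto

lemma p_pos: "j \<in> J \<Longrightarrow> p j > 0"
  using q_le numeric by force

lemma ix_less: "j \<in> J \<Longrightarrow> j \<noteq> c \<Longrightarrow> ix j < ix c"
  using last[of j] inj cJ by (force simp: inj_on_def)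

lemma sum_le_O:
  assumes "A \<subseteq> OPT h" "h < m"
  shows "sum p A \<le> 1"
proof -
  have "sum p A \<le> sum p (OPT h)"
    using assms p_pos by (intro sum_mono2) (auto simp: less_imp_le)
  then show ?thesis using opt_load[OF assms(2)] by (simp add: OPT_def)
qed

lemma p_le_1: "j \<in> J \<Longrightarrow> p j \<le> 1"
  using sum_le_O[of "{j}" "opt j"] opt_less by auto

lemma s_q: "s + q > 1 + \<kappa>"
proof -
  have "{j\<in>J. lpt j = lpt c} = insert c (N (lpt c))" using cJ by auto
  then have "sum p {j\<in>J. lpt j = lpt c} = q + s" by (simp add: s_def)
  then show ?thesis using fails by simp
qed

lemma s_le: "h < m \<Longrightarrow> s \<le> sum p (N h)"
proof -
  assume "h < m"
  have "{j\<in>J. (j \<in> {} \<or> ix j < ix c) \<and> lpt j = k} = N k" for k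
    using ix_less by auto
  then show ?thesis unfolding s_def using lpt_greedy cJ \<open>h < m\<close> unfolding greedy_def by auto
qed

lemma s_pos: "s > 0"
  using s_q p_le_1[OF cJ] numeric by linarith

lemma opt_pair: "u \<in> J \<Longrightarrow> y \<in> J \<Longrightarrow> u \<noteq> y \<Longrightarrow> opt u = opt y \<Longrightarrow> p u + p y \<le> 1"
  using sum_le_O[of "{u, y}" "opt y"] opt_less by auto

lemma opt_three: "u \<in> J \<Longrightarrow> y \<in> J \<Longrightarrow> e \<in> J \<Longrightarrow> u \<noteq> y \<Longrightarrow> u \<noteq> e \<Longrightarrow> y \<noteq> e \<Longrightarrow>
    opt u = opt y \<Longrightarrow> opt e = opt y \<Longrightarrow> p u + p y + p e \<le> 1"
  using sum_le_O[of "{u, y, e}" "opt y"] opt_less by auto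

lemma card_O_q: "h < m \<Longrightarrow> real (card (OPT h)) * q \<le> 1"
  using sum_bounded_below[of "OPT h" q p] q_le sum_le_O[of "OPT h" h] by force

lemma card_O_le3: "h < m \<Longrightarrow> card (OPT h) \<le> 3"
proof (rule ccontr)
  assume h: "h < m" "\<not> card (OPT h) \<le> 3"
  then have "4 * q \<le> real (card (OPT h)) * q" using numeric by (intro mult_right_mono) auto
  with card_O_q[OF h(1)] numeric show False by linarith
qed

section \<open>Weights of jobs relative to a load level\<close>

definition weight :: "real \<Rightarrow> 'a \<Rightarrow> nat" where
  "weight \<theta> j = (if \<theta> \<le> p j then 2 else 1)"

lemma weight_le2:
  assumes "finite X" "card X \<le> 2" "\<And>u v. u \<in> X \<Longrightarrow> v \<in> X \<Longrightarrow> u \<noteq> v \<Longrightarrow> p u < \<theta>"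
  shows "sum (weight \<theta>) X \<le> 2"
proof -
  consider "card X = 0" | "card X = 1" | "card X = 2" using assms(2) by linarith
  then show ?thesis
  proof cases
    case 3
    then obtain u v where X: "X = {u, v}" "u \<noteq> v" by (auto simp: card_2_iff)
    then show ?thesis using assms(3)[of u v] assms(3)[of v u] by (auto simp: weight_def)
  qed (use assms(1) in \<open>auto simp: card_1_singleton_iff weight_def\<close>)
qed

lemma weight_ge_card: "finite X \<Longrightarrow> card X \<le> sum (weight \<theta>) X"
  using sum_mono[of X "\<lambda>_. 1" "weight \<theta>"] by (simp add: weight_def)

text \<open>A positive load excludes the empty set, a lone job reaching \<open>\<theta>\<close> is
  heavy, and two jobs weigh 2 in any case. This is why heavy jobs count twice.\<close>

lemma weight_ge2:
  assumes "finite X" "sum p X \<ge> \<theta>" "\<theta> > 0"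
  shows "sum (weight \<theta>) X \<ge> 2"
proof -
  consider "card X = 0" | "card X = 1" | "card X \<ge> 2" by linarith
  then show ?thesis
  proof cases
    case 3
    then show ?thesis using weight_ge_card[OF assms(1), of \<theta>] by linarith
  qed (use assms in \<open>auto simp: card_1_singleton_iff weight_def\<close>)
qed

text \<open>If \<open>3 * q > 1\<close>, optimal machines hold at most two jobs, and of two each is
  below \<open>s\<close>, because the other is at least \<open>q\<close> and
  \<open>s > 1 - q\<close>. So the optimum weighs at most \<open>2 * m\<close>, whereas the LPT
  machines before \<open>c\<close> already weigh that much and \<open>c\<close> is left
  over.\<close>

lemma q_third: "q \<le> 1/3"
proof (rule ccontr)
  assume q: "\<not> q \<le> 1/3"
  have "sum (weight s) (OPT h) \<le> 2" if h: "h < m" for h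
  proof (rule weight_le2)
    show "card (OPT h) \<le> 2"
    proof (rule ccontr)
      assume "\<not> card (OPT h) \<le> 2"
      then have "3 * q \<le> real (card (OPT h)) * q" using numeric by (intro mult_right_mono) auto
      with card_O_q[OF h(1)] q show False by linarith
    qed
    show "p u < s" if "u \<in> OPT h" "v \<in> OPT h" "u \<noteq> v" for u v
      using opt_pair[of u v] that q_le[of v] s_q numeric by auto
  qed simp
  then have "sum (weight s) J \<le> (\<Sum>h<m. 2)"
    unfolding sum_OPT by (intro sum_mono) auto
  moreover have "(\<Sum>h<m. sum (weight s) (N h)) \<ge> (\<Sum>h<m. 2)"
    using weight_ge2[OF finN s_le s_pos] by (intro sum_mono) auto
  moreover have "weight s c \<ge> 1" by (simp add: weight_def)
  moreover note sum_N[of "weight s"]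
  ultimately show False by linarith
qed

text \<open>Since \<open>s > 1 + \<kappa> - q\<close>, it suffices that
  \<open>l * \<kappa> \<ge> (l - 1) * q\<close>. For \<open>q = 1/3\<close> this reads
  \<open>l * (m - 2) \<ge> (l - 1) * (m - 1)\<close>, that is \<open>l \<le> m - 1\<close>: the
  ratio is made for the tight case \<open>l = m - 1\<close>. Many later contradictions bound
  \<open>l\<close> sums that reach \<open>s\<close> by \<open>l - q\<close> in total.\<close>

lemma few_machines:
  assumes "1 \<le> l" "l \<le> m - 1"
  shows "real l * s + q > real l"
proof -
  have M: "real m \<ge> 3" "real l \<le> real m - 1" "real l \<ge> 1" using assms m3 by auto
  have "(real m - 1) * (real l * \<kappa> - (real l - 1) * q)
      = real l * ((real m - 2) / 3) - (real m - 1) * (real l - 1) * q"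
    by (simp add: excess_bounds(4)[OF m3, symmetric] algebra_simps)
  also have "\<dots> \<ge> real l * ((real m - 2) / 3) - (real m - 1) * (real l - 1) * (1/3)"
    using M q_third by (intro diff_left_mono mult_left_mono) auto
  also have "real l * ((real m - 2) / 3) - (real m - 1) * (real l - 1) * (1/3) = (real m - 1 - real l) / 3"
    by (simp add: field_simps)
  also have "\<dots> \<ge> 0" using M by simp
  finally have "(real m - 1) * (real l * \<kappa> - (real l - 1) * q) \<ge> 0" .
  then have "real l * \<kappa> - (real l - 1) * q \<ge> 0"
    using M mult_pos_neg[of "real m - 1" "real l * \<kappa> - (real l - 1) * q"] by linarith
  moreover have "real l * (s + q) > real l * (1 + \<kappa>)" using s_q M by simp
  ultimately show ?thesis by (simp add: algebra_simps)
qed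

lemma two_machines: "2 * s + q > 2"
  using few_machines[of 2] m3 by simp

lemma s_q_1: "s + q > 1"
  using s_q numeric by linarith

section \<open>Comparing LPT loads with optimal loads\<close>

lemma total_le: "sum p J \<le> real m"
  using sum_mono[of "{..<m}" "\<lambda>h. sum p (OPT h)" "\<lambda>_. 1"] sum_le_O by (auto simp: sum_OPT[of p])

lemma N_sum_ge:
  assumes "h < m"
  shows "(\<Sum>k<m. sum p (N k)) \<ge> (real m - 1) * s + sum p (N h)"
proof -
  have "card ({..<m} - {h}) = m - 1" using assms by simp
  then have "(\<Sum>k\<in>{..<m} - {h}. s) = (real m - 1) * s" using m3 by (simp add: of_nat_diff)
  moreover have "(\<Sum>k\<in>{..<m} - {h}. sum p (N k)) \<ge> (\<Sum>k\<in>{..<m} - {h}. s)"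
    by (intro sum_mono s_le) auto
  moreover have "(\<Sum>k<m. sum p (N k)) = sum p (N h) + (\<Sum>k\<in>{..<m} - {h}. sum p (N k))"
    using assms by (simp add: sum.remove)
  ultimately show ?thesis by linarith
qed

text \<open>Otherwise deleting the two machines would leave an instance on \<open>m - 1\<close> machines to which
  the averaging argument for \<open>m - 1\<close> machines applies.\<close>

lemma lpt_load_less_opt_load:
  assumes "h < m" "g < m"
  shows "sum p (N h) < sum p (OPT g)"
proof (rule ccontr)
  assume "\<not> ?thesis"
  then have le: "sum p (OPT g) \<le> sum p (N h)" by simp
  have "sum p J = sum p (OPT g) + (\<Sum>k\<in>{..<m} - {g}. sum p (OPT k))"
    using sum_OPT[of p] assms by (simp add: sum.remove[of "{..<m}" g])
  moreover have "(\<Sum>k\<in>{..<m} - {g}. sum p (OPT k)) \<le> (\<Sum>k\<in>{..<m} - {g}. 1)"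
    by (intro sum_mono sum_le_O) auto
  moreover have "(\<Sum>k\<in>{..<m} - {g}. 1) = real m - 1"
    using assms m3 card_Diff_singleton[of g "{..<m}"] by (simp add: of_nat_diff)
  ultimately have "(real m - 1) * s + q \<le> real m - 1"
    using sum_N[of p] N_sum_ge[OF assms(1)] le by linarith
  moreover have "real (m - 1) = real m - 1" using m3 by simp
  moreover have "1 \<le> m - 1" using m3 by simp
  ultimately show False using few_machines[of "m - 1"] by simp
qed

lemma lpt_load_less_1: "h < m \<Longrightarrow> sum p (N h) < 1"
  using lpt_load_less_opt_load[of h h] sum_le_O[of "OPT h" h] by simp

text \<open>A lone job \<open>x\<close> cannot exceed every LPT load: if \<open>x\<close> is not
  \<open>c\<close>, its own LPT machine has load at least \<open>p x\<close>; if
  \<open>x = c\<close>, then \<open>s < q \<le> 1/3\<close> contradicts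
  \<open>s + q > 1\<close>.\<close>

lemma card_O_ge2: "g < m \<Longrightarrow> card (OPT g) \<ge> 2"
proof (rule ccontr)
  assume g: "g < m" "\<not> card (OPT g) \<ge> 2"
  have less: "h < m \<Longrightarrow> sum p (N h) < sum p (OPT g)" for h
    using lpt_load_less_opt_load g by simp
  have "s < sum p (OPT g)" using less lpt_less[OF cJ] by (simp add: s_def)
  consider "card (OPT g) = 0" | "card (OPT g) = 1" using g by linarith
  then show False
  proof cases
    case 1
    then have "OPT g = {}" by (metis card_0_eq finO)
    then show False using \<open>s < sum p (OPT g)\<close> s_pos by simp
  next
    case 2
    then obtain x where x: "OPT g = {x}" by (auto simp: card_1_singleton_iff)
    then have "x \<in> J" using mem_OPT[of x g] by blast
    show False
    proof (cases "x = c")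
      case True
      then show False using \<open>s < sum p (OPT g)\<close> x s_q q_third numeric by simp
    next
      case False
      then have "x \<in> N (lpt x)" using \<open>x \<in> J\<close> by simp
      then have "p x \<le> sum p (N (lpt x))"
        using p_pos by (intro member_le_sum) (auto simp: less_imp_le)
      then show False using less[OF lpt_less[OF \<open>x \<in> J\<close>]] x by simp
    qed
  qed
qed

lemma opt_mate:
  assumes "j \<in> J"
  obtains j' where "j' \<in> J" "j' \<noteq> j" "opt j' = opt j"
proof -
  have "OPT (opt j) \<noteq> {j}" "j \<in> OPT (opt j)"
    using card_O_ge2[OF opt_less[OF assms]] assms by auto
  then obtain j' where "j' \<in> OPT (opt j)" "j' \<noteq> j" by blast
  then show ?thesis using that[of j'] by simp
qed

lemma p_le: "j \<in> J \<Longrightarrow> p j \<le> 1 - q"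
proof -
  assume j: "j \<in> J"
  obtain j' where "j' \<in> J" "j' \<noteq> j" "opt j' = opt j" using opt_mate[OF j] .
  then show ?thesis using opt_pair[of j j'] q_le[of j'] j by simp
qed

text \<open>A lone job has an optimal companion of size at least \<open>q\<close>, so it is at most
  \<open>1 - q\<close>, which is less than \<open>s\<close>.\<close>

lemma card_N_ge2: "h < m \<Longrightarrow> card (N h) \<ge> 2"
proof (rule ccontr)
  assume h: "h < m" "\<not> card (N h) \<ge> 2"
  consider "card (N h) = 0" | "card (N h) = 1" using h by linarith
  then show False
  proof cases
    case 1
    then have "N h = {}" by (metis card_0_eq finN)
    then show False using s_le[OF h(1)] s_pos by simp
  next
    case 2
    then obtain x where x: "N h = {x}" by (auto simp: card_1_singleton_iff)
    then have "x \<in> J" using mem_N[of x h] by blast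
    then have "s \<le> 1 - q" using s_le[OF h(1)] p_le[of x] x by simp
    then show False using s_q_1 by simp
  qed
qed

definition "Triples = {h. h < m \<and> card (OPT h) = 3}"

lemma Triples_finite [simp]: "finite Triples"
  by (simp add: Triples_def)

lemma card_O: "h < m \<Longrightarrow> card (OPT h) = (if h \<in> Triples then 3 else 2)"
  using card_O_le3[of h] card_O_ge2[of h] by (auto simp: Triples_def)

lemma card_J: "card J = 2 * m + card Triples"
proof -
  have "card J = (\<Sum>h<m. card (OPT h))" using sum_OPT[of "\<lambda>_. 1::nat"] by simp
  also have "\<dots> = (\<Sum>h<m. 2 + (if h \<in> Triples then 1 else 0))"
    by (intro sum.cong) (auto simp: card_O)
  also have "\<dots> = 2 * m + (\<Sum>h<m. if h \<in> Triples then 1 else 0)" by (simp only: sum.distrib sum_constant card_lessThan) simp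
  also have "(\<Sum>h<m. if h \<in> Triples then 1 else 0) = card Triples"
    using sum.inter_filter[of "{..<m}" "\<lambda>_. 1::nat" "\<lambda>h. h \<in> Triples"]
    by (simp add: Triples_def)
  finally show ?thesis .
qed

lemma card_J_N: "card J = 1 + (\<Sum>h<m. card (N h))"
  using sum_N[of "\<lambda>_. 1::nat"] by simp

text \<open>LPT places at least \<open>2 * m\<close> jobs before \<open>c\<close>, so
  \<open>J\<close> has more jobs than optimal pairs can hold.\<close>

lemma Triples_ge1: "card Triples \<ge> 1"
proof -
  have "(\<Sum>h<m. 2) \<le> (\<Sum>h<m. card (N h))" using card_N_ge2 by (intro sum_mono) auto
  then show ?thesis using card_J card_J_N by simp
qed

lemma triple_one: "u \<in> J \<Longrightarrow> opt u \<in> Triples \<Longrightarrow> p u + 2 * q \<le> 1"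
proof -
  assume u: "u \<in> J" "opt u \<in> Triples"
  then have "card (OPT (opt u) - {u}) = 2" by (simp add: Triples_def)
  then obtain y e where "OPT (opt u) - {u} = {y, e}" "y \<noteq> e" by (auto simp: card_2_iff)
  then have "y \<in> OPT (opt u) - {u}" "e \<in> OPT (opt u) - {u}" "y \<noteq> e" by blast+
  then show ?thesis using opt_three[of u y e] u q_le[of y] q_le[of e] by auto
qed

lemma triple_two:
  "u \<in> J \<Longrightarrow> y \<in> J \<Longrightarrow> u \<noteq> y \<Longrightarrow> opt u = opt y \<Longrightarrow> opt y \<in> Triples \<Longrightarrow> p u + p y + q \<le> 1"
proof -
  assume u: "u \<in> J" "y \<in> J" "u \<noteq> y" "opt u = opt y" "opt y \<in> Triples"
  then have "card (OPT (opt u) - {u}) = 2" by (simp add: Triples_def)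
  then obtain e where e: "OPT (opt u) - {u} = {y, e}" "y \<noteq> e"
    using card2E[of "OPT (opt u) - {u}" y] u by auto
  then have "e \<in> OPT (opt u) - {u}" by blast
  then show ?thesis using opt_three[of u y e] u q_le[of e] e(2) by auto
qed

subsection \<open>At least two triples\<close>

definition "pair_at h x y \<longleftrightarrow> h < m \<and> N h = {x, y} \<and> ix x < ix y"

definition "initial y = {j\<in>J. ix j \<le> ix y}"

definition "before y h = {j \<in> N h. ix j < ix y}"

lemma mem_initial [simp]: "j \<in> initial y \<longleftrightarrow> j \<in> J \<and> ix j \<le> ix y"
  by (simp add: initial_def)

lemma fin_initial [simp]: "finite (initial y)" and fin_before [simp]: "finite (before y h)"
  using fin by (auto simp: initial_def before_def)

lemma pair_at_exists:
  assumes "h < m" "card (N h) = 2"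
  obtains x y where "pair_at h x y"
proof -
  obtain u v where uv: "N h = {u, v}" "u \<noteq> v" using assms by (auto simp: card_2_iff)
  then have "u \<in> N h" "v \<in> N h" by (simp_all only: insert_iff) auto
  then have "ix u \<noteq> ix v" using uv(2) inj by (metis inj_onD mem_N)
  then consider "ix u < ix v" | "ix v < ix u" by linarith
  then show ?thesis
    using that uv assms(1) unfolding pair_at_def by cases (metis insert_commute)+
qed

lemma pair_atD:
  assumes "pair_at h x y"
  shows "h < m" "x \<in> J" "y \<in> J" "x \<noteq> y" "x \<noteq> c" "y \<noteq> c" "lpt x = h" "lpt y = h" "ix x < ix y" "p y \<le> p x"
    "s \<le> p x + p y" "before y h = {x}"
proof -
  have h: "h < m" "N h = {x, y}" "ix x < ix y" using assms by (auto simp: pair_at_def)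
  then have "x \<in> N h" "y \<in> N h" by (simp_all only: insert_iff) auto
  then have "x \<in> J \<and> x \<noteq> c \<and> lpt x = h" "y \<in> J \<and> y \<noteq> c \<and> lpt y = h" by (simp_all)
  moreover have "x \<noteq> y" using h(3) by blast
  ultimately show "h < m" "x \<in> J" "y \<in> J" "x \<noteq> y" "x \<noteq> c" "y \<noteq> c" "lpt x = h" "lpt y = h" "ix x < ix y"
    using h(1,3) by blast+
  then show "p y \<le> p x" using anti by simp
  show "s \<le> p x + p y" using s_le[OF h(1)] h(2,3) by (cases "x = y") auto
  show "before y h = {x}" using h unfolding before_def by auto
qed

text \<open>When \<open>y\<close> arrives, its machine holds \<open>x\<close> alone, and the greedy
  choice makes this the least load at that moment.\<close>

lemma pair_at_greedy:
  assumes "pair_at h x y" "k < m"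
  shows "p x \<le> sum p (before y k)"
proof -
  note D = pair_atD[OF assms(1)]
  have "{j \<in> J. (j \<in> {} \<or> ix j < ix y) \<and> lpt j = k} = before y k" for k
    using last[OF \<open>y \<in> J\<close>] by (auto simp: before_def)
  moreover from this[of h] have "sum p (before y h) = p x" using D(12) by simp
  ultimately show ?thesis
    using lpt_greedy D(3,8) assms(2) unfolding greedy_def by fastforce
qed

lemma before_nonempty:
  assumes "pair_at h x y" "k < m"
  shows "before y k \<noteq> {}"
  using pair_at_greedy[OF assms] p_pos[of x] pair_atD[OF assms(1)] by auto

lemma card_initial:
  assumes "pair_at h x y"
  shows "card (initial y) = 1 + (\<Sum>k<m. card (before y k))"
proof -
  note D = pair_atD[OF assms]
  have "initial y = insert y {j\<in>J. ix j < ix y}"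
    using D inj by (auto simp: inj_on_def)
  moreover have "y \<notin> {j\<in>J. ix j < ix y}" by simp
  moreover have "card {j\<in>J. ix j < ix y} = (\<Sum>k<m. card {i\<in>{j\<in>J. ix j < ix y}. lpt i = k})"
    using fin lpt_less by (intro card_by_machine) auto
  moreover have "{i\<in>{j\<in>J. ix j < ix y}. lpt i = k} = before y k" for k
    using last[OF \<open>y \<in> J\<close>] by (auto simp: before_def)
  ultimately show ?thesis using fin by simp
qed

text \<open>No machine is empty when \<open>y\<close> arrives. The jobs counted here are at least as
  large as \<open>y\<close>, and there are enough of them for two to share an optimal
  machine.\<close>

lemma card_initial_ge:
  assumes "pair_at h x y"
  shows "card (initial y) \<ge> m + 1"
proof -
  have "card (before y k) \<ge> 1" if "k < m" for k
    using before_nonempty[OF assms that] by (simp add: Suc_le_eq card_gt_0_iff)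
  then have "(\<Sum>k<m. card (before y k)) \<ge> (\<Sum>k<m. 1)" by (intro sum_mono) auto
  then show ?thesis using card_initial[OF assms] by simp
qed

text \<open>The count has no slack: every machine holds exactly one job when \<open>y\<close>
  arrives, and the greedy choice compares \<open>x\<close> with each of them.\<close>

lemma initial_ge_first:
  assumes "pair_at h x y" "card (initial y) = m + 1" "u \<in> initial y" "u \<noteq> y"
  shows "p x \<le> p u"
proof -
  have ge: "card (before y k) \<ge> 1" if "k < m" for k
    using before_nonempty[OF assms(1) that] by (simp add: Suc_le_eq card_gt_0_iff)
  have le: "(\<Sum>k<m. card (before y k)) \<le> (\<Sum>k<m. 1)" using card_initial[OF assms(1)] assms(2) by simp
  have k: "lpt u < m" using assms(3) lpt_less by simp
  have "1 = card (before y (lpt u))"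
    by (rule sum_le_all_eq[OF ge le k])
  moreover have "u \<in> before y (lpt u)"
    using assms inj last[of y] pair_atD[OF assms(1)] by (auto simp: before_def inj_on_def le_less)
  ultimately have "before y (lpt u) = {u}" by (metis card_1_singletonE singletonD)
  then show ?thesis using pair_at_greedy[OF assms(1) k] by simp
qed

text \<open>In this prefix \<open>y\<close> is a smallest job and \<open>x\<close> a next smallest,
  so their sum, which reaches \<open>s\<close> as an LPT load, is the least sum of two jobs.\<close>

lemma initial_sum_ge:
  assumes "pair_at h x y" "card (initial y) = m + 1" "u \<in> initial y" "v \<in> initial y" "u \<noteq> v"
  shows "s \<le> p u + p v"
  using initial_ge_first[OF assms(1,2), of u] initial_ge_first[OF assms(1,2), of v] assms(3-5)
    anti[of u y] anti[of v y] pair_atD[OF assms(1)] by (cases "u = y"; cases "v = y") auto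

text \<open>Machine \<open>h'\<close> has not yet received its second job when \<open>y\<close>
  arrives, so \<open>x\<close> is compared with \<open>x'\<close> alone.\<close>

lemma first_le_first:
  assumes "pair_at h x y" "pair_at h' x' y'" "ix y < ix y'"
  shows "p x \<le> p x'"
proof -
  note D = pair_atD[OF assms(1)] and D' = pair_atD[OF assms(2)]
  have "before y h' \<subseteq> {x'}"
    using assms(2,3) unfolding pair_at_def before_def by auto
  then have "before y h' = {x'}" using before_nonempty[OF assms(1) D'(1)] by blast
  then show ?thesis using pair_at_greedy[OF assms(1) D'(1)] by simp
qed

lemma first_in_initial:
  assumes "pair_at h x y" "pair_at h' x' y'" "ix y < ix y'"
  shows "x' \<in> initial y"
proof -
  have "before y h' \<subseteq> {x'}"
    using assms(2,3) unfolding pair_at_def before_def by auto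
  then have "x' \<in> before y h'" using before_nonempty[OF assms(1)] pair_atD(1)[OF assms(2)] by blast
  then show ?thesis by (auto simp: before_def)
qed

lemma initial_p_ge: "y \<in> J \<Longrightarrow> u \<in> initial y \<Longrightarrow> p y \<le> p u"
  using anti by simp

lemma pigeonhole:
  assumes "U \<subseteq> J" "card U > m"
  obtains u v where "u \<in> U" "v \<in> U" "u \<noteq> v" "opt u = opt v"
proof -
  have "\<not> inj_on opt U"
    using card_inj_on_le[of opt U "{..<m}"] assms opt_less by (auto simp: subset_iff)
  then show ?thesis using that by (auto simp: inj_on_def)
qed

text \<open>A set that never uses a triple twice has room for one job per triple and two per optimal
  pair. The last two claims exploit equality: every triple is met, and every optimal pair lies in
  \<open>U\<close>. It is applied to prefixes \<open>initial y\<close>.\<close>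

lemma spread_le:
  assumes "U \<subseteq> J"
    and spread: "\<forall>u\<in>U. \<forall>v\<in>U. u \<noteq> v \<longrightarrow> opt u = opt v \<longrightarrow> opt v \<notin> Triples"
  shows "card U + card Triples \<le> 2 * m"
    and "card U + card Triples = 2 * m \<Longrightarrow> h \<in> Triples \<Longrightarrow> \<exists>u\<in>U. opt u = h"
    and "card U + card Triples = 2 * m \<Longrightarrow> j \<in> J \<Longrightarrow> opt j \<notin> Triples \<Longrightarrow> j \<in> U"
proof -
  have fU: "finite U" using assms(1) fin finite_subset by blast
  have U: "card U = (\<Sum>h<m. card {u\<in>U. opt u = h})"
    using card_by_machine[OF fU, of opt m] assms(1) opt_less by blast
  have sub: "{u\<in>U. opt u = h} \<subseteq> OPT h" for h using assms(1) by auto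
  have le: "card {u\<in>U. opt u = h} \<le> (if h \<in> Triples then 1 else 2)" if "h < m" for h
  proof (cases "h \<in> Triples")
    case True
    have "finite {u\<in>U. opt u = h}" using fU by simp
    then have "card {u\<in>U. opt u = h} \<le> 1"
      using spread True by (subst One_nat_def, subst card_le_Suc0_iff_eq) auto
    then show ?thesis using True by simp
  next
    case False
    then show ?thesis using card_mono[OF finO sub[of h]] card_O[OF that] by simp
  qed
  have T: "(\<Sum>h<m. if h \<in> Triples then 1 else 2) + card Triples = 2 * m"
  proof -
    have "card Triples = (\<Sum>h<m. if h \<in> Triples then 1 else 0)"
      using sum.inter_filter[of "{..<m}" "\<lambda>_. 1::nat" "\<lambda>h. h \<in> Triples"] by (simp add: Triples_def)
    then have "(\<Sum>h<m. if h \<in> Triples then 1 else 2) + card Triples = (\<Sum>h<m. 2)"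
      by (simp only: sum.distrib[symmetric]) (intro sum.cong, auto)
    then show ?thesis by simp
  qed
  show "card U + card Triples \<le> 2 * m"
    using T U sum_mono[of "{..<m}" "\<lambda>h. card {u\<in>U. opt u = h}" "\<lambda>h. if h \<in> Triples then 1 else 2"] le by simp
  assume eq: "card U + card Triples = 2 * m"
  have all: "card {u\<in>U. opt u = h} = (if h \<in> Triples then 1 else 2)" if "h < m" for h
  proof (rule sum_le_all_eq[of m, OF le _ that])
    show "(\<Sum>h<m. if h \<in> Triples then 1 else 2) \<le> (\<Sum>h<m. card {u\<in>U. opt u = h})"
      using eq T U by linarith
  qed
  show "\<exists>u\<in>U. opt u = h" if "h \<in> Triples"
  proof -
    have "card {u\<in>U. opt u = h} = 1" using all[of h] that by (simp add: Triples_def)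
    then have "{u\<in>U. opt u = h} \<noteq> {}" by (metis card.empty zero_neq_one)
    then show ?thesis by blast
  qed
  show "j \<in> U" if "j \<in> J" "opt j \<notin> Triples"
  proof -
    have "card {u\<in>U. opt u = opt j} = card (OPT (opt j))"
      using all[OF opt_less] card_O[OF opt_less] that by simp
    then have "{u\<in>U. opt u = opt j} = OPT (opt j)" using card_subset_eq[OF finO sub] by blast
    then show ?thesis using that mem_OPT[of j "opt j"] by blast
  qed
qed

lemma non_triple_mate:
  assumes "j \<in> J" "opt j \<notin> Triples"
  obtains j' where "OPT (opt j) = {j, j'}" "j' \<noteq> j" "j' \<in> J" "opt j' = opt j"
proof -
  have "card (OPT (opt j)) = 2" "j \<in> OPT (opt j)" using card_O opt_less assms by auto
  then obtain y where y: "OPT (opt j) = {j, y}" "j \<noteq> y" using card2E by metis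
  then have "y \<in> OPT (opt j)" by blast
  then show ?thesis using that[OF y(1)] y(2) by simp
qed

definition "Pairs = {h. h < m \<and> card (N h) = 2}"

text \<open>There are \<open>2 * m + card Triples - 1\<close> jobs before \<open>c\<close>, and each
  of the \<open>m\<close> machines holds three or more of them unless it is a pair.\<close>

lemma card_Pairs: "card Pairs + card Triples \<ge> m + 1"
proof -
  have "card (N h) + (if h \<in> Pairs then 1 else 0) \<ge> 3" if "h < m" for h
    using card_N_ge2[OF that] that by (auto simp: Pairs_def)
  then have "(\<Sum>h<m. card (N h) + (if h \<in> Pairs then 1 else 0)) \<ge> (\<Sum>h<m. 3)"
    by (intro sum_mono) auto
  moreover have "(\<Sum>h<m. if h \<in> Pairs then 1 else 0) = card Pairs"
    using sum.inter_filter[of "{..<m}" "\<lambda>_. 1::nat" "\<lambda>h. h \<in> Pairs"] by (simp add: Pairs_def)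
  ultimately show ?thesis using card_J card_J_N by (simp add: sum.distrib)
qed

text \<open>Two triples force three jobs, hence load at least \<open>3 * q\<close>, on some LPT
  machine before \<open>c\<close>. Averaging gives \<open>(m - 1) * s + 4 * q \<le> m\<close>, and
  \<open>s > 1 + \<kappa> - q\<close> turns this into \<open>(m - 5) / 3 < (m - 5) * q\<close>,
  impossible for \<open>q \<le> 1/3\<close> from \<open>m = 5\<close> on.\<close>

lemma not_two_triples_large:
  assumes "card Triples \<ge> 2" "m \<ge> 5"
  shows False
proof -
  obtain h where h: "h < m" "card (N h) \<ge> 3"
  proof (rule ccontr)
    assume "\<not> thesis"
    then have "\<not> card (N h) \<ge> 3" if "h < m" for h using that \<open>\<And>h. h < m \<Longrightarrow> 3 \<le> card (N h) \<Longrightarrow> thesis\<close> by blast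
    then have "card (N h) \<le> 2" if "h < m" for h using that by force
    then have "(\<Sum>h<m. card (N h)) \<le> (\<Sum>h<m. 2)" by (intro sum_mono) auto
    then show False using card_J card_J_N assms(1) by simp
  qed
  have "3 * q \<le> real (card (N h)) * q" using h(2) numeric by (intro mult_right_mono) auto
  also have "\<dots> \<le> sum p (N h)" using sum_bounded_below[of "N h" q p] q_le by simp
  finally have "(real m - 1) * s + 3 * q + q \<le> real m"
    using N_sum_ge[OF h(1)] sum_N[of p] total_le by linarith
  moreover have "(real m - 1) * s > (real m - 1) * (1 + \<kappa> - q)"
    using s_q m3 by (intro mult_strict_left_mono) auto
  moreover have "(real m - 1) * (1 + \<kappa> - q) = real m - 1 + (real m - 2) / 3 - (real m - 1) * q"
    by (simp add: excess_bounds(4)[OF m3, symmetric] algebra_simps)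
  moreover have "(real m - 5) * (1 / 3 - q) \<ge> 0" using assms(2) q_third by simp
  ultimately show False by (simp add: algebra_simps diff_divide_distrib)
qed

lemma two_over_triple:
  assumes "y \<in> J" "u \<in> initial y" "v \<in> initial y" "u \<noteq> v" "opt u = opt v" "opt v \<in> Triples"
  shows "2 * p y + q \<le> 1"
  using triple_two[of u v] initial_p_ge[OF assms(1), of u] initial_p_ge[OF assms(1), of v] assms by auto

text \<open>For an LPT pair \<open>x\<close>, \<open>y\<close>, pigeonhole puts two jobs at least as
  large as \<open>y\<close> into one triple, so \<open>2 * p y + q \<le> 1\<close>; the triple of
  \<open>x\<close> gives \<open>p x + 2 * q \<le> 1\<close>. Such a pair cannot reach
  \<open>s\<close>.\<close>

lemma not_all_triples:
  assumes "card Triples = m"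
  shows False
proof -
  have all: "h < m \<Longrightarrow> h \<in> Triples" for h
    using card_subset_eq[of "{..<m}" Triples] assms by (auto simp: Triples_def)
  have "card Pairs > 0" using card_Pairs assms by simp
  then obtain h where h: "h < m" "card (N h) = 2" by (force simp: Pairs_def card_gt_0_iff)
  obtain x y where xy: "pair_at h x y" using pair_at_exists[OF h] .
  note D = pair_atD[OF xy]
  obtain u v where "u \<in> initial y" "v \<in> initial y" "u \<noteq> v" "opt u = opt v"
    using pigeonhole[of "initial y"] card_initial_ge[OF xy] by (auto simp: initial_def)
  then have "2 * p y + q \<le> 1" using two_over_triple[of y u v] D all opt_less by auto
  moreover have "p x + 2 * q \<le> 1" using triple_one D all opt_less by simp
  ultimately show False using D(11) s_q numeric by linarith
qed

text \<open>Two LPT pairs exist; \<open>y1\<close> is the earlier of the second jobs. If two jobs of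
  its prefix shared a triple, \<open>y1\<close> would be too small. Otherwise the prefix takes
  exactly one job from each triple and both jobs of the only optimal pair, which makes the other LPT
  pair too small.\<close>

lemma not_one_opt_pair:
  assumes "card Triples = m - 1"
  shows False
proof -
  have "card Pairs \<ge> 2" using card_Pairs assms m3 by simp
  then obtain h0 h1 where hh: "h0 \<in> Pairs" "h1 \<in> Pairs" "h0 \<noteq> h1"
    by (metis card_le_Suc0_iff_eq card.infinite not_less_eq_eq numeral_2_eq_2 zero_le)
  then obtain x y x' y' where "pair_at h0 x y" "pair_at h1 x' y'"
    using pair_at_exists unfolding Pairs_def by (metis (mono_tags, lifting) mem_Collect_eq)
  moreover have "ix y \<noteq> ix y'"
    using pair_atD[OF calculation(1)] pair_atD[OF calculation(2)] hh inj by (auto simp: inj_on_def)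
  ultimately obtain h0 h1 x0 y0 x1 y1
    where P0: "pair_at h0 x0 y0" and P1: "pair_at h1 x1 y1" and lt: "ix y1 < ix y0"
    by (metis linorder_neqE_nat)
  note D0 = pair_atD[OF P0] and D1 = pair_atD[OF P1]
  have "x0 \<noteq> x1" using D0 D1 lt P0 P1 unfolding pair_at_def by (metis doubleton_eq_iff less_irrefl)
  have x: "p x1 \<le> p x0" using first_le_first[OF P1 P0 lt] .
  have "card {h. h < m \<and> h \<notin> Triples} = 1"
  proof -
    have "{h. h < m \<and> h \<notin> Triples} = {..<m} - Triples" by auto
    moreover have "card ({..<m} - Triples) = m - card Triples"
      by (subst card_Diff_subset) (auto simp: Triples_def)
    ultimately show ?thesis using assms m3 by simp
  qed
  then obtain g where g: "\<And>h. h < m \<Longrightarrow> h \<notin> Triples \<Longrightarrow> h = g"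
    by (force simp: card_1_singleton_iff)
  \<comment> \<open>Either \<open>x0\<close> or \<open>x1\<close> lies in a triple, or both form the
    only optimal pair. In both cases \<open>x1\<close>, the smaller one, cannot complete
    \<open>y1\<close> to \<open>s\<close>.\<close>
  have "opt v \<notin> Triples" if "u \<in> initial y1" "v \<in> initial y1" "u \<noteq> v" "opt u = opt v" for u v
  proof
    assume "opt v \<in> Triples"
    then have 1: "2 * p y1 + q \<le> 1" using two_over_triple[of y1 u v] that D1 by simp
    show False
    proof (cases "opt x0 \<in> Triples \<or> opt x1 \<in> Triples")
      case True
      then have "p x1 + 2 * q \<le> 1" using triple_one[of x0] triple_one[of x1] x D0 D1 by auto
      then show False using 1 D1(11) s_q numeric by linarith
    next
      case False
      then have "opt x0 = opt x1" using g opt_less D0 D1 by metis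
      then have "p x0 + p x1 \<le> 1" using opt_pair \<open>x0 \<noteq> x1\<close> D0 D1 by simp
      then show False using 1 D1(11) x two_machines by linarith
    qed
  qed
  then have spread: "\<forall>u\<in>initial y1. \<forall>v\<in>initial y1. u \<noteq> v \<longrightarrow> opt u = opt v \<longrightarrow> opt v \<notin> Triples"
    by blast
  have U: "initial y1 \<subseteq> J" by (auto simp: initial_def)
  have "card (initial y1) = m + 1"
    using spread_le(1)[OF U spread] card_initial_ge[OF P1] assms m3 by simp
  then have eq: "card (initial y1) + card Triples = 2 * m" using assms m3 by simp
  note sums = initial_sum_ge[OF P1 \<open>card (initial y1) = m + 1\<close>]
  have y0: "y0 \<notin> initial y1" using lt by simp
  then have y0T: "opt y0 \<in> Triples" using spread_le(3)[OF U spread eq D0(3)] by blast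
  then obtain u where u: "u \<in> initial y1" "opt u = opt y0" using spread_le(2)[OF U spread eq] by blast
  then have 1: "p u + p y0 + q \<le> 1" using triple_two[OF _ D0(3) _ u(2) y0T] u(1) y0 U by blast
  show False
  proof (cases "opt x0 \<in> Triples")
    case True
    then have "p x0 + 2 * q \<le> 1" using triple_one D0 by simp
    moreover have "p y1 \<le> p u" using initial_p_ge u D1 by simp
    ultimately show False using 1 x D0(11) D1(11) s_q numeric by linarith
  next
    case False
    \<comment> \<open>The optimal partner \<open>b\<close> of \<open>x0\<close> lies in the prefix.
      Both \<open>x0 + y0\<close> and \<open>b + u\<close> reach \<open>s\<close>, but regrouped
      along the optimal machines they total at most \<open>2 - q\<close>.\<close>
    obtain b where b: "b \<noteq> x0" "b \<in> J" "opt b = opt x0" by (rule non_triple_mate[OF D0(2) False])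
    then have "b \<in> initial y1" using spread_le(3)[OF U spread eq b(2)] False by simp
    moreover have "b \<noteq> u" using b(3) u(2) False y0T by metis
    ultimately have "s \<le> p b + p u" using sums u(1) by blast
    moreover have "p b + p x0 \<le> 1" using opt_pair b D0 by simp
    ultimately show False using 1 D0(11) two_machines by linarith
  qed
qed

text \<open>There are three LPT pairs but only two optimal pairs. First jobs avoid triples, so two
  of them share an optimal machine and the smallest is at most 1/2. Hence the prefix up to the
  earliest second job uses no triple twice and has five or six jobs.\<close>

lemma not_two_triples_4:
  assumes m4: "m = 4" and T: "card Triples = 2"
  shows False
proof -
  \<comment> \<open>The general bounds on \<open>\<kappa>\<close> and \<open>q\<close> are too weak
    here: keeping first jobs out of triples needs \<open>q \<ge> 1/2 - \<kappa>\<close>, and indeed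
    \<open>5/18 < 8/27\<close>.\<close>
  have num: "\<kappa> = 2/9" "q > 8/27" using excess_bounds4 not_threshold m4 by auto
  have three: "3 * s + q > 3" using few_machines[of 3] m4 by simp
  have "card Pairs \<ge> 3" using card_Pairs T m4 by simp
  then obtain H where H: "H \<subseteq> Pairs" "card H = 3" by (meson obtain_subset_with_card_n)
  have "\<forall>h\<in>H. \<exists>xy. pair_at h (fst xy) (snd xy)"
    using H pair_at_exists unfolding Pairs_def by (metis (mono_tags, lifting) fst_conv mem_Collect_eq snd_conv subsetD)
  then obtain xy where xy: "\<And>h. h \<in> H \<Longrightarrow> pair_at h (fst (xy h)) (snd (xy h))" by metis
  have finH: "finite H" using H(2) by (simp add: card_ge_0_finite)
  obtain h2 where h2: "h2 \<in> H" "\<And>h. h \<in> H \<Longrightarrow> ix (snd (xy h2)) \<le> ix (snd (xy h))"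
  proof -
    have "H \<noteq> {}" using H(2) by auto
    then show ?thesis
      using that arg_min_if_finite[OF finH, of "\<lambda>h. ix (snd (xy h))"] by (metis not_le)
  qed
  then have "card (H - {h2}) = 2" using H(2) finH by simp
  then obtain h0 h1 where h01: "H - {h2} = {h0, h1}" "h0 \<noteq> h1" by (auto simp: card_2_iff)
  then have hs: "h0 \<in> H" "h1 \<in> H" "h0 \<noteq> h2" "h1 \<noteq> h2" by auto
  define x0 y0 x1 y1 x2 y2 where
    "x0 = fst (xy h0)" "y0 = snd (xy h0)" "x1 = fst (xy h1)" "y1 = snd (xy h1)" "x2 = fst (xy h2)" "y2 = snd (xy h2)"
  note defs = this
  have P0: "pair_at h0 x0 y0" and P1: "pair_at h1 x1 y1" and P2: "pair_at h2 x2 y2"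
    using xy[OF hs(1)] xy[OF hs(2)] xy[OF h2(1)] by (simp_all only: defs)
  note D0 = pair_atD[OF P0] and D1 = pair_atD[OF P1] and D2 = pair_atD[OF P2]
  have ne: "x0 \<noteq> x1" "x0 \<noteq> x2" "x1 \<noteq> x2" "y0 \<noteq> y1" "y0 \<noteq> y2" "y1 \<noteq> y2"
    using D0(7,8) D1(7,8) D2(7,8) hs h01(2) by metis+
  have lt: "ix y2 < ix y0" "ix y2 < ix y1"
    using h2(2)[OF hs(1)] h2(2)[OF hs(2)] ne(5,6) inj_onD[OF inj _ D2(3) D0(3)] inj_onD[OF inj _ D2(3) D1(3)]
    by (auto simp: defs[symmetric] le_less)
  have x: "p x2 \<le> p x0" "p x2 \<le> p x1"
    using first_le_first[OF P2 P0 lt(1)] first_le_first[OF P2 P1 lt(2)] .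
  have xT: "opt x' \<notin> Triples" if P: "pair_at h' x' y'" for h' x' y'
  proof
    note D = pair_atD[OF P]
    assume "opt x' \<in> Triples"
    then have "p x' + 2 * q \<le> 1" using triple_one D by simp
    moreover obtain u v where uv: "u \<in> initial y'" "v \<in> initial y'" "u \<noteq> v" "opt u = opt v"
      using pigeonhole[of "initial y'"] card_initial_ge[OF P] by (auto simp: initial_def)
    then have "2 * p y' \<le> 1"
      using opt_pair[of u v] initial_p_ge[of y' u] initial_p_ge[of y' v] D by simp
    ultimately show False using D(11) s_q num by linarith
  qed
  note xT0 = xT[OF P0] and xT1 = xT[OF P1] and xT2 = xT[OF P2]
  have "card ({..<m} - Triples) = 2"
  proof -
    have "Triples \<subseteq> {..<m}" by (auto simp: Triples_def)
    from card_Diff_subset[OF Triples_finite this] show ?thesis using T m4 by simp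
  qed
  then obtain g g' where g: "{..<m} - Triples = {g, g'}" "g \<noteq> g'" by (auto simp: card_2_iff)
  then have gg: "opt j = g \<or> opt j = g'" if "j \<in> J" "opt j \<notin> Triples" for j
    using opt_less[OF that(1)] that by blast
  have share: "opt x0 = opt x1 \<or> opt x0 = opt x2 \<or> opt x1 = opt x2"
    using gg[OF D0(2) xT0] gg[OF D1(2) xT1] gg[OF D2(2) xT2] by metis
  have x2_half: "2 * p x2 \<le> 1"
    using share opt_pair[OF D0(2) D1(2) ne(1)] opt_pair[OF D0(2) D2(2) ne(2)]
      opt_pair[OF D1(2) D2(2) ne(3)] x by linarith
  have "opt v \<notin> Triples" if "u \<in> initial y2" "v \<in> initial y2" "u \<noteq> v" "opt u = opt v" for u v
    using two_over_triple[OF D2(3) that] D2(11) x2_half two_machines by linarith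
  then have spread: "\<forall>u\<in>initial y2. \<forall>v\<in>initial y2. u \<noteq> v \<longrightarrow> opt u = opt v \<longrightarrow> opt v \<notin> Triples"
    by blast
  have U: "initial y2 \<subseteq> J" by (auto simp: initial_def)
  have yU: "y0 \<notin> initial y2" "y1 \<notin> initial y2" using lt by auto
  have U_ge: "s \<le> p x2 + p u" "p y2 \<le> p u" if "u \<in> initial y2" for u
    using initial_p_ge[OF D2(3) that] D2(11) by auto
  have xU: "x0 \<in> J \<and> x1 \<in> J \<and> x2 \<in> initial y2" using D0 D1 D2 by simp
  text \<open>The recurring contradiction: \<open>e\<close> is the partner of \<open>x'\<close> in the optimal schedule and
    \<open>u\<close> shares a triple with \<open>y'\<close>.\<close>
  have clash: False
    if "pair_at h' x' y'" "e \<in> J" "e \<noteq> x'" "opt e = opt x'" "u \<in> J" "u \<noteq> y'" "opt u = opt y'"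
      "opt y' \<in> Triples" "s \<le> p e + p u" for h' x' y' e u
  proof -
    note D = pair_atD[OF that(1)]
    have "p e + p x' \<le> 1" using opt_pair that D by simp
    moreover have "p u + p y' + q \<le> 1" using triple_two that D by simp
    ultimately show False using that(9) D(11) two_machines by linarith
  qed
  have "card (initial y2) = 5 \<or> card (initial y2) = 6"
    using spread_le(1)[OF U spread] card_initial_ge[OF P2] T m4 by linarith
  then show False
  proof
    \<comment> \<open>Without slack, \<open>y0\<close> and \<open>y1\<close> lie in triples that
      meet the prefix, and any optimal machine shared by two first jobs yields a clash.\<close>
    assume "card (initial y2) = 6"
    then have eq: "card (initial y2) + card Triples = 2 * m" using T m4 by simp
    have ex: "opt y' \<in> Triples \<and> (\<exists>u\<in>initial y2. opt u = opt y')" if "y' \<in> J" "y' \<notin> initial y2" for y'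
      using spread_le(2,3)[OF U spread eq] that by blast
    obtain u0 where u0: "opt y0 \<in> Triples" "u0 \<in> initial y2" "opt u0 = opt y0" using ex[OF D0(3) yU(1)] by blast
    obtain u1 where u1: "opt y1 \<in> Triples" "u1 \<in> initial y2" "opt u1 = opt y1" using ex[OF D1(3) yU(2)] by blast
    have "u0 \<noteq> y0" "u1 \<noteq> y1" using u0 u1 yU by auto
    have "opt x1 \<noteq> opt x0"
    proof
      assume "opt x1 = opt x0"
      moreover have "s \<le> p x1 + p u0" using U_ge(1)[OF u0(2)] x by linarith
      ultimately show False
        using clash[OF P0 D1(2) _ _ _ \<open>u0 \<noteq> y0\<close> u0(3,1)] ne u0(2) U by blast
    qed
    moreover have "opt x2 \<noteq> opt x0"
      using clash[OF P0 D2(2) _ _ _ \<open>u0 \<noteq> y0\<close> u0(3,1) U_ge(1)[OF u0(2)]] ne u0(2) U by blast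
    moreover have "opt x2 \<noteq> opt x1"
      using clash[OF P1 D2(2) _ _ _ \<open>u1 \<noteq> y1\<close> u1(3,1) U_ge(1)[OF u1(2)]] ne u1(2) U by blast
    ultimately show False using share by metis
  next
    assume c5: "card (initial y2) = 5"
    then have sums: "s \<le> p u + p v" if "u \<in> initial y2" "v \<in> initial y2" "u \<noteq> v" for u v
      using initial_sum_ge[OF P2 _ that] m4 by simp
    \<comment> \<open>The four jobs of the two optimal pairs: the three first jobs and one more,
      \<open>w\<close>. The cases differ in whether \<open>w\<close> lies in the prefix.\<close>
    define W where "W = OPT g \<union> OPT g'"
    have W: "j \<in> W \<longleftrightarrow> j \<in> J \<and> opt j \<notin> Triples" for j
      using gg g opt_less by (auto simp: W_def)
    have "g < m \<and> g \<notin> Triples" "g' < m \<and> g' \<notin> Triples" using g(1) by blast+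
    then have "card (OPT g) = 2" "card (OPT g') = 2" using card_O by simp_all
    moreover have "OPT g \<inter> OPT g' = {}" using g(2) by auto
    ultimately have cardW: "card W = 4" unfolding W_def by (simp add: card_Un_disjoint)
    have finW: "finite W" by (simp add: W_def)
    have xW: "{x0, x1, x2} \<subseteq> W" using W D0(2) D1(2) D2(2) xT0 xT1 xT2 by simp
    have "card {x0, x1, x2} = 3" using ne by simp
    then have "card (W - {x0, x1, x2}) = 1" using cardW xW card_Diff_subset[OF _ xW] by simp
    then obtain w where w: "W - {x0, x1, x2} = {w}" by (auto simp: card_1_singleton_iff)
    then have "W = {x0, x1, x2, w}" using xW by blast
    have "w \<in> W - {x0, x1, x2}" using w by blast
    then have wJ: "w \<in> J" "opt w \<notin> Triples" "w \<noteq> x0" "w \<noteq> x1" "w \<noteq> x2" using W[of w] by blast+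
    have two_each: "\<not> (opt x0 = opt x1 \<and> opt x1 = opt x2)"
    proof
      assume "opt x0 = opt x1 \<and> opt x1 = opt x2"
      then have "{x0, x1, x2} \<subseteq> OPT (opt x0)" using D0(2) D1(2) D2(2) by auto
      then have "card {x0, x1, x2} \<le> card (OPT (opt x0))" by (intro card_mono finO)
      then show False using card_O[OF opt_less[OF D0(2)]] xT0 ne by simp
    qed
    have wmate: "opt x' = opt w"
      if "opt x'' = opt x'''" "{x', x'', x'''} = {x0, x1, x2}" for x' x'' x'''
    proof -
      have "x' \<in> {x0, x1, x2}" using that(2) by blast
      then have x': "x' \<in> J" "opt x' \<notin> Triples" using D0(2) D1(2) D2(2) xT0 xT1 xT2 by blast+
      obtain j where j: "j \<noteq> x'" "j \<in> J" "opt j = opt x'" by (rule non_triple_mate[OF x'])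
      then have "j \<in> {x0, x1, x2, w}" using \<open>W = {x0, x1, x2, w}\<close> W x' by metis
      then have "j = w \<or> j = x'' \<or> j = x'''" using that(2) j(1) by blast
      moreover have "opt x' \<noteq> opt x''" using two_each that
        by (metis (no_types, lifting) insertCI insertE singletonD)
      ultimately show ?thesis using j(3) that(1) by metis
    qed
    have x01U: "x0 \<in> initial y2" "x1 \<in> initial y2"
      using first_in_initial[OF P2 P0 lt(1)] first_in_initial[OF P2 P1 lt(2)] .
    show False
    proof (cases "w \<in> initial y2")
      case True
      then have WU: "W \<subseteq> initial y2" using \<open>W = {x0, x1, x2, w}\<close> x01U xU by simp
      then have "card (initial y2 - W) = 1" using c5 cardW finW by (simp add: card_Diff_subset)
      then obtain u where "initial y2 - W = {u}" by (auto simp: card_1_singleton_iff)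
      then have u: "u \<in> initial y2" "u \<notin> W" by auto
      then have uT: "u \<in> J" "opt u \<in> Triples" using W by auto
      obtain e0 where e0: "e0 \<noteq> x0" "e0 \<in> J" "opt e0 = opt x0" by (rule non_triple_mate[OF D0(2) xT0])
      obtain e1 where e1: "e1 \<noteq> x1" "e1 \<in> J" "opt e1 = opt x1" by (rule non_triple_mate[OF D1(2) xT1])
      have eU: "e0 \<in> initial y2" "e1 \<in> initial y2" using W[of e0] W[of e1] WU e0 e1 xT0 xT1 by (simp_all add: subset_iff)
      have y: "opt y0 \<in> Triples" "opt y1 \<in> Triples" using W WU yU D0(3) D1(3) by blast+
      have "opt u \<noteq> opt y0"
      proof
        assume eq: "opt u = opt y0"
        have "e0 \<noteq> u" using e0(3) uT xT0 by metis
        then show False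
          using clash[OF P0 e0(2,1,3) uT(1) _ eq y(1)] sums[OF eU(1) u(1)] u(1) yU by blast
      qed
      moreover have "opt u \<noteq> opt y1"
      proof
        assume eq: "opt u = opt y1"
        have "e1 \<noteq> u" using e1(3) uT xT1 by metis
        then show False
          using clash[OF P1 e1(2,1,3) uT(1) _ eq y(2)] sums[OF eU(2) u(1)] u(1) yU by blast
      qed
      \<comment> \<open>Neither \<open>y0\<close> nor \<open>y1\<close> lies in the triple of
        \<open>u\<close>, so both lie in the other one.\<close>
      ultimately have "opt y0 = opt y1"
        using T uT y by (auto simp: card_2_iff)
      then have 1: "p y0 + p y1 + q \<le> 1" using triple_two[OF D0(3) D1(3) ne(4)] y by simp
      show False
      proof (cases "opt x0 = opt x1")
        case True
        then have "p x0 + p x1 \<le> 1" using opt_pair D0(2) D1(2) ne(1) by blast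
        then show False using 1 D0(11) D1(11) two_machines by linarith
      next
        case False
        \<comment> \<open>Three sums reach \<open>s\<close>: \<open>x0 + y0\<close>,
          \<open>x1 + y1\<close> and \<open>e0 + e1\<close>. Regrouped along optimal machines they
          total at most \<open>3 - q\<close>.\<close>
        then have "e0 \<noteq> e1" using e0(3) e1(3) by metis
        then have "s \<le> p e0 + p e1" using sums[OF eU] by blast
        moreover have "p e0 + p x0 \<le> 1" "p e1 + p x1 \<le> 1" using opt_pair e0 e1 D0(2) D1(2) by blast+
        ultimately show False using 1 D0(11) D1(11) three by linarith
      qed
    next
      case False
      have "{x0, x1, x2} \<subseteq> initial y2" using x01U xU by simp
      then have "card (initial y2 - {x0, x1, x2}) = 2" using c5 ne by (simp add: card_Diff_subset)
      then obtain u v where uv: "initial y2 - {x0, x1, x2} = {u, v}" "u \<noteq> v" by (auto simp: card_2_iff)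
      then have uv': "u \<in> initial y2 - {x0, x1, x2}" "v \<in> initial y2 - {x0, x1, x2}" by auto
      then have "u \<notin> W" "v \<notin> W" using \<open>W = {x0, x1, x2, w}\<close> False by auto
      then have uvT: "opt u \<in> Triples" "opt v \<in> Triples" using W uv' U by auto
      then have "opt u \<noteq> opt v" using spread uv uv' by blast
      then have "Triples = {opt u, opt v}" using T uvT by (auto simp: card_2_iff)
      then have ex: "\<exists>e\<in>initial y2. opt e = opt j" if "opt j \<in> Triples" for j
        using that uv' by auto
      have yw: "y' = w" if "y' \<in> J" "y' \<notin> initial y2" "opt y' \<notin> Triples" for y'
        using W[of y'] that \<open>W = {x0, x1, x2, w}\<close> x01U xU by auto
      \<comment> \<open>Both triples are represented in the prefix, so a second job in a triple
        would clash as soon as the optimal partner of its first job is in the prefix. Only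
        \<open>w\<close> escapes.\<close>
      have shared: "y' = w"
        if "pair_at h' x' y'" "y' \<notin> initial y2" "e \<in> initial y2" "e \<noteq> x'" "opt e = opt x'" "opt e \<notin> Triples"
        for h' x' y' e
      proof (rule ccontr)
        assume "y' \<noteq> w"
        note D = pair_atD[OF that(1)]
        have y'T: "opt y' \<in> Triples" using yw[OF D(3) that(2)] \<open>y' \<noteq> w\<close> by blast
        then obtain u' where u': "u' \<in> initial y2" "opt u' = opt y'" using ex by blast
        then have "e \<noteq> u'" using that(6) y'T by metis
        then have "s \<le> p e + p u'" using sums[OF that(3) u'(1)] by blast
        then show False using clash[OF that(1) _ that(4,5) _ _ u'(2) y'T] that(2,3) u'(1) U by blast
      qed
      \<comment> \<open>The optimal pairs are \<open>x2\<close>, \<open>x\<close> and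
        \<open>x'\<close>, \<open>w\<close>, with \<open>w = y\<close>, while \<open>y'\<close>
        shares a triple with a prefix job \<open>u'\<close>. These three machines bound the sums
        \<open>x + y\<close>, \<open>x' + y'\<close> and \<open>x2 + u'\<close> by
        \<open>3 - q\<close> in total.\<close>
      have chain: False
        if "pair_at h x y" "pair_at h' x' y'" "y \<notin> initial y2" "y' \<notin> initial y2" "y \<noteq> y'"
          "x2 \<noteq> x" "opt x2 = opt x" "opt x' = opt w" "x' \<noteq> w" for h x y h' x' y'
      proof -
        note D = pair_atD[OF that(1)] and D' = pair_atD[OF that(2)]
        have "y = w" using shared[OF that(1,3) _ that(6,7) xT2] xU by blast
        then have y'T: "opt y' \<in> Triples" using yw[OF D'(3) that(4)] that(5) by blast
        then obtain u' where u': "u' \<in> initial y2" "opt u' = opt y'" using ex by blast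
        then have "s \<le> p x2 + p u'" using U_ge by simp
        moreover have "p u' + p y' + q \<le> 1" using triple_two[OF _ D'(3) _ u'(2) y'T] u'(1) that(4) U by blast
        moreover have "p x2 + p x \<le> 1" "p x' + p y \<le> 1"
          using opt_pair[OF D2(2) D(2) that(6,7)] opt_pair[OF D'(2) D(3)] that(8,9) \<open>y = w\<close> by simp_all
        ultimately show False using D(11) D'(11) three by linarith
      qed
      from share show False
      proof (elim disjE)
        assume eq: "opt x0 = opt x1"
        then have "y0 = w" "y1 = w"
          using shared[OF P0 yU(1) x01U(2)] shared[OF P1 yU(2) x01U(1)] ne xT0 by auto
        then show False using ne by simp
      next
        assume eq: "opt x0 = opt x2"
        then have "opt x1 = opt w" using wmate[of x0 x2 x1] by blast
        then show False using chain[OF P0 P1 yU] ne eq wJ by simp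
      next
        assume eq: "opt x1 = opt x2"
        then have "opt x0 = opt w" using wmate[of x1 x2 x0] by blast
        then show False using chain[OF P1 P0 yU(2,1)] ne eq wJ by simp
      qed
    qed
  qed
qed

text \<open>Below \<open>m = 5\<close>, two or more triples means \<open>m\<close> or
  \<open>m - 1\<close> of them, or two of them for \<open>m = 4\<close>.\<close>

lemma card_Triples: "card Triples = 1"
proof (rule ccontr)
  assume ne: "card Triples \<noteq> 1"
  have "card Triples \<le> m"
    using card_mono[of "{..<m}" Triples] by (auto simp: Triples_def)
  moreover have "card Triples \<ge> 2" using ne Triples_ge1 by simp
  ultimately have "m \<ge> 5 \<or> card Triples = m \<or> card Triples = m - 1 \<or> m = 4 \<and> card Triples = 2"
    using m3 by linarith
  then show False
    using not_two_triples_large \<open>card Triples \<ge> 2\<close> not_all_triples not_one_opt_pair not_two_triples_4 by blast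
qed

subsection \<open>A single triple\<close>

definition "triple = the_elem Triples"

lemma Triples_eq: "Triples = {triple}"
  using card_Triples by (metis card_1_singletonE the_elem_eq triple_def)

lemma triple_less: "triple < m" and card_triple: "card (OPT triple) = 3"
  using Triples_eq by (auto simp: Triples_def)

lemma card_J_eq: "card J = 2 * m + 1"
  using card_J card_Triples by simp

lemma card_N: "h < m \<Longrightarrow> card (N h) = 2"
proof -
  assume h: "h < m"
  have "2 = card (N h)"
  proof (rule sum_le_all_eq[of m "\<lambda>_. 2" "\<lambda>h. card (N h)", OF _ _ h])
    show "(\<Sum>h<m. card (N h)) \<le> (\<Sum>h<m. 2)" using card_J_N card_J_eq by simp
  qed (use card_N_ge2 in auto)
  then show ?thesis by simp
qed

lemma lpt_mate:
  assumes "j \<in> J" "j \<noteq> c"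
  obtains y where "N (lpt j) = {j, y}" "y \<in> J" "y \<noteq> c" "y \<noteq> j" "s \<le> p j + p y" "p j + p y < 1"
proof -
  have h: "lpt j < m" using lpt_less assms by simp
  have "j \<in> N (lpt j)" using assms by simp
  then obtain y where y: "N (lpt j) = {j, y}" "j \<noteq> y" using card2E card_N[OF h] by metis
  then have "y \<in> N (lpt j)" by blast
  moreover have "sum p (N (lpt j)) = p j + p y" using y by simp
  ultimately show ?thesis
    using that y s_le[OF h] lpt_load_less_1[OF h] by (metis mem_N)
qed

section \<open>Weights at a job that overflows LPT' or LPT''\<close>

lemma weight_eq_1: "weight \<theta> j = 1 \<longleftrightarrow> p j < \<theta>" and weight_ge_1: "weight \<theta> j \<ge> 1"
  by (auto simp: weight_def)

text \<open>The content of machine \<open>k\<close> when \<open>y\<close> arrives, with the block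
  \<open>S\<close> in place from the start.\<close>

definition "stage S b y k = {j\<in>J. (j \<in> S \<or> ix j < ix y) \<and> b j = k}"

lemma fin_stage [simp]: "finite (stage S b y k)"
  using fin by (simp add: stage_def)

lemma greedy_stage:
  "greedy m p ix S J b \<Longrightarrow> y \<in> J \<Longrightarrow> y \<notin> S \<Longrightarrow> k < m \<Longrightarrow> sum p (stage S b y (b y)) \<le> sum p (stage S b y k)"
  unfolding greedy_def stage_def by blast

text \<open>By \<open>large\<close>, two prefix jobs in the triple would give
  \<open>2 * (\<kappa> + q) + q < 1\<close>, against \<open>\<kappa> \<ge> 1/6\<close> and
  \<open>q > 1/4\<close>. A single one is at most \<open>1 - 2 * q\<close>, hence light, since then
  \<open>\<theta> > \<kappa> + 2 * q\<close>. In an optimal pair inside the prefix each job is at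
  most \<open>1 - p r < \<theta>\<close>.\<close>

lemma initial_opt_weight:
  assumes r: "r \<in> J" and large: "\<kappa> + q < p r" and \<theta>: "1 + \<kappa> < \<theta> + p r" and h: "h < m"
  shows "sum (weight \<theta>) {j\<in>initial r. opt j = h} \<le> (if h = triple then 1 else 2)"
proof -
  let ?X = "{j\<in>initial r. opt j = h}"
  have sub: "?X \<subseteq> OPT h" by auto
  have finX: "finite ?X" using finite_subset[OF sub finO] .
  have ge: "p r \<le> p u" if "u \<in> ?X" for u using initial_p_ge[OF r, of u] that by simp
  show ?thesis
  proof (cases "h = triple")
    case True
    have "u = v" if "u \<in> ?X" "v \<in> ?X" for u v
    proof (rule ccontr)
      assume "u \<noteq> v"
      then have "p u + p v + q \<le> 1" using triple_two[of u v] that True Triples_eq by simp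
      then show False using ge[OF that(1)] ge[OF that(2)] large numeric by linarith
    qed
    then have c1: "card ?X \<le> 1" by (subst One_nat_def, subst card_le_Suc0_iff_eq[OF finX]) blast
    have "weight \<theta> u = 1" if "u \<in> ?X" for u
    proof -
      have "p u + 2 * q \<le> 1" using triple_one[of u] that True Triples_eq by simp
      then show ?thesis unfolding weight_eq_1 using ge[OF that] \<theta> large numeric by linarith
    qed
    then have "sum (weight \<theta>) ?X = card ?X" by simp
    then show ?thesis using c1 True by simp
  next
    case False
    have "card ?X \<le> 2" using card_mono[OF finO sub] card_O[OF h] Triples_eq False by simp
    moreover have "p u < \<theta>" if "u \<in> ?X" "v \<in> ?X" "u \<noteq> v" for u v
      using opt_pair[of u v] that ge[OF that(2)] \<theta> numeric by simp
    ultimately show ?thesis using weight_le2[OF finX] False by simp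
  qed
qed

lemma sum_opt_capacity: "(\<Sum>h<m. if h = triple then 1 else 2) = 2 * m - (1::nat)"
proof -
  have "(\<Sum>h<m. if h = triple then 1 else 2) + (1::nat) = (\<Sum>h<m. (if h = triple then 1 else 2) + (if h = triple then 1 else 0))"
    using triple_less by (simp only: sum.distrib) simp
  also have "\<dots> = (\<Sum>h<m. 2)" by (intro sum.cong) auto
  finally show ?thesis by simp
qed

lemma initial_weight_le:
  assumes "r \<in> J" "\<kappa> + q < p r" "1 + \<kappa> < \<theta> + p r"
  shows "sum (weight \<theta>) (initial r) \<le> 2 * m - 1"
proof -
  have "sum (weight \<theta>) (initial r) = (\<Sum>h<m. sum (weight \<theta>) {j\<in>initial r. opt j = h})"
    using opt_less by (intro sum_by_machine) auto
  also have "\<dots> \<le> (\<Sum>h<m. if h = triple then 1 else 2)"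
    using initial_opt_weight[OF assms] by (intro sum_mono) auto
  finally show ?thesis using sum_opt_capacity by simp
qed

lemma initial_eq: "r \<in> J \<Longrightarrow> initial r = insert r {j\<in>J. ix j < ix r}"
  using inj by (auto simp: inj_on_def le_less)

text \<open>Before \<open>r\<close>, at most one machine holds a block \<open>S\<close>, which does not count towards the weight;
  every other machine has weight at least 2, and one of them receives \<open>r\<close>.\<close>

lemma initial_weight_ge:
  assumes b: "\<And>j. j \<in> J \<Longrightarrow> b j < m" and gr: "greedy m p ix S J b" and r: "r \<in> J" "r \<notin> S"
    and S: "\<And>j. j \<in> S \<Longrightarrow> j \<in> J \<and> b j = g \<and> ix r < ix j" and g: "g < m"
    and \<theta>: "0 < \<theta>" "\<theta> \<le> sum p (stage S b r (b r))"
    and d: "sum (weight \<theta>) (stage S b r g - S) + d \<ge> 2"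
  shows "sum (weight \<theta>) (initial r) + d \<ge> 2 * m + 1"
proof -
  let ?f = "\<lambda>k. sum (weight \<theta>) {j\<in>initial r. b j = k}"
  have "?f k + (if k = g then d else 0) \<ge> 2 + (if k = b r then 1 else 0)" if k: "k < m" for k
  proof -
    let ?X = "stage S b r k - S"
    have X: "{j\<in>initial r. b j = k} = ?X \<union> (if k = b r then {r} else {})"
      using S r unfolding stage_def initial_eq[OF r(1)] by (auto dest: less_asym)
    have "r \<notin> ?X" by (auto simp: stage_def r)
    then have f: "?f k = sum (weight \<theta>) ?X + (if k = b r then weight \<theta> r else 0)"
      unfolding X by (simp add: sum.union_disjoint)
    have "sum (weight \<theta>) ?X + (if k = g then d else 0) \<ge> 2"
    proof (cases "k = g")
      case False
      then have "?X = stage S b r k" using S by (auto simp: stage_def)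
      moreover have "\<theta> \<le> sum p (stage S b r k)" using greedy_stage[OF gr r k] \<theta>(2) by linarith
      ultimately show ?thesis using weight_ge2[OF fin_stage _ \<theta>(1)] False by simp
    qed (use d in simp)
    then show ?thesis using f weight_ge_1[of \<theta> r] by (cases "k = b r") simp_all
  qed
  then have "(\<Sum>k<m. ?f k + (if k = g then d else 0)) \<ge> (\<Sum>k<m. 2 + (if k = b r then 1 else 0))"
    by (intro sum_mono) auto
  moreover have "sum (weight \<theta>) (initial r) = (\<Sum>k<m. ?f k)"
    using b by (intro sum_by_machine) auto
  moreover have "(\<Sum>k<m. 2 + (if k = b r then 1 else 0)) = 2 * m + (1::nat)"
    using b[OF r(1)] by (simp only: sum.distrib) simp
  moreover have "(\<Sum>k<m. ?f k + (if k = g then d else 0)) = (\<Sum>k<m. ?f k) + d"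
    using g by (simp only: sum.distrib) simp
  ultimately show ?thesis by linarith
qed

text \<open>If some machine holds a single job when \<open>r\<close> overflows, weights apply: the
  machine of \<open>c\<close> contains a further job, so the prefix weighs at least
  \<open>2 * m\<close>. Otherwise all machines hold exactly two jobs, \<open>r\<close> is a smallest
  job besides \<open>c\<close>, and the job \<open>e\<close> next to \<open>c\<close> exceeds 1/2.
  Then the triple, which lacks \<open>c\<close>, contains a job as large as \<open>e\<close> and is
  overfull.\<close>

lemma LPT'_good:
  assumes c_pair: "opt c \<noteq> triple"
    and b: "\<And>j. j \<in> J \<Longrightarrow> b j < m" and gr: "greedy m p ix {c} J b" and r: "r \<in> J" "r \<noteq> c"
  shows "sum p (stage {c} b r (b r)) + p r \<le> 1 + \<kappa>"
proof (rule ccontr)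
  define \<sigma> where "\<sigma> = sum p (stage {c} b r (b r))"
  let ?D = "stage {c} b r"
  assume "\<not> ?thesis"
  then have bad: "1 + \<kappa> < \<sigma> + p r" by (simp add: \<sigma>_def)
  have ge: "\<sigma> \<le> sum p (?D k)" if "k < m" for k
    using greedy_stage[OF gr r(1) _ that] r(2) by (simp add: \<sigma>_def)
  have \<sigma>: "\<kappa> + q < \<sigma>" using bad p_le[OF r(1)] by linarith
  show False
  proof (cases "\<exists>k<m. card (?D k) \<le> 1")
    case True
    then obtain k where k: "k < m" "card (?D k) \<le> 1" by blast
    have "0 < sum p (?D k)" using ge[OF k(1)] \<sigma> numeric by linarith
    then have "?D k \<noteq> {}" by (metis less_irrefl sum.empty)
    then obtain x where x: "?D k = {x}" using card_le_1E[OF fin_stage _ k(2)] by blast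
    then have "x \<in> ?D k" by blast
    then have "x \<in> J" by (simp add: stage_def)
    \<comment> \<open>A single job is at most \<open>1 - q\<close>, hence so is
      \<open>\<sigma>\<close>, and \<open>r\<close> must supply the rest.\<close>
    then have large: "\<kappa> + q < p r" using ge[OF k(1)] x p_le[of x] bad by simp
    have "?D (b c) \<noteq> {c}" "c \<in> ?D (b c)" using ge[OF b[OF cJ]] \<sigma> numeric cJ by (auto simp: stage_def)
    then have "?D (b c) - {c} \<noteq> {}" by blast
    then have "card (?D (b c) - {c}) \<ge> 1" by (simp add: Suc_le_eq card_gt_0_iff)
    then have d: "sum (weight \<sigma>) (?D (b c) - {c}) + 1 \<ge> 2"
      using weight_ge_card[of "?D (b c) - {c}" \<sigma>] by simp
    have "sum (weight \<sigma>) (initial r) + 1 \<ge> 2 * m + 1"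
      by (rule initial_weight_ge[OF b gr r(1) _ _ b[OF cJ] _ _ d])
        (use r cJ ix_less[OF r] \<sigma> numeric in \<open>auto simp: \<sigma>_def\<close>)
    then show False using initial_weight_le[OF r(1) large bad] m3 by simp
  next
    case False
    then have ge2: "card (?D k) \<ge> 2" if "k < m" for k using that by force
    define K where "K = {j\<in>J. j \<in> {c} \<or> ix j < ix r}"
    have finK: "finite K" using fin by (simp add: K_def)
    have KJ: "K \<subseteq> J - {r}" using r by (auto simp: K_def)
    have "card (J - {r}) = 2 * m" using card_J_eq r fin by simp
    moreover have cK: "card K = (\<Sum>k<m. card (?D k))"
      using card_by_machine[of K b m] finK b by (simp add: K_def stage_def conj_assoc)
    moreover have "(\<Sum>k<m. 2) \<le> (\<Sum>k<m. card (?D k))" using ge2 by (intro sum_mono) auto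
    moreover have "card K \<le> card (J - {r})" using card_mono[OF _ KJ] fin by simp
    ultimately have K: "card K = 2 * m" "K = J - {r}"
      using card_subset_eq[OF _ KJ] fin by simp_all
    have rmin: "p r \<le> p j" if "j \<in> J" "j \<noteq> c" for j
    proof -
      have "j = r \<or> j \<in> K" using K(2) that by blast
      then show ?thesis using anti[of j r] that r by (auto simp: K_def)
    qed
    have "card (?D (b c)) = 2"
      by (rule sum_le_all_eq[symmetric, of m "\<lambda>_. 2" "\<lambda>k. card (?D k)", OF ge2 _ b[OF cJ]])
        (use K cK in auto)
    moreover have "c \<in> ?D (b c)" using cJ by (simp add: stage_def)
    ultimately obtain e where e: "?D (b c) = {c, e}" "c \<noteq> e" using card2E by metis
    then have "e \<in> ?D (b c)" by blast
    then have eJ: "e \<in> J" "ix e < ix r" "b e = b c" using e(2) by (auto simp: stage_def)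
    have \<sigma>e: "\<sigma> \<le> q + p e" using ge[OF b[OF cJ]] e by simp
    have tri: "card (OPT triple) = 3" "\<And>j. j \<in> OPT triple \<Longrightarrow> p r \<le> p j"
      using card_triple rmin c_pair by auto
    then have r3: "3 * p r \<le> 1"
      using sum_bounded_below[of "OPT triple" "p r" p] sum_le_O[of "OPT triple" triple] triple_less by simp
    then have half: "1/2 < p e" using \<sigma>e bad q_third numeric by linarith
    \<comment> \<open>At the arrival of \<open>e\<close> no machine is empty, so at least
      \<open>m\<close> jobs are as large as \<open>e\<close>. All exceed 1/2, so each optimal
      machine, in particular the triple, holds exactly one of them.\<close>
    have "{..<m} \<subseteq> b ` initial e"
    proof
      fix k assume "k \<in> {..<m}"
      then have k: "k < m" by simp
      show "k \<in> b ` initial e"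
      proof (cases "k = b c")
        case True
        then show ?thesis using eJ by (metis imageI le_refl mem_initial)
      next
        case False
        have "c \<in> stage {c} b e (b e)" using cJ eJ by (simp add: stage_def)
        then have "p c \<le> sum p (stage {c} b e (b e))"
          using p_pos by (intro member_le_sum fin_stage) (auto simp: stage_def less_imp_le)
        then have "0 < sum p (stage {c} b e k)"
          using greedy_stage[OF gr eJ(1) _ k] e(2) numeric by fastforce
        then have "stage {c} b e k \<noteq> {}" by auto
        then obtain j where "j \<in> stage {c} b e k" by blast
        then have "j \<in> initial e" "b j = k" using False by (auto simp: stage_def)
        then show ?thesis by blast
      qed
    qed
    then have "card {..<m} \<le> card (initial e)" by (rule surj_card_le[OF fin_initial])
    moreover have inj_opt: "inj_on opt (initial e)"
    proof (rule inj_onI, rule ccontr)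
      fix u v assume uv: "u \<in> initial e" "v \<in> initial e" "opt u = opt v" "u \<noteq> v"
      then have "p u + p v \<le> 1" using opt_pair by simp
      then show False using half initial_p_ge[OF eJ(1) uv(1)] initial_p_ge[OF eJ(1) uv(2)] by linarith
    qed
    moreover have "opt ` initial e \<subseteq> {..<m}" using opt_less by auto
    ultimately have "opt ` initial e = {..<m}"
      by (metis card_image card_mono card_subset_eq finite_lessThan le_antisym)
    then obtain g where g: "g \<in> initial e" "opt g = triple" using triple_less by (metis imageE lessThan_iff)
    then have gT: "g \<in> OPT triple" by simp
    have "2 * p r \<le> sum p (OPT triple - {g})"
      using sum_bounded_below[of "OPT triple - {g}" "p r" p] tri gT by simp
    moreover have "sum p (OPT triple) = p g + sum p (OPT triple - {g})"
      using gT by (simp add: sum.remove)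
    ultimately have "p g + 2 * p r \<le> 1"
      using sum_le_O[of "OPT triple" triple] triple_less by simp
    then show False using initial_p_ge[OF eJ(1) g(1)] \<sigma>e bad q_le[OF r(1)] numeric by linarith
  qed
qed

text \<open>The block consists of three smallest jobs, and the triple also has three jobs.\<close>

lemma block_small:
  assumes "S \<subseteq> J" "card S = 3" "\<And>j k. j \<in> J - S \<Longrightarrow> k \<in> S \<Longrightarrow> ix j < ix k"
  shows "sum p S \<le> 1"
proof -
  have "sum p S \<le> sum p (OPT triple)"
  proof (rule sum_le_last)
    show "finite S" using assms(1) fin finite_subset by blast
    show "p k \<le> p j" if "j \<in> OPT triple - S" "k \<in> S" for j k
      using that assms(3)[of j k] assms(1) by (intro anti) (auto simp: less_imp_le)
  qed (use assms(2) card_triple in auto)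
  then show ?thesis using sum_le_O[of "OPT triple" triple] triple_less by simp
qed

text \<open>If \<open>LPT''\<close> failed too, all weight bounds would be tight: the jobs below \<open>\<sigma>\<close> would be odd in
  number, but closed under passing to the other job on the same machine of the \<open>LPT\<close> schedule.\<close>

lemma LPT''_good:
  assumes c_triple: "opt c = triple" and SJ: "S \<subseteq> J" and cS: "c \<in> S" and card_S: "card S = 3"
    and S_last: "\<And>j k. j \<in> J - S \<Longrightarrow> k \<in> S \<Longrightarrow> ix j < ix k"
    and b: "\<And>j. j \<in> J \<Longrightarrow> b j < m" and bS: "\<And>j. j \<in> S \<Longrightarrow> b j = b c"
    and gr: "greedy m p ix S J b" and r: "r \<in> J" "r \<notin> S"
  shows "sum p (stage S b r (b r)) + p r \<le> 1 + \<kappa>"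
proof (rule ccontr)
  define \<sigma> where "\<sigma> = sum p (stage S b r (b r))"
  let ?D = "stage S b r"
  assume "\<not> ?thesis"
  then have bad: "1 + \<kappa> < \<sigma> + p r" by (simp add: \<sigma>_def)
  have ge: "\<sigma> \<le> sum p (?D k)" if "k < m" for k
    using greedy_stage[OF gr r that] by (simp add: \<sigma>_def)
  have \<sigma>: "\<kappa> + q < \<sigma>" using bad p_le[OF r(1)] by linarith
  have finS: "finite S" using SJ fin finite_subset by blast
  have bcm: "b c < m" using b cJ .
  \<comment> \<open>Besides \<open>r\<close> and the block at most \<open>2 * m - 3\<close> jobs
    remain, too few to give two to each of the other \<open>m - 1\<close> machines.\<close>
  obtain k where k: "k < m" "card (?D k) \<le> 1"
  proof (rule ccontr)
    assume none: "\<not> thesis"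
    have ge2: "card (?D k) \<ge> 2" if "k < m" for k
      using none \<open>\<And>k. k < m \<Longrightarrow> card (?D k) \<le> 1 \<Longrightarrow> thesis\<close>[OF that] by force
    define K where "K = {j\<in>J. ix j < ix r} - S"
    have finK: "finite K" using fin by (simp add: K_def)
    have "K \<subseteq> J - insert r S" by (auto simp: K_def)
    then have "card K \<le> card (J - insert r S)" using fin by (intro card_mono) auto
    also have "\<dots> = 2 * m + 1 - 4"
      using r SJ finS card_S card_J_eq by (subst card_Diff_subset) auto
    finally have "card K \<le> 2 * m - 3" by simp
    moreover have "card K = (\<Sum>k<m. card {j\<in>K. b j = k})"
      using finK b by (intro card_by_machine) (auto simp: K_def)
    moreover have "(\<Sum>k<m. card {j\<in>K. b j = k}) + 2 \<ge> 2 * m"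
    proof -
      have "card {j\<in>K. b j = k} + (if k = b c then 2 else 0) \<ge> 2" if "k < m" for k
      proof (cases "k = b c")
        case False
        then have "{j\<in>K. b j = k} = ?D k" using bS by (auto simp: K_def stage_def)
        then show ?thesis using ge2[OF that] by simp
      qed simp
      then have "(\<Sum>k<m. card {j\<in>K. b j = k} + (if k = b c then 2 else 0)) \<ge> (\<Sum>k<m. 2)"
        by (intro sum_mono) auto
      then show ?thesis using bcm by (simp add: sum.distrib)
    qed
    ultimately show False using m3 by linarith
  qed
  have "0 < sum p (?D k)" using ge[OF k(1)] \<sigma> numeric by linarith
  then have "?D k \<noteq> {}" by (metis less_irrefl sum.empty)
  then obtain x where x: "?D k = {x}" using card_le_1E[OF fin_stage _ k(2)] by blast
  then have "x \<in> ?D k" by blast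
  then have "x \<in> J" by (simp add: stage_def)
  then have large: "\<kappa> + q < p r" using ge[OF k(1)] x p_le[of x] bad by simp
  let ?w = "\<lambda>h. sum (weight \<sigma>) {j\<in>initial r. opt j = h}"
  \<comment> \<open>The block machine is credited with nothing, so \<open>d = 2\<close>. What is
    left, \<open>2 * m - 1\<close>, is the full optimal capacity, so every optimal machine attains
    its bound.\<close>
  have "sum (weight \<sigma>) (initial r) + 2 \<ge> 2 * m + 1"
  proof (rule initial_weight_ge[OF b gr r _ bcm])
    show "j \<in> J \<and> b j = b c \<and> ix r < ix j" if "j \<in> S" for j
      using SJ bS[OF that] S_last[of r j] r that by blast
    show "0 < \<sigma>" using \<sigma> numeric by linarith
  qed (simp_all add: \<sigma>_def)
  moreover have "sum (weight \<sigma>) (initial r) = (\<Sum>h<m. ?w h)"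
    using opt_less by (intro sum_by_machine) auto
  ultimately have "(\<Sum>h<m. if h = triple then 1 else 2) \<le> (\<Sum>h<m. ?w h)"
    using sum_opt_capacity by simp
  then have tight: "?w h = (if h = triple then 1 else 2)" if "h < m" for h
    using sum_le_all_eq[of m ?w "\<lambda>h. if h = triple then 1 else 2" h]
      initial_opt_weight[OF r(1) large bad] that by blast
  have total: "sum (weight \<sigma>) (initial r) = 2 * m - 1"
    using initial_weight_le[OF r(1) large bad] \<open>sum (weight \<sigma>) (initial r) + 2 \<ge> 2 * m + 1\<close> by simp
  \<comment> \<open>The jobs of weight 1; heavy jobs contribute an even amount to the odd
    total.\<close>
  define Low where "Low = {j\<in>initial r. p j < \<sigma>}"
  have "Low \<subseteq> initial r" by (auto simp: Low_def)
  then have "sum (weight \<sigma>) (initial r) = sum (weight \<sigma>) (initial r - Low) + sum (weight \<sigma>) Low"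
    by (rule sum.subset_diff) simp
  also have "sum (weight \<sigma>) Low = (\<Sum>j\<in>Low. 1)"
    by (intro sum.cong) (auto simp: weight_def Low_def)
  also have "sum (weight \<sigma>) (initial r - Low) = (\<Sum>j\<in>initial r - Low. 2)"
    by (intro sum.cong) (auto simp: weight_def Low_def)
  finally have "2 * card (initial r - Low) + card Low = 2 * m - 1" using total by simp
  then have odd_Low: "odd (card Low)" using m3 by presburger
  have ge_r: "p r \<le> p u" if "u \<in> initial r" for u using initial_p_ge[OF r(1) that] .
  obtain u where u: "{j\<in>initial r. opt j = triple} = {u}" "p u < \<sigma>"
  proof -
    let ?X = "{j\<in>initial r. opt j = triple}"
    have 1: "?w triple = 1" using tight triple_less by simp
    moreover have "finite ?X" using fin by simp
    ultimately have "card ?X \<le> 1" using weight_ge_card[of ?X \<sigma>] by simp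
    moreover have "?X \<noteq> {}" using 1 by (metis sum.empty zero_neq_one)
    ultimately obtain u where "?X = {u}" using card_le_1E \<open>finite ?X\<close> by metis
    then show ?thesis using that 1 weight_eq_1[of \<sigma> u] by simp
  qed
  have "u \<in> {j\<in>initial r. opt j = triple}" using u by blast
  then have uU: "u \<in> initial r" "u \<in> J" "opt u = triple" by auto
  have u_le: "p u + 2 * q \<le> 1" using triple_one[OF uU(2)] uU(3) Triples_eq by simp
  then have \<sigma>2: "\<kappa> + 2 * q < \<sigma>" using ge_r[OF uU(1)] bad by linarith
  have mate_low: "y \<in> Low"
    if \<tau>: "\<tau> \<in> Low" and y: "y \<in> J" "y \<noteq> \<tau>" "s \<le> p \<tau> + p y" "p \<tau> + p y < 1" for \<tau> y
  proof -
    have \<tau>U: "\<tau> \<in> initial r" "\<tau> \<in> J" "p \<tau> < \<sigma>" using \<tau> by (auto simp: Low_def)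
    \<comment> \<open>Outside the triple, tightness gives the light job \<open>\<tau>\<close> a
      companion in the prefix, which exceeds \<open>\<kappa> + q\<close>. Either way
      \<open>\<tau>\<close> is small, so its LPT partner \<open>y\<close> is large.\<close>
    have "p \<tau> + 2 * q \<le> 1 \<or> p \<tau> + \<kappa> + q < 1"
    proof (cases "opt \<tau> = triple")
      case True
      then show ?thesis using triple_one[OF \<tau>U(2)] Triples_eq by simp
    next
      case False
      then have 2: "?w (opt \<tau>) = 2" using tight opt_less \<tau>U by simp
      have "\<exists>v\<in>initial r. opt v = opt \<tau> \<and> v \<noteq> \<tau>"
      proof (rule ccontr)
        assume "\<not> ?thesis"
        then have "{j\<in>initial r. opt j = opt \<tau>} = {\<tau>}" using \<tau>U by blast
        then have "?w (opt \<tau>) = weight \<sigma> \<tau>" by simp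
        then show False using 2 weight_eq_1[of \<sigma> \<tau>] \<tau>U(3) by simp
      qed
      then obtain v where v: "v \<in> initial r" "opt v = opt \<tau>" "v \<noteq> \<tau>" by blast
      then have "p v + p \<tau> \<le> 1" using opt_pair[of v \<tau>] \<tau>U by simp
      then show ?thesis using ge_r[OF v(1)] large by linarith
    qed
    then have y_large: "\<kappa> + q < p y \<or> 2 * \<kappa> < p y" using y(3) s_q by linarith
    have y_less: "p y < \<sigma>"
      using y(4) bad ge_r[OF \<tau>U(1)] numeric by linarith
    \<comment> \<open>In the triple, \<open>y\<close> is too large to sit beside \<open>u\<close>,
      so it is \<open>u\<close>. In an optimal pair it is too large to sit beside a heavy job, so by
      tightness both jobs of the pair lie in the prefix.\<close>
    have "y \<in> initial r"
    proof (cases "opt y = triple")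
      case True
      have "y = u"
      proof (rule ccontr)
        assume "y \<noteq> u"
        then have "p u + p y + q \<le> 1" using triple_two[OF uU(2) y(1)] uU(3) True Triples_eq by simp
        then show False using y_large ge_r[OF uU(1)] large numeric by linarith
      qed
      then show ?thesis using uU by simp
    next
      case False
      let ?X = "{j\<in>initial r. opt j = opt y}"
      have h: "opt y < m" using opt_less y(1) .
      have finX: "finite ?X" using fin by simp
      have "weight \<sigma> j = 1" if "j \<in> ?X" for j
      proof (rule ccontr)
        assume "weight \<sigma> j \<noteq> 1"
        then have j: "\<sigma> \<le> p j" using weight_eq_1 by (metis not_less)
        then have "j \<noteq> y" using y_less by auto
        then have "p j + p y \<le> 1" using opt_pair[of j y] that y(1) by simp
        then show False using j \<sigma>2 y_large numeric by linarith
      qed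
      then have "?w (opt y) = card ?X" by simp
      then have "card ?X = card (OPT (opt y))"
        using tight[OF h] False card_O[OF h] Triples_eq by simp
      moreover have "?X \<subseteq> OPT (opt y)" by auto
      ultimately have "?X = OPT (opt y)" using card_subset_eq[OF finO] by blast
      then have "y \<in> ?X" using y(1) by simp
      then show ?thesis by blast
    qed
    then show ?thesis using y_less by (simp add: Low_def)
  qed
  have LowJ: "Low \<subseteq> J" "c \<notin> Low"
  proof -
    have "r \<noteq> c" using cS r(2) by blast
    then show "Low \<subseteq> J" "c \<notin> Low" using ix_less[OF r(1)] by (auto simp: Low_def)
  qed
  \<comment> \<open>With each of its jobs, \<open>Low\<close> contains the whole LPT pair.\<close>
  have "even (card {j\<in>Low. lpt j = h})" if h: "h < m" for h
  proof (cases "{j\<in>Low. lpt j = h} = {}")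
    case False
    then obtain \<tau> where \<tau>: "\<tau> \<in> Low" "lpt \<tau> = h" by blast
    then have "\<tau> \<in> J" "\<tau> \<noteq> c" using LowJ by auto
    then obtain y where y: "N (lpt \<tau>) = {\<tau>, y}" "y \<in> J" "y \<noteq> \<tau>" "s \<le> p \<tau> + p y" "p \<tau> + p y < 1"
      using lpt_mate[of \<tau>] by metis
    have "y \<in> Low" using mate_low[OF \<tau>(1) y(2-5)] .
    have "{j\<in>Low. lpt j = h} = N h"
    proof
      show "{j\<in>Low. lpt j = h} \<subseteq> N h" using LowJ by auto
      show "N h \<subseteq> {j\<in>Low. lpt j = h}"
      proof
        fix j assume j: "j \<in> N h"
        then have "j \<in> {\<tau>, y}" using y(1) \<tau>(2) by blast
        then show "j \<in> {j\<in>Low. lpt j = h}" using \<open>y \<in> Low\<close> \<tau>(1) j by auto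
      qed
    qed
    then show ?thesis using card_N[OF h] by simp
  next
    case True
    then show ?thesis by (metis card.empty even_zero)
  qed
  moreover have "finite Low" using fin by (simp add: Low_def)
  then have "card Low = (\<Sum>h<m. card {j\<in>Low. lpt j = h})"
    using LowJ lpt_less by (intro card_by_machine) auto
  ultimately have "even (card Low)" by (metis (no_types, lifting) dvd_sum lessThan_iff)
  then show False using odd_Low by simp
qed

end

section \<open>The three schedules\<close>

locale scheduling =
  fixes m :: nat and p :: "'a \<Rightarrow> real" and ix :: "'a \<Rightarrow> nat" and A :: "'a set" and opt :: "'a \<Rightarrow> nat"
  assumes m3: "m \<ge> 3" and fin: "finite A" and inj: "inj_on ix A"
    and p_nonneg: "\<And>j. j \<in> A \<Longrightarrow> 0 \<le> p j"
    and anti: "\<And>j k. j \<in> A \<Longrightarrow> k \<in> A \<Longrightarrow> ix j \<le> ix k \<Longrightarrow> p k \<le> p j"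
    and opt_less: "\<And>j. j \<in> A \<Longrightarrow> opt j < m"
    and opt_load: "\<And>h. h < m \<Longrightarrow> sum p {j\<in>A. opt j = h} \<le> 1"
begin

lemma total_le: "sum p A \<le> real m"
proof -
  have "sum p A = (\<Sum>h<m. sum p {j\<in>A. opt j = h})" by (rule sum_by_machine[OF fin opt_less])
  also have "\<dots> \<le> (\<Sum>h<m. 1)" using opt_load by (intro sum_mono) auto
  finally show ?thesis by simp
qed

lemma greedy_load:
  assumes b: "\<And>j. j \<in> A \<Longrightarrow> b j < m" and gr: "greedy m p ix S A b" and y: "y \<in> A" "y \<notin> S"
  shows "real m * sum p {j\<in>A. (j \<in> S \<or> ix j < ix y) \<and> b j = b y} \<le> sum p {j\<in>A. j \<in> S \<or> ix j < ix y}"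
proof -
  let ?K = "{j\<in>A. j \<in> S \<or> ix j < ix y}"
  have "sum p {j\<in>A. (j \<in> S \<or> ix j < ix y) \<and> b j = b y} \<le> sum p {j\<in>?K. b j = k}" if "k < m" for k
    using gr y that unfolding greedy_def by (simp add: conj_assoc)
  then have "(\<Sum>k<m. sum p {j\<in>A. (j \<in> S \<or> ix j < ix y) \<and> b j = b y}) \<le> (\<Sum>k<m. sum p {j\<in>?K. b j = k})"
    by (intro sum_mono) auto
  also have "\<dots> = sum p ?K"
    using fin b by (intro sum_by_machine[symmetric]) auto
  finally show ?thesis by simp
qed

lemma greedy_small:
  assumes b: "\<And>j. j \<in> A \<Longrightarrow> b j < m" and gr: "greedy m p ix S A b" and y: "y \<in> A" "y \<notin> S"
    and small: "p y \<le> threshold m"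
  shows "sum p {j\<in>A. (j \<in> S \<or> ix j < ix y) \<and> b j = b y} + p y \<le> 1 + excess m"
proof (rule average_bound[OF m3 _ small])
  let ?K = "{j\<in>A. j \<in> S \<or> ix j < ix y}"
  have "sum p (insert y ?K) \<le> sum p A"
    using fin y p_nonneg by (intro sum_mono2) auto
  then have "sum p ?K + p y \<le> real m" using fin y total_le by simp
  then show "real m * sum p {j\<in>A. (j \<in> S \<or> ix j < ix y) \<and> b j = b y} + p y \<le> real m"
    using greedy_load[OF assms(1-4)] by linarith
qed

text \<open>Greedy choices depend only on the block and on earlier jobs, so later jobs can be cut
  off as long as the block is kept.\<close>

lemma greedy_restrict:
  assumes "greedy m p ix S A b" "S \<subseteq> {j\<in>A. ix j \<le> n}"
  shows "greedy m p ix S {j\<in>A. ix j \<le> n} b"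
proof -
  have eq: "{j \<in> {j\<in>A. ix j \<le> n}. (j \<in> S \<or> ix j < ix y) \<and> b j = k} = {j\<in>A. (j \<in> S \<or> ix j < ix y) \<and> b j = k}"
    if "y \<in> {j\<in>A. ix j \<le> n}" for y k
    using that assms(2) by auto
  show ?thesis
    unfolding greedy_def
  proof (intro ballI allI impI)
    fix y k assume y: "y \<in> {j\<in>A. ix j \<le> n} - S" and "k < m"
    then have "y \<in> {j\<in>A. ix j \<le> n}" "y \<in> A - S" by auto
    then show "sum p {j \<in> {j\<in>A. ix j \<le> n}. (j \<in> S \<or> ix j < ix y) \<and> b j = b y}
        \<le> sum p {j \<in> {j\<in>A. ix j \<le> n}. (j \<in> S \<or> ix j < ix y) \<and> b j = k}"
      unfolding eq[OF \<open>y \<in> {j\<in>A. ix j \<le> n}\<close>] using assms(1) \<open>k < m\<close> unfolding greedy_def by blast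
  qed
qed

lemma last_of:
  assumes "X \<subseteq> A" "X \<noteq> {}"
  shows "\<exists>y\<in>X. \<forall>j\<in>X. j \<noteq> y \<longrightarrow> ix j < ix y"
proof -
  have finX: "finite X" using assms fin finite_subset by blast
  have "Max (ix ` X) \<in> ix ` X" using finX assms by (intro Max_in) auto
  then obtain y where y: "y \<in> X" "ix y = Max (ix ` X)" by auto
  have "ix j < ix y" if "j \<in> X" "j \<noteq> y" for j
  proof -
    have "ix j \<le> ix y" using y finX that by simp
    moreover have "ix j \<noteq> ix y" using inj_onD[OF inj, of j y] that y(1) assms(1) by blast
    ultimately show ?thesis by simp
  qed
  then show ?thesis using y(1) by blast
qed

text \<open>A load is final once the last job outside the block is placed; a machine without such a
  job holds only block jobs. Positions beyond \<open>n\<close> are left to averaging.\<close>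

lemma makespan_le:
  assumes b: "\<And>j. j \<in> A \<Longrightarrow> b j < m" and gr: "greedy m p ix S A b" and SA: "S \<subseteq> A"
    and S: "sum p S \<le> 1 + excess m"
    and small: "\<And>y. y \<in> A \<Longrightarrow> ix y > n \<Longrightarrow> p y \<le> threshold m"
    and large: "\<And>y. y \<in> A \<Longrightarrow> ix y \<le> n \<Longrightarrow> y \<notin> S \<Longrightarrow>
      sum p {j\<in>A. (j \<in> S \<or> ix j < ix y) \<and> b j = b y} + p y \<le> 1 + excess m"
  shows "sum p {j\<in>A. b j = h} \<le> 1 + excess m"
proof (cases "{j\<in>A. b j = h} - S = {}")
  case True
  have "sum p {j\<in>A. b j = h} \<le> sum p S"
  proof (rule sum_mono2)
    show "finite S" using finite_subset[OF SA fin] .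
    show "{j\<in>A. b j = h} \<subseteq> S" using True by blast
    show "0 \<le> p j" if "j \<in> S - {j\<in>A. b j = h}" for j using that SA p_nonneg by blast
  qed
  then show ?thesis using S by simp
next
  case False
  have "{j\<in>A. b j = h} - S \<subseteq> A" by blast
  from last_of[OF this False]
  obtain y where y: "y \<in> {j\<in>A. b j = h} - S" "\<forall>j\<in>{j\<in>A. b j = h} - S. j \<noteq> y \<longrightarrow> ix j < ix y"
    by (elim bexE)
  then have yA: "y \<in> A" "y \<notin> S" "b y = h" by auto
  let ?X = "{j\<in>A. (j \<in> S \<or> ix j < ix y) \<and> b j = b y}"
  have "{j\<in>A. b j = h} = insert y ?X"
  proof (intro equalityI subsetI)
    fix j assume j: "j \<in> {j\<in>A. b j = h}"
    then have "j = y \<or> j \<in> S \<or> ix j < ix y" using y(2) by blast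
    then show "j \<in> insert y ?X" using j yA(3) by simp
  next
    fix j assume "j \<in> insert y ?X"
    then show "j \<in> {j\<in>A. b j = h}" using yA by auto
  qed
  moreover have "y \<notin> ?X" using yA(2) by simp
  moreover have "finite ?X" using fin by simp
  ultimately have "sum p {j\<in>A. b j = h} = sum p ?X + p y" by simp
  moreover have "sum p ?X + p y \<le> 1 + excess m"
  proof (cases "ix y \<le> n")
    case True
    show ?thesis by (rule large[OF yA(1) True yA(2)])
  next
    case False
    then have "p y \<le> threshold m" by (intro small yA(1)) simp
    with greedy_small[OF b gr yA(1,2)] show ?thesis by blast
  qed
  ultimately show ?thesis by simp
qed

theorem three_schedules:
  assumes b1: "\<And>j. j \<in> A \<Longrightarrow> b1 j < m" and b2: "\<And>j. j \<in> A \<Longrightarrow> b2 j < m" and b3: "\<And>j. j \<in> A \<Longrightarrow> b3 j < m"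
    and c: "c \<in> A" and last: "\<And>j. j \<in> A \<Longrightarrow> b1 j = b1 c \<Longrightarrow> ix j \<le> ix c"
    and ixA: "ix ` A = {..<n}"
    and S_def: "S = {j\<in>A. ix j \<le> ix c \<and> ix c < ix j + card {j\<in>A. b1 j = b1 c}}"
    and bS: "\<And>j k. j \<in> S \<Longrightarrow> k \<in> S \<Longrightarrow> b3 j = b3 k"
    and gr1: "greedy m p ix {} A b1" and gr2: "greedy m p ix {c} A b2" and gr3: "greedy m p ix S A b3"
    and fails: "1 + excess m < sum p {j\<in>A. b1 j = b1 c}"
  shows "(\<forall>h. sum p {j\<in>A. b2 j = h} \<le> 1 + excess m) \<or> (\<forall>h. sum p {j\<in>A. b3 j = h} \<le> 1 + excess m)"
proof -
  define J where "J = {j\<in>A. ix j \<le> ix c}"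
  have memJ: "j \<in> J \<longleftrightarrow> j \<in> A \<and> ix j \<le> ix c" for j by (simp add: J_def)
  have JA: "J \<subseteq> A" using memJ by blast
  have cJ: "c \<in> J" using c memJ by simp
  have M: "real m \<ge> 3" using m3 by simp
  let ?D = "{j\<in>A. (j \<in> {} \<or> ix j < ix c) \<and> b1 j = b1 c}"
  have eq: "{j\<in>A. b1 j = b1 c} = insert c ?D" (is "?L = ?R")
  proof
    show "?L \<subseteq> ?R"
    proof
      fix j assume j: "j \<in> ?L"
      then have "ix j \<le> ix c" using last by simp
      moreover have "ix j = ix c \<Longrightarrow> j = c" using inj_onD[OF inj, of j c] j c by simp
      ultimately show "j \<in> ?R" using j by (cases "ix j = ix c") auto
    qed
    show "?R \<subseteq> ?L" using c by auto
  qed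
  have D: "sum p {j\<in>A. b1 j = b1 c} = sum p ?D + p c"
    unfolding eq using fin by simp
  have c_large: "threshold m < p c"
    using greedy_small[OF b1 gr1 c] D fails by force
  have Jb1: "{j\<in>J. b1 j = b1 c} = {j\<in>A. b1 j = b1 c}" using last memJ by blast
  interpret F: failed_LPT m p ix J c opt b1
  proof
    show "sum p {j\<in>J. opt j = h} \<le> 1" if "h < m" for h
    proof -
      have "sum p {j\<in>J. opt j = h} \<le> sum p {j\<in>A. opt j = h}"
        using fin JA p_nonneg by (intro sum_mono2) auto
      then show ?thesis using opt_load[OF that] by simp
    qed
    show "greedy m p ix {} J b1" unfolding J_def by (rule greedy_restrict[OF gr1]) simp
    show "1 + excess m < sum p {j\<in>J. b1 j = b1 c}" using fails Jb1 by simp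
    show "inj_on ix J" using inj JA by (rule inj_on_subset)
    show "finite J" using fin JA finite_subset by blast
    show "p k \<le> p j" if "j \<in> J" "k \<in> J" "ix j \<le> ix k" for j k using anti that JA by blast
    show "opt j < m" "b1 j < m" if "j \<in> J" for j using opt_less b1 that JA by blast+
    show "ix j \<le> ix c" if "j \<in> J" for j using that memJ by blast
  qed (fact m3 cJ c_large)+
  \<comment> \<open>With \<open>y\<close> added, averaging reads
    \<open>m * s + q + p y \<le> m\<close>, where \<open>s\<close> is the load under
    \<open>c\<close>. Against \<open>s + q > 1 + excess m\<close> and \<open>q \<le> 1/3\<close>
    this leaves \<open>p y < threshold m\<close>, by \<open>threshold_ge\<close>.\<close>
  have later: "p y \<le> threshold m" if y: "y \<in> A" "ix c < ix y" for y
  proof (rule ccontr)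
    assume "\<not> ?thesis"
    then have py: "threshold m < p y" by simp
    let ?K = "{j\<in>A. j \<in> {} \<or> ix j < ix c}"
    have "sum p (insert y (insert c ?K)) \<le> sum p A"
      using fin y c p_nonneg by (intro sum_mono2) auto
    moreover have "sum p (insert y (insert c ?K)) = p y + (p c + sum p ?K)"
    proof -
      have "y \<notin> insert c ?K" "c \<notin> ?K" "finite ?K" using fin y by auto
      then show ?thesis by simp
    qed
    ultimately have "real m * sum p ?D + p c + p y \<le> real m"
      using greedy_load[OF b1 gr1 c] total_le by simp
    moreover have "real m * (1 + excess m) < real m * (sum p ?D + p c)"
      using fails D M by simp
    then have "real m + real m * excess m < real m * sum p ?D + real m * p c"
      by (simp only: distrib_left mult_1_right)
    moreover have "(real m - 1) * p c \<le> (real m - 1) * (1/3)"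
      using F.q_third M by (intro mult_left_mono) auto
    then have "real m * p c - p c \<le> (real m - 1) / 3" by (simp only: left_diff_distrib) simp
    moreover have "real m * excess m = real m * threshold m - threshold m"
      using excess_bounds(5)[OF m3] by (simp add: right_diff_distrib mult.commute)
    moreover note threshold_ge[OF m3] py
    ultimately show False by linarith
  qed
  have stage: "F.stage S b y k = {j\<in>A. (j \<in> S \<or> ix j < ix y) \<and> b j = k}"
    if "S \<subseteq> J" "ix y \<le> ix c" for S b y k
  proof -
    have "j \<in> J" if "j \<in> A" "ix j < ix y" for j using that \<open>ix y \<le> ix c\<close> memJ by simp
    then show ?thesis using that(1) JA unfolding F.stage_def by blast
  qed
  show ?thesis
  proof (cases "opt c = F.triple")
    case False
    have "sum p {j\<in>A. b2 j = h} \<le> 1 + excess m" for h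
    proof (rule makespan_le[OF b2 gr2])
      show "sum p {c} \<le> 1 + excess m" using F.p_le_1[OF cJ] F.numeric by simp
      show "sum p {j\<in>A. (j \<in> {c} \<or> ix j < ix y) \<and> b2 j = b2 y} + p y \<le> 1 + excess m"
        if "y \<in> A" "ix y \<le> ix c" "y \<notin> {c}" for y
      proof -
        have g: "greedy m p ix {c} J b2"
          unfolding J_def by (rule greedy_restrict[OF gr2]) (use c in simp)
        have "y \<in> J" "y \<noteq> c" using that memJ by auto
        then have "sum p (F.stage {c} b2 y (b2 y)) + p y \<le> 1 + excess m"
          by (intro F.LPT'_good[OF False _ g]) (use b2 JA in blast)
        then show ?thesis using stage[of "{c}" y b2 "b2 y"] cJ that(2) by simp
      qed
      show "p y \<le> threshold m" if "y \<in> A" "ix c < ix y" for y using later that .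
    qed (use c in auto)
    then show ?thesis by blast
  next
    case True
    have "{j\<in>A. b1 j = b1 c} = insert c (F.N (b1 c))" unfolding Jb1[symmetric] F.N_def using cJ by blast
    \<comment> \<open>So the parameter \<open>k\<close> of LPT-REV is 3: a pair and \<open>c\<close>
      itself.\<close>
    then have card3: "card {j\<in>A. b1 j = b1 c} = 3" using F.card_N[OF b1[OF c]] F.mem_N[of c "b1 c"] by simp
    have ixJ: "ix ` J = {..ix c}"
    proof
      show "{..ix c} \<subseteq> ix ` J"
      proof
        fix i assume "i \<in> {..ix c}"
        moreover have "ix c \<in> {..<n}" using ixA c by blast
        ultimately have "i \<in> ix ` A" using ixA by simp
        then obtain j where "j \<in> A" "i = ix j" by blast
        then show "i \<in> ix ` J" using \<open>i \<in> {..ix c}\<close> memJ by simp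
      qed
      show "ix ` J \<subseteq> {..ix c}" using memJ by blast
    qed
    have memS: "j \<in> S \<longleftrightarrow> j \<in> J \<and> ix c < ix j + 3" for j
      unfolding S_def card3 using memJ by simp
    then have SJ: "S \<subseteq> J" by blast
    have "card J = card {..ix c}" using card_image[OF F.inj] ixJ by simp
    \<comment> \<open>Positions run from 0 without gaps, so \<open>ix c = 2 * m\<close>. Hence
      \<open>ix c - 2\<close> is not truncated and the block has exactly three jobs.\<close>
    then have c_ge: "ix c \<ge> 2" using F.card_J_eq m3 by simp
    have "ix ` S = {ix c - 2..ix c}"
    proof
      show "{ix c - 2..ix c} \<subseteq> ix ` S"
      proof
        fix i assume i: "i \<in> {ix c - 2..ix c}"
        then have "i \<in> ix ` J" using ixJ by simp
        then obtain j where "j \<in> J" "i = ix j" by blast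
        moreover have "ix c - 2 \<le> ix j" using i \<open>i = ix j\<close> by simp
        then have "ix c < ix j + 3" by linarith
        then have "j \<in> S" using \<open>j \<in> J\<close> by (simp add: memS)
        ultimately show "i \<in> ix ` S" by blast
      qed
      show "ix ` S \<subseteq> {ix c - 2..ix c}"
      proof
        fix i assume "i \<in> ix ` S"
        then obtain j where "j \<in> S" "i = ix j" by blast
        then have "ix j \<le> ix c" "ix c < ix j + 3" using memS[of j] memJ[of j] by simp_all
        then have "ix c - 2 \<le> ix j" by linarith
        then show "i \<in> {ix c - 2..ix c}" using \<open>ix j \<le> ix c\<close> \<open>i = ix j\<close> by simp
      qed
    qed
    moreover have "card (ix ` S) = card S" using inj_on_subset[OF F.inj SJ] by (rule card_image)
    ultimately have cardS: "card S = 3" using c_ge by simp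
    have cS: "c \<in> S" using cJ memS by simp
    have S_last: "ix j < ix k" if "j \<in> J - S" "k \<in> S" for j k
    proof -
      have "\<not> ix c < ix j + 3" "ix c < ix k + 3" using that memS by auto
      then show ?thesis by linarith
    qed
    have "sum p {j\<in>A. b3 j = h} \<le> 1 + excess m" for h
    proof (rule makespan_le[OF b3 gr3])
      show "sum p S \<le> 1 + excess m"
        using F.block_small[OF SJ cardS S_last] F.numeric by simp
      show "sum p {j\<in>A. (j \<in> S \<or> ix j < ix y) \<and> b3 j = b3 y} + p y \<le> 1 + excess m"
        if "y \<in> A" "ix y \<le> ix c" "y \<notin> S" for y
      proof -
        have g: "greedy m p ix S J b3"
          unfolding J_def by (rule greedy_restrict[OF gr3]) (use SJ J_def in blast)
        have y: "y \<in> J" using that memJ by auto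
        have "sum p (F.stage S b3 y (b3 y)) + p y \<le> 1 + excess m"
        proof (rule F.LPT''_good[OF True SJ cS cardS _ _ _ g y \<open>y \<notin> S\<close>])
          show "ix j < ix k" if "j \<in> J - S" "k \<in> S" for j k using S_last that .
          show "b3 j < m" if "j \<in> J" for j using b3 JA that by blast
          show "b3 j = b3 c" if "j \<in> S" for j using bS that cS .
        qed
        then show ?thesis unfolding stage[OF SJ that(2)] .
      qed
      show "p y \<le> threshold m" if "y \<in> A" "ix c < ix y" for y using later that .
      show "S \<subseteq> A" using SJ JA by blast
    qed
    then show ?thesis by blast
  qed
qed

end

section \<open>The implementation\<close>

lemma timed_simps [simp]:
  "result (bind_timed t f) = result (f (result t))"
  "steps (bind_timed t f) = steps t + steps (f (result t))"
  "result (ret x) = x" "steps (ret x) = 0" "steps tick = 1"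
  by (simp_all add: bind_timed_def ret_def tick_def split: prod.splits)

lemma count_jobs [simp]: "result (count_jobs js) = length js" "steps (count_jobs js) = length js + 1"
  by (induction js) simp_all

section \<open>Merge sort\<close>

lemma mset_merge [simp]: "mset (result (merge p xs ys)) = mset xs + mset ys"
  by (induction p xs ys rule: merge.induct) auto

lemma set_merge [simp]: "set (result (merge p xs ys)) = set xs \<union> set ys"
  by (metis mset_merge set_mset_mset set_mset_union)

lemma steps_merge: "steps (merge p xs ys) \<le> length xs + length ys + 1"
  by (induction p xs ys rule: merge.induct) auto

lemma non_increasing_merge:
  "non_increasing p xs \<Longrightarrow> non_increasing p ys \<Longrightarrow> non_increasing p (result (merge p xs ys))"
  by (induction p xs ys rule: merge.induct) (auto simp: non_increasing_def)

text \<open>The claims are proved together because the second recursive call works on the rest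
  returned by the first.\<close>

lemma merge_sort_result:
  "snd (result (merge_sort p n xs)) = drop n xs \<and>
   mset (fst (result (merge_sort p n xs))) = mset (take n xs) \<and>
   non_increasing p (fst (result (merge_sort p n xs)))"
proof (induction n arbitrary: xs rule: less_induct)
  case (less n)
  consider "n = 0" | "n = 1" | "n \<ge> 2" by linarith
  then show ?case
  proof cases
    case 3
    then have "n div 2 < n" "n - n div 2 < n" by auto
    note IH = less[OF this(1)] less[OF this(2)]
    have n: "n = n div 2 + (n - n div 2)" by simp
    have "mset (take (n div 2) xs) + mset (take (n - n div 2) (drop (n div 2) xs)) = mset (take n xs)"
      by (subst (3) n) (simp only: take_add mset_append)
    then show ?thesis
      using 3 IH[of xs] IH[of "drop (n div 2) xs"]
      by (subst (1 2 3) merge_sort.simps) (simp add: case_prod_beta non_increasing_merge)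
  qed (auto simp: merge_sort.simps[of p 0] merge_sort.simps[of p "Suc 0"] non_increasing_def split: list.splits)
qed

lemma merge_sort_all:
  "mset (fst (result (merge_sort p (length J) J))) = mset J"
  "non_increasing p (fst (result (merge_sort p (length J) J)))"
  using merge_sort_result[of p "length J" J] by simp_all

text \<open>A call with \<open>n \<ge> 2\<close> spends 1 step on itself and at most
  \<open>n + 1\<close> on merging, hence at most \<open>2 * n\<close>; this is paid on each of
  \<open>k\<close> levels.\<close>

lemma steps_merge_sort:
  "1 \<le> n \<Longrightarrow> n \<le> 2 ^ k \<Longrightarrow> steps (merge_sort p n xs) \<le> n * (2 * k + 1)"
proof (induction k arbitrary: n xs)
  case 0
  then have "n = 1" by simp
  then show ?case by (simp add: merge_sort.simps[of p 0] merge_sort.simps[of p "Suc 0"] split: list.splits)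
next
  case (Suc k)
  consider "n = 1" | "n \<ge> 2" using Suc.prems(1) by linarith
  then show ?case
  proof cases
    case 2
    let ?l = "merge_sort p (n div 2) xs"
    let ?r = "merge_sort p (n - n div 2) (snd (result ?l))"
    have "steps ?l \<le> n div 2 * (2 * k + 1)" "steps ?r \<le> (n - n div 2) * (2 * k + 1)"
      using Suc.prems 2 by (intro Suc.IH; auto)+
    then have "steps ?l + steps ?r \<le> (n div 2 + (n - n div 2)) * (2 * k + 1)"
      by (simp only: add_mult_distrib)
    then have "steps ?l + steps ?r \<le> n * (2 * k + 1)" by simp
    moreover have "length (fst (result ?l)) \<le> n div 2" "length (fst (result ?r)) \<le> n - n div 2"
      using merge_sort_result by (metis size_mset length_take min.cobounded2)+
    then have "steps (merge p (fst (result ?l)) (fst (result ?r))) \<le> n + 1"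
      using steps_merge[of p "fst (result ?l)" "fst (result ?r)"] by linarith
    moreover have "steps (merge_sort p n xs) =
        1 + steps ?l + steps ?r + steps (merge p (fst (result ?l)) (fst (result ?r)))"
      using 2 by (subst merge_sort.simps) (simp add: case_prod_beta)
    ultimately show ?thesis using 2 by (simp add: algebra_simps)
  qed (simp add: merge_sort.simps[of p 0] merge_sort.simps[of p "Suc 0"] split: list.splits)
qed

lemma steps_merge_sort_0: "steps (merge_sort p 0 xs) = 1"
  by (simp add: merge_sort.simps)

section \<open>Machine lists and their operations\<close>

definition loads_ok :: "(job \<Rightarrow> real) \<Rightarrow> machine list \<Rightarrow> bool" where
  "loads_ok p ms \<longleftrightarrow> (\<forall>(l, js) \<in> set ms. l = load p js)"

lemma empty_machines [simp]:
  "result (empty_machines m) = replicate m (0, [])" "steps (empty_machines m) = m + 1"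
  by (induction m) simp_all

lemma total_time [simp]:
  "result (total_time p js) = load p js" "steps (total_time p js) = length js + 1"
  by (induction js) (simp_all add: load_def)

lemma min_load: "ms \<noteq> [] \<Longrightarrow> result (min_load ms) = Min (fst ` set ms)"
  by (induction ms rule: min_load.induct) (auto simp: min_def)

lemma steps_min_load: "steps (min_load ms) \<le> length ms + 1"
  by (induction ms rule: min_load.induct) auto

lemma max_load: "ms \<noteq> [] \<Longrightarrow> result (max_load ms) = Max (fst ` set ms)"
proof (induction ms rule: max_load.induct)
  case (3 l js M ms)
  then have IH: "result (max_load (M # ms)) = Max (fst ` set (M # ms))" by simp
  have "result (max_load ((l, js) # M # ms)) = max l (result (max_load (M # ms)))"
    by (simp add: max_def)
  then show ?case unfolding IH by simp
qed auto

lemma steps_max_load: "steps (max_load ms) \<le> length ms + 1"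
  by (induction ms rule: max_load.induct) auto

lemma length_assign [simp]: "length (result (assign p j l ms)) = length ms"
  by (induction p j l ms rule: assign.induct) auto

lemma steps_assign: "steps (assign p j l ms) \<le> length ms + 1"
  by (induction p j l ms rule: assign.induct) auto

lemma assign:
  "\<exists>M\<in>set ms. fst M \<le> l \<Longrightarrow> \<exists>i<length ms. fst (ms ! i) \<le> l \<and>
     result (assign p j l ms) = ms[i := (fst (ms ! i) + p j, j # snd (ms ! i))]"
proof (induction p j l ms rule: assign.induct)
  case (2 p j l l' js ms)
  show ?case
  proof (cases "l' \<le> l")
    case False
    then obtain i where "i < length ms" "fst (ms ! i) \<le> l"
      "result (assign p j l ms) = ms[i := (fst (ms ! i) + p j, j # snd (ms ! i))]"
      using 2 by auto
    then show ?thesis using False by (intro exI[of _ "Suc i"]) simp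
  qed auto
qed simp

lemma length_ls [simp]: "length (result (ls p ms js)) = length ms"
  by (induction p ms js rule: ls.induct) auto

text \<open>Each job costs one step plus at most two passes over the machines.\<close>

lemma steps_ls: "steps (ls p ms js) \<le> (length js + 1) * (2 * length ms + 3)"
proof (induction js arbitrary: ms)
  case (Cons j js)
  show ?case
    using Cons[of "result (assign p j (result (min_load ms)) ms)"] steps_min_load[of ms]
      steps_assign[of p j "result (min_load ms)" ms] by simp
qed simp

lemma loads_ok_nth: "loads_ok p ms \<Longrightarrow> i < length ms \<Longrightarrow> fst (ms ! i) = load p (snd (ms ! i))"
  by (fastforce simp: loads_ok_def dest: nth_mem)

lemma schedule_of_update:
  "i < length ms \<Longrightarrow> schedule_of (ms[i := (l, j # snd (ms ! i))]) = (schedule_of ms)(i := j # schedule_of ms i)"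
  by (auto simp: schedule_of_def fun_eq_iff nth_list_update)

text \<open>The bound handed to \<open>assign\<close> is the minimum load, so the machine it finds
  has least load; \<open>loads_ok\<close> transfers this from stored to true loads.\<close>

lemma ls_correct:
  assumes "ms \<noteq> []" "loads_ok p ms"
  shows "list_scheduling (length ms) p (schedule_of ms) js (schedule_of (result (ls p ms js))) \<and>
    loads_ok p (result (ls p ms js))"
  using assms
proof (induction js arbitrary: ms)
  case (Cons j js)
  let ?l = "result (min_load ms)"
  have l: "?l = Min (fst ` set ms)" using min_load Cons.prems by simp
  then have "?l \<in> fst ` set ms" using Cons.prems by simp
  then obtain i where i: "i < length ms" "fst (ms ! i) \<le> ?l"
    "result (assign p j ?l ms) = ms[i := (fst (ms ! i) + p j, j # snd (ms ! i))]"
    using assign[of ms ?l p j] by force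
  let ?ms = "ms[i := (fst (ms ! i) + p j, j # snd (ms ! i))]"
  have "loads_ok p ?ms"
    using Cons.prems(2) loads_ok_nth[OF Cons.prems(2) i(1)] set_update_subset_insert[of ms i]
    by (fastforce simp: loads_ok_def load_def)
  then have IH: "list_scheduling (length ms) p (schedule_of ?ms) js (schedule_of (result (ls p ?ms js)))"
    "loads_ok p (result (ls p ?ms js))"
    using Cons.IH[of ?ms] Cons.prems by auto
  have "load p (schedule_of ms i) \<le> load p (schedule_of ms h)" if "h < length ms" for h
  proof -
    have "?l \<le> fst (ms ! h)" using l that by simp
    then show ?thesis
      using i that loads_ok_nth[OF Cons.prems(2)] by (simp add: schedule_of_def)
  qed
  then have "list_scheduling (length ms) p (schedule_of ms) (j # js) (schedule_of (result (ls p ?ms js)))"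
    using IH(1) i(1) by (intro LS_Cons[of i]) (simp_all add: schedule_of_update)
  then show ?case using IH(2) i(3) by simp
qed (simp add: LS_Nil)

lemma makespan_schedule_of:
  assumes "ms \<noteq> []" "loads_ok p ms"
  shows "makespan (length ms) p (schedule_of ms) = result (max_load ms)"
proof -
  have "(\<lambda>i. load p (schedule_of ms i)) ` {..<length ms} = fst ` set ms"
    using loads_ok_nth[OF assms(2)] by (force simp: schedule_of_def set_conv_nth)
  then show ?thesis using assms by (simp add: makespan_def max_load)
qed

lemma result_split_at: "c < length js \<Longrightarrow> distinct js \<Longrightarrow>
    result (split_at (js ! c) pre js) = (rev (take c js) @ pre, drop (Suc c) js)"
proof (induction js arbitrary: c pre)
  case (Cons x xs)
  then show ?case by (cases c) auto
qed simp

lemma steps_split_at: "steps (split_at j pre js) \<le> length js + 1"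
  by (induction j pre js rule: split_at.induct) auto

lemma result_move: "result (move n xs ys) = (drop n xs, rev (take n xs) @ ys)"
  by (induction n xs ys rule: move.induct) auto

lemma steps_move: "steps (move n xs ys) \<le> length xs + 2"
  by (induction n xs ys rule: move.induct) auto

lemma rev_append [simp]: "result (rev_append xs ys) = rev xs @ ys" "steps (rev_append xs ys) = length xs + 1"
  by (induction xs ys rule: rev_append.induct) auto

lemma steps_critical_machine: "steps (critical_machine z ms) \<le> length ms + 1"
  by (induction z ms rule: critical_machine.induct) auto

lemma critical_machine_Some:
  "result (critical_machine z ms) = Some js \<Longrightarrow> js \<noteq> [] \<and> (\<exists>i<length ms. ms ! i = (z, js))"
proof (induction z ms rule: critical_machine.induct)
  case (2 z l js' ms)
  then show ?case by (cases "l = z \<and> js' \<noteq> []") (auto intro: exI[of _ "Suc _"] exI[of _ 0])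
qed simp

lemma critical_machine_None:
  "result (critical_machine z ms) = None \<Longrightarrow> (l, js) \<in> set ms \<Longrightarrow> l = z \<Longrightarrow> js = []"
  by (induction z ms rule: critical_machine.induct) (auto split: if_splits)

lemma lpt_with_correct:
  assumes "m \<ge> 1" "distinct block" "rest = filter (\<lambda>j. j \<notin> set block) js"
  shows "LPT_with m p js (set block) (schedule_of (result (lpt_with m p block rest)))"
    and "loads_ok p (result (lpt_with m p block rest))"
    and "length (result (lpt_with m p block rest)) = m"
proof -
  let ?ms = "(load p block, block) # replicate (m - 1) (0, [])"
  have ok: "loads_ok p ?ms" by (auto simp: loads_ok_def load_def)
  have len: "length ?ms = m" using assms(1) by simp
  have "schedule_of ?ms = (\<lambda>_. [])(0 := block)"
    by (auto simp: schedule_of_def fun_eq_iff nth_Cons split: nat.splits)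
  then have "list_scheduling m p ((\<lambda>_. [])(0 := block)) rest (schedule_of (result (ls p ?ms rest)))"
    "loads_ok p (result (ls p ?ms rest))"
    using ls_correct[OF _ ok, of rest] len by auto
  moreover have "result (lpt_with m p block rest) = result (ls p ?ms rest)"
    by (simp add: lpt_with_def)
  ultimately show "LPT_with m p js (set block) (schedule_of (result (lpt_with m p block rest)))"
    "loads_ok p (result (lpt_with m p block rest))" "length (result (lpt_with m p block rest)) = m"
    using assms len unfolding LPT_with_def by (auto intro!: exI[of _ 0] exI[of _ block])
qed

lemma steps_lpt_with:
  assumes "m \<ge> 1"
  shows "steps (lpt_with m p block js) \<le> length block + m + 2 + (length js + 1) * (2 * m + 3)"
  using steps_ls[of p "(load p block, block) # replicate (m - 1) (0, [])" js] assms
  by (simp add: lpt_with_def)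

lemma list_scheduling_length:
  assumes "list_scheduling m p (\<lambda>_. []) js B" "i < m"
  shows "length (B i) \<le> length js"
proof -
  have "mset (B i) \<subseteq># (\<Sum>h<m. mset (B h))"
    using assms(2) by (simp add: sum.remove[of "{..<m}" i])
  then have "mset (B i) \<subseteq># mset js" using list_scheduling_mset[OF assms(1)] by simp
  then show ?thesis by (metis size_mset size_mset_mono)
qed

lemma schedule_of_replicate: "schedule_of (replicate m (0, [])) = (\<lambda>_. [])"
  by (auto simp: schedule_of_def fun_eq_iff)

lemma loads_ok_replicate: "loads_ok p (replicate m (0, []))"
  by (auto simp: loads_ok_def load_def)

section \<open>The complete run of the implementation\<close>

context
  fixes m :: nat and p :: "job \<Rightarrow> real" and J js :: "job list" and ms1 :: "machine list"
    and z1 :: real and crit :: "job list option"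
  assumes m: "m \<ge> 1"
  defines "js \<equiv> fst (result (merge_sort p (length J) J))"
    and "ms1 \<equiv> result (ls p (replicate m (0, [])) js)"
    and "z1 \<equiv> result (max_load ms1)"
    and "crit \<equiv> result (critical_machine z1 ms1)"
begin

lemma lpt_rev_no_crit:
  assumes "crit = None \<or> crit = Some []"
  shows "result (lpt_rev m p J) = ms1"
    and "steps (lpt_rev m p J) = 1 + (length J + 1) + steps (merge_sort p (length J) J) + (m + 1) +
      steps (ls p (replicate m (0, [])) js) + steps (max_load ms1) + steps (critical_machine z1 ms1)"
  using assms
  by (auto simp: lpt_rev_def case_prod_beta js_def[symmetric] ms1_def[symmetric] z1_def[symmetric] crit_def[symmetric])

lemma lpt_rev_crit:
  assumes "crit = Some (j # before)"
  defines "pre \<equiv> fst (result (split_at j [] js))" and "post \<equiv> snd (result (split_at j [] js))"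
  defines "ms2 \<equiv> result (lpt_with m p [j] (rev pre @ post))"
  defines "pre' \<equiv> drop (length before) pre" and "block \<equiv> rev (take (length before) pre) @ [j]"
  defines "ms3 \<equiv> result (lpt_with m p block (rev pre' @ post))"
  shows "result (lpt_rev m p J) = (let z2 = result (max_load ms2); z3 = result (max_load ms3)
      in if z1 \<le> z2 \<and> z1 \<le> z3 then ms1 else if z2 \<le> z3 then ms2 else ms3)"
    and "steps (lpt_rev m p J) = 1 + (length J + 1) + steps (merge_sort p (length J) J) + (m + 1) +
      steps (ls p (replicate m (0, [])) js) + steps (max_load ms1) + steps (critical_machine z1 ms1) +
      steps (split_at j [] js) + (length pre + 1) + steps (lpt_with m p [j] (rev pre @ post)) +
      steps (max_load ms2) + (length before + 1) + steps (move (length before) pre [j]) +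
      (length pre' + 1) + steps (lpt_with m p block (rev pre' @ post)) + steps (max_load ms3)"
  by (simp_all add: lpt_rev_def case_prod_beta result_move Let_def js_def[symmetric] ms1_def[symmetric]
      z1_def[symmetric] crit_def[symmetric] assms(1) pre_def[symmetric] post_def[symmetric]
      pre'_def[symmetric] block_def[symmetric] ms2_def[symmetric] ms3_def[symmetric])

lemma length_js: "length js = length J"
  unfolding js_def using merge_sort_all(1) by (metis size_mset)

lemma length_ms1: "length ms1 = m"
  by (simp add: ms1_def)

lemma ms1_LPT: "LPT m p js (schedule_of ms1)" and ms1_ok: "loads_ok p ms1"
  using ls_correct[OF _ loads_ok_replicate, of m p js] m
  by (simp_all add: ms1_def LPT_def schedule_of_replicate)

lemma ms1_makespan: "makespan m p (schedule_of ms1) = z1"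
proof -
  have "ms1 \<noteq> []" using length_ms1 m by auto
  then show ?thesis using makespan_schedule_of[OF _ ms1_ok] length_ms1 by (simp add: z1_def)
qed

lemma split_at_lengths:
  "length (fst (result (split_at j pre xs))) + length (snd (result (split_at j pre xs))) \<le> length xs + length pre"
  by (induction j pre xs rule: split_at.induct) auto

text \<open>The three runs of \<open>ls\<close> account for the factor 3; apart from sorting,
  everything else is linear in the numbers of jobs and machines.\<close>

lemma lpt_rev_steps:
  "steps (lpt_rev m p J) \<le> steps (merge_sort p (length J) J) +
     (3 * ((length J + 1) * (2 * m + 3)) + 8 * length J + 8 * m + 32)"
proof (cases "crit = None \<or> crit = Some []")
  case True
  define E where "E = (length J + 1) * (2 * m + 3)"
  have "steps (ls p (replicate m (0, [])) js) \<le> E"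
    using steps_ls[of p "replicate m (0, [])" js] length_js by (simp add: E_def)
  moreover note steps_max_load[of ms1] steps_critical_machine[of z1 ms1] length_ms1
  ultimately show ?thesis unfolding lpt_rev_no_crit(2)[OF True] E_def[symmetric] by linarith
next
  case False
  then obtain j before where crit: "crit = Some (j # before)" by (cases crit; cases "the crit") auto
  define E where "E = (length J + 1) * (2 * m + 3)"
  define pre post where "pre = fst (result (split_at j [] js))" "post = snd (result (split_at j [] js))"
  define pre' where "pre' = drop (length before) pre"
  define block where "block = rev (take (length before) pre) @ [j]"
  define ms2 ms3 where "ms2 = result (lpt_with m p [j] (rev pre @ post))"
    "ms3 = result (lpt_with m p block (rev pre' @ post))"
  note C = lpt_rev_crit(2)[OF crit, folded pre_post_def, folded pre'_def block_def, folded ms2_ms3_def]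
  have pp: "length pre + length post \<le> length J"
    using split_at_lengths[of j "[]" js] length_js by (simp add: pre_post_def)
  obtain i where "i < m" "ms1 ! i = (z1, j # before)"
    using critical_machine_Some[OF crit[unfolded crit_def]] length_ms1 by auto
  then have "schedule_of ms1 i = j # before" by (simp add: schedule_of_def length_ms1)
  then have bf: "length before \<le> length J"
    using list_scheduling_length[OF ms1_LPT[unfolded LPT_def] \<open>i < m\<close>] length_js by simp
  have "steps (ls p (replicate m (0, [])) js) \<le> E"
    using steps_ls[of p "replicate m (0, [])" js] length_js by (simp add: E_def)
  moreover have lw: "steps (lpt_with m p xs ys) \<le> length J + m + 3 + E"
    if "length xs \<le> length J + 1" "length ys \<le> length J" for xs ys
  proof -
    have "(length ys + 1) * (2 * m + 3) \<le> E"
      unfolding E_def using that(2) by (intro mult_le_mono1) simp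
    then show ?thesis using steps_lpt_with[OF m, of p xs ys] that(1) by linarith
  qed
  have "steps (lpt_with m p [j] (rev pre @ post)) \<le> length J + m + 3 + E"
    using pp by (intro lw) simp_all
  moreover have "steps (lpt_with m p block (rev pre' @ post)) \<le> length J + m + 3 + E"
    using pp by (intro lw) (simp_all add: block_def pre'_def)
  moreover have "length ms2 = m" "length ms3 = m" using m by (simp_all add: ms2_ms3_def lpt_with_def)
  moreover note steps_max_load[of ms1] steps_max_load[of ms2] steps_max_load[of ms3]
    steps_critical_machine[of z1 ms1] length_ms1 steps_split_at[of j "[]" js] length_js
    steps_move[of "length before" pre "[j]"] pp bf
  moreover have "length pre' \<le> length pre" by (simp add: pre'_def)
  ultimately show ?thesis unfolding C E_def[symmetric] by linarith
qed

lemma lpt_rev_correct: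
  assumes valid: "valid_instance p J"
  shows "mset js = mset J" "non_increasing p js" "LPT_REV m p js (schedule_of (result (lpt_rev m p J)))"
proof -
  show mset: "mset js = mset J" and "non_increasing p js"
    using merge_sort_all[of p J] by (simp_all add: js_def)
  have dist: "distinct js" using valid mset mset_eq_imp_distinct_iff by (auto simp: valid_instance_def)
  have nonneg: "\<And>j. j \<in> set js \<Longrightarrow> 0 \<le> p j"
    using valid mset_eq_setD[OF mset] by (simp add: valid_instance_def)
  have sched: "is_schedule m (set js) (schedule_of ms1)" using LPT_is_schedule[OF dist ms1_LPT] .
  then have jobs: "set (schedule_of ms1 i) \<subseteq> set js" if "i < m" for i
    using that unfolding is_schedule_def by auto
  show "LPT_REV m p js (schedule_of (result (lpt_rev m p J)))"
  proof (cases "crit = None \<or> crit = Some []")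
    case True
    then have None: "crit = None" using critical_machine_Some[of z1 ms1 "[]"] by (auto simp: crit_def[symmetric])
    \<comment> \<open>Only empty machines attain the makespan, so it is 0. Loads being nonnegative,
      every machine attains it and is therefore empty.\<close>
    have empty: "schedule_of ms1 i = []" if "i < m" for i
    proof (rule ccontr)
      assume ne: "schedule_of ms1 i \<noteq> []"
      have iin: "ms1 ! i \<in> set ms1" using that length_ms1 by simp
      have "ms1 \<noteq> []" using iin by auto
      have "z1 = Max (fst ` set ms1)" unfolding z1_def by (rule max_load[OF \<open>ms1 \<noteq> []\<close>])
      then have z1: "z1 \<in> fst ` set ms1" "fst (ms1 ! i) \<le> z1"
        using \<open>ms1 \<noteq> []\<close> iin by simp_all
      then obtain M where "M \<in> set ms1" "fst M = z1" by auto
      then have "(z1, snd M) \<in> set ms1" by (metis prod.collapse)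
      moreover from this have "snd M = []" using critical_machine_None[OF None[unfolded crit_def]] by blast
      ultimately have "(z1, []) \<in> set ms1" by simp
      then have "z1 = 0" using ms1_ok by (force simp: loads_ok_def load_def)
      moreover have "fst (ms1 ! i) = load p (schedule_of ms1 i)"
        using loads_ok_nth[OF ms1_ok] that length_ms1 by (simp add: schedule_of_def)
      moreover have "load p (schedule_of ms1 i) \<ge> 0"
        unfolding load_def using jobs[OF that] nonneg by (intro sum_list_nonneg) auto
      ultimately have "fst (ms1 ! i) = z1" using z1(2) by simp
      then have "snd (ms1 ! i) = []"
        using critical_machine_None[OF None[unfolded crit_def]] iin by (metis prod.collapse)
      then show False using ne that length_ms1 by (simp add: schedule_of_def)
    qed
    then have "set js = {}" using sched unfolding is_schedule_def by auto
    then show ?thesis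
      using lpt_rev_no_crit(1)[OF True] ms1_LPT by (simp add: LPT_REV.no_jobs)
  next
    case False
    then obtain j before where crit: "crit = Some (j # before)" by (cases crit; cases "the crit") auto
    obtain i where i: "i < m" "ms1 ! i = (z1, j # before)"
      using critical_machine_Some[OF crit[unfolded crit_def]] length_ms1 by auto
    then have A1i: "schedule_of ms1 i = j # before" by (simp add: schedule_of_def length_ms1)
    then have "j \<in> set js" using jobs[OF i(1)] by simp
    then obtain c where c: "c < length js" "js ! c = j" by (auto simp: in_set_conv_nth)
    have split: "result (split_at j [] js) = (rev (take c js), drop (Suc c) js)"
      using result_split_at[OF c(1) dist, of "[]"] c(2) by simp
    \<comment> \<open>This counts the jobs below the critical one, so \<open>c - ?k\<close> equals
      the \<open>c + 1 - k\<close> of \<open>LPT_REV\<close>, truncated at 0 in the same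
      way.\<close>
    let ?k = "length before"
    define block where "block = drop (c - ?k) (take c js) @ [j]"
    define rest2 where "rest2 = take c js @ drop (Suc c) js"
    define rest3 where "rest3 = take (c - ?k) js @ drop (Suc c) js"
    define ms2 where "ms2 = result (lpt_with m p [j] rest2)"
    define ms3 where "ms3 = result (lpt_with m p block rest3)"
    have lc: "length (take c js) = c" using c(1) by simp
    have blk: "rev (take ?k (rev (take c js))) = drop (c - ?k) (take c js)"
      using lc by (simp add: take_rev)
    have pre': "rev (drop ?k (rev (take c js))) = take (c - ?k) js"
      using lc by (simp add: drop_rev min_def)
    have js: "take c js @ [j] @ drop (Suc c) js = js"
      using id_take_nth_drop[OF c(1), symmetric] c(2) by (simp only: append_Cons append_Nil)
    have js3: "take (c - ?k) js @ block @ drop (Suc c) js = js"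
    proof -
      have "take (c - ?k) js = take (c - ?k) (take c js)" by (simp add: min_def)
      then have "take (c - ?k) js @ drop (c - ?k) (take c js) = take c js" by (simp only: append_take_drop_id)
      then have "take (c - ?k) js @ block @ drop (Suc c) js = take c js @ [j] @ drop (Suc c) js"
        unfolding block_def by (simp only: append_assoc[symmetric])
      then show ?thesis by (simp only: js)
    qed
    have d2: "distinct (take c js @ [j] @ drop (Suc c) js)" by (simp only: js dist)
    have d3: "distinct (take (c - ?k) js @ block @ drop (Suc c) js)" by (simp only: js3 dist)
    have f: "xs @ zs = filter (\<lambda>x. x \<notin> set ys) (xs @ ys @ zs)" if "distinct (xs @ ys @ zs)" for xs ys zs :: "job list"
    proof -
      have "filter (\<lambda>x. x \<notin> set ys) xs = xs" "filter (\<lambda>x. x \<notin> set ys) zs = zs"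
        using that by (auto simp: filter_id_conv)
      then show ?thesis by simp
    qed
    have rest2: "rest2 = filter (\<lambda>x. x \<notin> set [j]) js"
      using f[OF d2] by (simp only: js rest2_def)
    have rest3: "rest3 = filter (\<lambda>x. x \<notin> set block) js"
      using f[OF d3] by (simp only: js3 rest3_def)
    have "distinct block" using d3 by simp
    note W2 = lpt_with_correct[OF m _ rest2, of p, folded ms2_def]
    note W3 = lpt_with_correct[OF m \<open>distinct block\<close> rest3, of p, folded ms3_def]
    have W2': "LPT_with m p js {js ! c} (schedule_of ms2)" "loads_ok p ms2" "length ms2 = m"
      using W2 c(2) by simp_all
    have "set block = {js ! d | d. d \<in> {c + 1 - length (schedule_of ms1 i)..c}}"
    proof -
      have "set (drop (c - ?k) (take c js)) = {js ! d | d. d \<in> {c - ?k..<c}}"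
      proof -
        have "drop (c - ?k) (take c js) = map ((!) js) [c - ?k..<c]"
          using c(1) by (intro nth_equalityI) auto
        then show ?thesis by auto
      qed
      moreover have "{c - ?k..c} = insert c {c - ?k..<c}" by auto
      ultimately show ?thesis using c(2) A1i by (auto simp: block_def)
    qed
    then have W3': "LPT_with m p js {js ! d | d. d \<in> {c + 1 - length (schedule_of ms1 i)..c}} (schedule_of ms3)"
      using W3(1) by simp
    have mk: "makespan m p (schedule_of ms) = result (max_load ms)" if "loads_ok p ms" "length ms = m" for ms
    proof -
      have "ms \<noteq> []" using that(2) m by auto
      then show ?thesis using makespan_schedule_of[OF _ that(1)] that(2) by simp
    qed
    have res: "result (lpt_rev m p J) = (let z2 = result (max_load ms2); z3 = result (max_load ms3)
      in if z1 \<le> z2 \<and> z1 \<le> z3 then ms1 else if z2 \<le> z3 then ms2 else ms3)"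
      using lpt_rev_crit(1)[OF crit]
      by (simp only: split blk pre' fst_conv snd_conv rev_rev_ident rest2_def rest3_def block_def ms2_def ms3_def)
    show ?thesis
    proof (rule LPT_REV.run[OF ms1_LPT i(1)])
      show "load p (schedule_of ms1 i) = makespan m p (schedule_of ms1)"
        using loads_ok_nth[OF ms1_ok, of i] i length_ms1 ms1_makespan by (simp add: schedule_of_def)
      show "schedule_of ms1 i \<noteq> []" "js ! c = hd (schedule_of ms1 i)" using A1i c by simp_all
      show "schedule_of (result (lpt_rev m p J)) \<in> {schedule_of ms1, schedule_of ms2, schedule_of ms3}"
        unfolding res by (simp add: Let_def)
      show "makespan m p (schedule_of (result (lpt_rev m p J))) = Min {makespan m p (schedule_of ms1),
          makespan m p (schedule_of ms2), makespan m p (schedule_of ms3)}"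
        unfolding res using mk[OF ms1_ok length_ms1] mk[OF W2'(2,3)] mk[OF W3(2,3)] z1_def
        by (auto simp: Let_def min_def)
    qed (use c(1) W2'(1) W3' in simp_all)
  qed
qed

end

section \<open>The ratio and the running time\<close>

definition position :: "'a list \<Rightarrow> 'a \<Rightarrow> nat" where
  "position js = inv_into {..<length js} ((!) js)"

lemma position_nth: "distinct js \<Longrightarrow> i < length js \<Longrightarrow> position js (js ! i) = i"
  unfolding position_def by (rule inv_into_f_f) (auto simp: inj_on_nth)

lemma nth_position:
  assumes "distinct js" "j \<in> set js"
  shows "position js j < length js" "js ! position js j = j"
  using assms by (auto simp: in_set_conv_nth position_nth)

lemma sorted_position: "distinct js \<Longrightarrow> sorted_wrt (\<lambda>i j. position js i < position js j) js"
  by (simp add: sorted_wrt_iff_nth_less position_nth)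

text \<open>The occurrences of a job over all machines add up to 1, so exactly one machine holds it.
  The function \<open>b\<close> is the form in which \<open>greedy\<close> and the locales treat
  schedules.\<close>

lemma is_schedule_function:
  assumes "is_schedule m J A" "finite J"
  obtains b where "\<And>j. j \<in> J \<Longrightarrow> b j < m" "\<And>k. k < m \<Longrightarrow> set (A k) = {j\<in>J. b j = k}"
    "\<And>k. k < m \<Longrightarrow> distinct (A k)"
proof -
  have "(\<Sum>k<m. mset (A k)) = mset_set J" using assms is_schedule_iff_mset by blast
  then have cnt: "(\<Sum>k<m. count (mset (A k)) j) = (if j \<in> J then 1 else 0)" for j
    using assms(2) by (metis count_mset_set(1,3) count_sum)
  define b where "b j = (SOME k. k < m \<and> count (mset (A k)) j = 1)" for j
  have uniq: "b j < m \<and> count (mset (A (b j))) j = 1 \<and> (\<forall>k<m. k \<noteq> b j \<longrightarrow> count (mset (A k)) j = 0)"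
    if "j \<in> J" for j
  proof -
    have "(\<Sum>k<m. count (mset (A k)) j) = 1" using cnt[of j] that by simp
    then obtain k where k: "k < m" "count (mset (A k)) j = 1"
      "\<forall>k'\<in>{..<m}. k \<noteq> k' \<longrightarrow> count (mset (A k')) j = 0"
      using sum_eq_1_iff[of "{..<m}" "\<lambda>k. count (mset (A k)) j"] by blast
    have "b j = k"
      unfolding b_def
    proof (rule some_equality)
      show "k' = k" if "k' < m \<and> count (mset (A k')) j = 1" for k'
        using that k(3) by (metis lessThan_iff zero_neq_one)
    qed (use k in simp)
    then show ?thesis using k by auto
  qed
  have notJ: "j \<notin> set (A k)" if "j \<notin> J" "k < m" for j k
    using cnt[of j] that by simp
  show ?thesis
  proof
    show "b j < m" if "j \<in> J" for j using uniq[OF that] by blast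
    show "set (A k) = {j\<in>J. b j = k}" if "k < m" for k
    proof (intro equalityI subsetI)
      fix j assume j: "j \<in> set (A k)"
      have "j \<in> J" using notJ[OF _ that] j by blast
      have "count (mset (A k)) j \<noteq> 0" using j by (simp add: count_eq_zero_iff)
      then have "b j = k" using uniq[OF \<open>j \<in> J\<close>] that by metis
      then show "j \<in> {j\<in>J. b j = k}" using \<open>j \<in> J\<close> by simp
    next
      fix j assume "j \<in> {j\<in>J. b j = k}"
      then have "count (mset (A k)) j = 1" using uniq by blast
      then show "j \<in> set (A k)" by (metis count_eq_zero_iff set_mset_mset zero_neq_one)
    qed
    show "distinct (A k)" if "k < m" for k
      unfolding distinct_count_atmost_1
    proof (intro allI)
      fix j
      show "count (mset (A k)) j = (if j \<in> set (A k) then 1 else 0)"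
      proof (cases "j \<in> J")
        case True
        note u = uniq[OF True]
        show ?thesis
        proof (cases "k = b j")
          case True
          then have "count (mset (A k)) j = 1" using u by simp
          then show ?thesis by (metis count_eq_zero_iff set_mset_mset zero_neq_one)
        next
          case False
          then have "count (mset (A k)) j = 0" using u that by blast
          then show ?thesis by (metis count_eq_zero_iff set_mset_mset)
        qed
      next
        case False
        then have "j \<notin> set (A k)" using notJ[OF False that] by simp
        then show ?thesis by (metis count_eq_zero_iff set_mset_mset)
      qed
    qed
  qed
qed

lemma load_eq_sum: "distinct xs \<Longrightarrow> load p xs = sum p (set xs)"
  by (simp add: load_def sum_list_distinct_conv_sum_set)

lemma load_le_makespan: "k < m \<Longrightarrow> load p (A k) \<le> makespan m p A"
  by (simp add: makespan_def)

lemma makespan_attained: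
  assumes "m \<ge> 1"
  obtains k where "k < m" "makespan m p A = load p (A k)"
proof -
  have "makespan m p A \<in> (\<lambda>i. load p (A i)) ` {..<m}"
    unfolding makespan_def using assms by (intro Max_in) (auto simp: lessThan_empty_iff)
  then show ?thesis using that by blast
qed

lemma list_scheduling_append:
  "list_scheduling m p A (xs @ ys) B \<Longrightarrow> \<exists>C. list_scheduling m p A xs C \<and> list_scheduling m p C ys B"
proof (induction xs arbitrary: A)
  case (Cons x xs)
  from Cons.prems obtain i where i: "i < m" "\<forall>h<m. load p (A i) \<le> load p (A h)"
    "list_scheduling m p (A(i := x # A i)) (xs @ ys) B"
    by (auto elim: list_scheduling.cases)
  then show ?case using Cons.IH[OF i(3)] by (blast intro: LS_Cons)
qed (auto intro: LS_Nil)

text \<open>Machines grow at the head, so the order of \<open>js\<close> survives reversed.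
  \<open>R\<close> is trivial where only contents matter, and the order of positions where the
  critical job must be the latest on its machine.\<close>

lemma list_scheduling_extends:
  "list_scheduling m p A js B \<Longrightarrow> sorted_wrt R js \<Longrightarrow>
     \<exists>xs. B k = rev xs @ A k \<and> set xs \<subseteq> set js \<and> sorted_wrt R xs"
proof (induction rule: list_scheduling.induct)
  case (LS_Cons i A j js B)
  then obtain xs where xs: "B k = rev xs @ (A(i := j # A i)) k" "set xs \<subseteq> set js" "sorted_wrt R xs"
    by auto
  show ?case
  proof (cases "k = i")
    case True
    then show ?thesis using xs LS_Cons.prems by (intro exI[of _ "j # xs"]) auto
  next
    case False
    then show ?thesis using xs by (intro exI[of _ xs]) auto
  qed
qed (auto intro: exI[of _ "[]"])

text \<open>Cutting the run at \<open>y\<close> yields the partial schedule \<open>C\<close> in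
  which the machine for \<open>y\<close> is chosen. Its contents are recovered from the final
  \<open>B\<close> by removing \<open>y\<close> and the later jobs, which positions
  identify.\<close>

lemma list_scheduling_greedy:
  assumes dist: "distinct js" and A: "\<And>k. set (A k) \<subseteq> S"
    and LS: "list_scheduling m p A (filter (\<lambda>j. j \<notin> S) js) B"
    and b: "\<And>j. j \<in> set js \<Longrightarrow> b j < m" and setB: "\<And>k. k < m \<Longrightarrow> set (B k) = {j\<in>set js. b j = k}"
    and distB: "\<And>k. k < m \<Longrightarrow> distinct (B k)"
  shows "greedy m p (position js) S (set js) b"
  unfolding greedy_def
proof (intro ballI allI impI)
  fix y k assume y: "y \<in> set js - S" and k: "k < m"
  let ?ix = "position js" and ?F = "filter (\<lambda>j. j \<notin> S)"
  define i where "i = ?ix y"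
  have i: "i < length js" "js ! i = y" using nth_position[OF dist] y by (auto simp: i_def)
  let ?X = "?F (take i js)" and ?Y = "?F (drop (Suc i) js)"
  have before: "j \<in> set js \<and> ?ix j < i" if "j \<in> set (take i js)" for j
  proof -
    obtain l where "l < i" "j = js ! l" using \<open>j \<in> set (take i js)\<close> i(1) by (auto simp: in_set_conv_nth)
    then show ?thesis using i(1) position_nth[OF dist, of l] by simp
  qed
  have after: "i < ?ix j" if "j \<in> set (drop (Suc i) js)" for j
    using that by (auto simp: in_set_conv_nth position_nth[OF dist])
  have "js = take i js @ y # drop (Suc i) js" using id_take_nth_drop[OF i(1)] i(2) by simp
  then have "?F js = ?X @ y # ?Y" using y by (metis DiffD2 filter.simps(2) filter_append)
  then obtain C where C: "list_scheduling m p A ?X C" "list_scheduling m p C (y # ?Y) B"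
    using list_scheduling_append LS by metis
  from C(2) obtain h where h: "h < m" "\<forall>k<m. load p (C h) \<le> load p (C k)"
    "list_scheduling m p (C(h := y # C h)) ?Y B"
    by (auto elim: list_scheduling.cases)
  have triv: "sorted_wrt (\<lambda>_ _. True) xs" for xs :: "job list" by (simp add: sorted_wrt_iff_nth_less)
  have C_load: "load p (C k) = sum p {j\<in>set js. (j \<in> S \<or> ?ix j < ?ix y) \<and> b j = k}" if k: "k < m" for k
  proof -
    obtain xs where xs: "C k = rev xs @ A k" "set xs \<subseteq> set ?X"
      using list_scheduling_extends[OF C(1) triv] by blast
    obtain ys where ys: "B k = rev ys @ (C(h := y # C h)) k" "set ys \<subseteq> set ?Y"
      using list_scheduling_extends[OF h(3) triv] by blast
    have "set (C k) = {j\<in>set js. (j \<in> S \<or> ?ix j < ?ix y) \<and> b j = k}"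
    proof (intro equalityI subsetI)
      fix j assume j: "j \<in> set (C k)"
      then have "j \<in> set (B k)" using ys(1) by (auto split: if_splits)
      moreover have "j \<in> S \<or> ?ix j < ?ix y"
        using j xs A[of k] before unfolding i_def by auto
      ultimately show "j \<in> {j\<in>set js. (j \<in> S \<or> ?ix j < ?ix y) \<and> b j = k}"
        using setB[OF k] by simp
    next
      fix j assume j: "j \<in> {j\<in>set js. (j \<in> S \<or> ?ix j < ?ix y) \<and> b j = k}"
      then have "j \<in> set (B k)" using setB[OF k] by simp
      moreover have "j \<notin> set ys"
      proof
        assume "j \<in> set ys"
        then have "j \<in> set (drop (Suc i) js)" "j \<notin> S" using ys(2) by auto
        then show False using after[of j] j by (simp add: i_def)
      qed
      moreover have "j \<noteq> y" using j y by auto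
      ultimately show "j \<in> set (C k)" using ys(1) by (auto split: if_splits)
    qed
    moreover have "distinct (C k)" using distB[OF k] ys(1) by (auto split: if_splits)
    ultimately show ?thesis using load_eq_sum by metis
  qed
  obtain ys where "B h = rev ys @ (C(h := y # C h)) h"
    using list_scheduling_extends[OF h(3) triv] by blast
  then have "b y = h" using setB[OF h(1)] by auto
  then show "sum p {j\<in>set js. (j \<in> S \<or> ?ix j < ?ix y) \<and> b j = b y}
      \<le> sum p {j\<in>set js. (j \<in> S \<or> ?ix j < ?ix y) \<and> b j = k}"
    using h(1,2) k C_load by simp
qed

lemma greedy_scale:
  assumes "greedy m p ix S J b" "C > 0"
  shows "greedy m (\<lambda>j. p j / C) ix S J b"
  using assms unfolding greedy_def by (simp add: sum_divide_distrib[symmetric] divide_right_mono)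

lemma LPT_REV_ratio:
  assumes m: "m \<ge> 3" and valid: "valid_instance p js" and mono: "non_increasing p js"
    and R: "LPT_REV m p js B"
  shows "makespan m p B \<le> (1 + excess m) * opt_makespan m p (set js)"
proof -
  let ?J = "set js" and ?ix = "position js"
  define C where "C = opt_makespan m p ?J"
  have dist: "distinct js" and nonneg: "\<And>j. j \<in> ?J \<Longrightarrow> 0 \<le> p j"
    using valid by (auto simp: valid_instance_def)
  have m1: "m \<ge> 1" using m by simp
  have ex: "0 \<le> excess m" using excess_bounds(1)[OF m] by simp
  obtain Opt where Opt: "is_schedule m ?J Opt" "makespan m p Opt = C"
    using opt_makespan_attained[OF m1, of ?J p] by (auto simp: C_def)
  obtain opt where opt: "\<And>j. j \<in> ?J \<Longrightarrow> opt j < m" "\<And>k. k < m \<Longrightarrow> set (Opt k) = {j\<in>?J. opt j = k}"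
    "\<And>k. k < m \<Longrightarrow> distinct (Opt k)"
    using is_schedule_function[OF Opt(1)] by (metis List.finite_set)
  have opt_sum: "sum p {j\<in>?J. opt j = k} \<le> C" if "k < m" for k
    using load_le_makespan[OF that, of p Opt] load_eq_sum[OF opt(3)[OF that], of p] opt(2)[OF that] Opt(2) by simp
  have C0: "0 \<le> C"
  proof -
    have "0 \<le> sum p {j\<in>?J. opt j = 0}" using nonneg by (intro sum_nonneg) auto
    then show ?thesis using opt_sum[of 0] m by simp
  qed
  show ?thesis
  proof (cases "C = 0")
    \<comment> \<open>Scaling by \<open>C\<close> is impossible here, but all processing times
      vanish.\<close>
    case True
    have p0: "p j = 0" if j: "j \<in> ?J" for j
    proof -
      have "p j \<le> sum p {k\<in>?J. opt k = opt j}" using j nonneg by (intro member_le_sum) auto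
      then show ?thesis using opt_sum[OF opt(1)[OF j]] nonneg[OF j] True by simp
    qed
    obtain b where b: "\<And>k. k < m \<Longrightarrow> set (B k) = {j\<in>?J. b j = k}" "\<And>k. k < m \<Longrightarrow> distinct (B k)"
      using is_schedule_function[OF LPT_REV_is_schedule[OF dist R]] by (metis List.finite_set)
    obtain k where "k < m" "makespan m p B = load p (B k)" using makespan_attained[OF m1] .
    then have "makespan m p B = 0" using load_eq_sum[OF b(2)] b(1) p0 by simp
    then show ?thesis using True by (simp add: C_def)
  next
    case False
    then have Cpos: "C > 0" using C0 by simp
    from R show ?thesis
    proof cases
      case no_jobs
      then have "B = (\<lambda>_. [])" unfolding LPT_def by (auto elim: list_scheduling.cases)
      moreover obtain k where "k < m" "makespan m p B = load p (B k)" using makespan_attained[OF m1] .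
      ultimately have "makespan m p B = 0" by (simp add: load_def)
      then show ?thesis using C0 ex by (simp add: C_def)
    next
      case (run A1 i c k A2 A3)
      let ?c = "js ! c"
      let ?S = "{js ! d | d. d \<in> {c + 1 - k..c}}"
      have cJ: "?c \<in> ?J" and ixc: "?ix ?c = c" using position_nth[OF dist run(5)] run(5) by simp_all
      have SJ: "?S \<subseteq> ?J" using \<open>c < length js\<close> by auto
      have sc: "is_schedule m ?J A1" "is_schedule m ?J A2" "is_schedule m ?J A3"
        using LPT_is_schedule[OF dist run(1)] LPT_with_is_schedule[OF dist _ run(8)]
          LPT_with_is_schedule[OF dist SJ run(9)] cJ by simp_all
      obtain b1 where b1: "\<And>j. j \<in> ?J \<Longrightarrow> b1 j < m" "\<And>k. k < m \<Longrightarrow> set (A1 k) = {j\<in>?J. b1 j = k}"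
        "\<And>k. k < m \<Longrightarrow> distinct (A1 k)"
        using is_schedule_function[OF sc(1)] by (metis List.finite_set)
      obtain b2 where b2: "\<And>j. j \<in> ?J \<Longrightarrow> b2 j < m" "\<And>k. k < m \<Longrightarrow> set (A2 k) = {j\<in>?J. b2 j = k}"
        "\<And>k. k < m \<Longrightarrow> distinct (A2 k)"
        using is_schedule_function[OF sc(2)] by (metis List.finite_set)
      obtain b3 where b3: "\<And>j. j \<in> ?J \<Longrightarrow> b3 j < m" "\<And>k. k < m \<Longrightarrow> set (A3 k) = {j\<in>?J. b3 j = k}"
        "\<And>k. k < m \<Longrightarrow> distinct (A3 k)"
        using is_schedule_function[OF sc(3)] by (metis List.finite_set)
      have gr1: "greedy m p ?ix {} ?J b1"
        by (rule list_scheduling_greedy[OF dist _ _ b1, of "\<lambda>_. []"]) (use run(1) in \<open>simp_all add: LPT_def\<close>)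
      obtain i2 L2 where L2: "set L2 = {?c}"
          "list_scheduling m p ((\<lambda>_. [])(i2 := L2)) (filter (\<lambda>j. j \<notin> {?c}) js) A2"
        using run(8) unfolding LPT_with_def by blast
      have gr2: "greedy m p ?ix {?c} ?J b2"
        by (rule list_scheduling_greedy[OF dist _ L2(2) b2]) (use L2(1) in auto)
      obtain i3 L3 where L3: "i3 < m" "set L3 = ?S"
          "list_scheduling m p ((\<lambda>_. [])(i3 := L3)) (filter (\<lambda>j. j \<notin> ?S) js) A3"
        using run(9) unfolding LPT_with_def by blast
      have gr3: "greedy m p ?ix ?S ?J b3"
        by (rule list_scheduling_greedy[OF dist _ L3(3) b3]) (use L3(2) in auto)
      have b3S: "b3 j = i3" if "j \<in> ?S" for j
      proof -
        obtain xs where "A3 i3 = rev xs @ L3"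
          using list_scheduling_extends[OF L3(3), of "\<lambda>_ _. True" i3]
          unfolding fun_upd_same sorted_wrt_iff_nth_less by blast
        then have "j \<in> set (A3 i3)" using that L3(2) by simp
        then show ?thesis using b3(2)[OF L3(1)] by simp
      qed
      have "?c \<in> set (A1 i)" using run(4,6) by simp
      then have b1c: "b1 ?c = i" using b1(2)[OF run(2)] by simp
      have A1i: "set (A1 i) = {j\<in>?J. b1 j = b1 ?c}" using b1(2)[OF run(2)] b1c by simp
      have card_k: "card {j\<in>?J. b1 j = b1 ?c} = k"
        using A1i distinct_card[OF b1(3)[OF run(2)]] run(7) by simp
      have last: "?ix j \<le> ?ix ?c" if "j \<in> ?J" "b1 j = b1 ?c" for j
      proof -
        \<comment> \<open>Machine \<open>i\<close> received its jobs in order of position, so the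
          head of its list has the largest one.\<close>
        obtain xs where xs: "A1 i = rev xs" "sorted_wrt (\<lambda>i j. ?ix i < ?ix j) xs"
          using list_scheduling_extends[OF run(1)[unfolded LPT_def] sorted_position[OF dist], of i]
          unfolding append_Nil2 by blast
        then have ne: "xs \<noteq> []" "?c = List.last xs" using run(4,6) by (simp_all add: hd_rev)
        have "j \<in> set xs" using that A1i xs(1) by auto
        moreover have snoc: "butlast xs @ [?c] = xs" using ne by simp
        ultimately have "j \<in> set (butlast xs) \<or> j = ?c"
          using set_append[of "butlast xs" "[?c]"] by auto
        moreover have "sorted_wrt (\<lambda>i j. ?ix i < ?ix j) (butlast xs @ [?c])"
          unfolding snoc by (rule xs(2))
        ultimately show ?thesis by (auto simp: sorted_wrt_append less_imp_le)
      qed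
      define p' where "p' j = p j / C" for j
      have p'_eq: "p' = (\<lambda>j. p j / C)" by (simp add: fun_eq_iff p'_def)
      have p'_sum: "sum p' X = sum p X / C" for X by (simp add: p'_def sum_divide_distrib)
      interpret scheduling m p' ?ix ?J opt
      proof
        show "inj_on ?ix ?J" by (rule inj_on_inverseI[of _ "(!) js"]) (simp add: nth_position(2)[OF dist])
        show "0 \<le> p' j" if "j \<in> ?J" for j using nonneg[OF that] Cpos by (simp add: p'_def)
        show "p' k \<le> p' j" if "j \<in> ?J" "k \<in> ?J" "?ix j \<le> ?ix k" for j k
        proof -
          have "p (js ! ?ix k) \<le> p (js ! ?ix j)"
          proof (cases "?ix j = ?ix k")
            case False
            then have "?ix j < ?ix k" using that(3) by simp
            then show ?thesis
              using mono nth_position(1)[OF dist that(2)]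
              unfolding non_increasing_def sorted_wrt_iff_nth_less by blast
          qed simp
          then have "p k \<le> p j" using nth_position(2)[OF dist] that by simp
          then show ?thesis using Cpos by (simp add: p'_def divide_right_mono)
        qed
        show "sum p' {j\<in>?J. opt j = h} \<le> 1" if "h < m" for h
          using opt_sum[OF that] Cpos by (simp add: p'_sum)
        show "opt j < m" if "j \<in> ?J" for j by (rule opt(1)[OF that])
      qed (use m in simp_all)
      have le: "makespan m p A \<le> (1 + excess m) * C"
        if b: "\<And>k. k < m \<Longrightarrow> set (A k) = {j\<in>?J. b j = k}" "\<And>k. k < m \<Longrightarrow> distinct (A k)"
          and all: "\<forall>h. sum p' {j\<in>?J. b j = h} \<le> 1 + excess m" for A b
      proof -
        obtain h where h: "h < m" "makespan m p A = load p (A h)" using makespan_attained[OF m1] .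
        then have "makespan m p A = sum p {j\<in>?J. b j = h}" using load_eq_sum[OF b(2)] b(1) by simp
        moreover have "sum p {j\<in>?J. b j = h} / C \<le> 1 + excess m" using all p'_sum by simp
        ultimately show ?thesis using Cpos by (simp add: pos_divide_le_eq)
      qed
      have min: "makespan m p B \<le> makespan m p A1" "makespan m p B \<le> makespan m p A2"
        "makespan m p B \<le> makespan m p A3"
        using run(11) by simp_all
      have z1: "makespan m p A1 = sum p' {j\<in>?J. b1 j = b1 ?c} * C"
        using run(3) load_eq_sum[OF b1(3)[OF run(2)], of p] A1i Cpos by (simp add: p'_sum)
      show ?thesis
      proof (cases "1 + excess m < sum p' {j\<in>?J. b1 j = b1 ?c}")
        case False
        then have "makespan m p A1 \<le> (1 + excess m) * C" using z1 Cpos by simp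
        then show ?thesis using min(1) by (simp add: C_def)
      next
        case True
        have "(\<forall>h. sum p' {j\<in>?J. b2 j = h} \<le> 1 + excess m) \<or> (\<forall>h. sum p' {j\<in>?J. b3 j = h} \<le> 1 + excess m)"
        proof (rule three_schedules[OF b1(1) b2(1) b3(1) cJ last])
          show "?ix ` ?J = {..<length js}"
          proof (intro equalityI subsetI)
            fix i assume "i \<in> {..<length js}"
            then have "i = ?ix (js ! i)" "js ! i \<in> ?J" using position_nth[OF dist] by simp_all
            then show "i \<in> ?ix ` ?J" by blast
          next
            fix i assume "i \<in> ?ix ` ?J"
            then show "i \<in> {..<length js}" using nth_position(1)[OF dist] by blast
          qed
          show "?S = {j\<in>?J. ?ix j \<le> ?ix ?c \<and> ?ix ?c < ?ix j + card {j\<in>?J. b1 j = b1 ?c}}"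
            unfolding card_k ixc
          proof (intro equalityI subsetI)
            fix j assume "j \<in> ?S"
            then obtain d where d: "j = js ! d" "c + 1 - k \<le> d" "d \<le> c" by auto
            then have "?ix j = d" "j \<in> ?J" using position_nth[OF dist] run(5) by auto
            moreover have "c < d + k" using d(2) by linarith
            ultimately show "j \<in> {j\<in>?J. ?ix j \<le> c \<and> c < ?ix j + k}" using d(3) by simp
          next
            fix j assume j: "j \<in> {j\<in>?J. ?ix j \<le> c \<and> c < ?ix j + k}"
            then have "js ! ?ix j = j" using nth_position(2)[OF dist] by blast
            moreover have "?ix j \<in> {c + 1 - k..c}" using j by auto
            ultimately show "j \<in> ?S" by (metis (mono_tags, lifting) mem_Collect_eq)
          qed
          show "b3 j = b3 k" if "j \<in> ?S" "k \<in> ?S" for j k using b3S[OF that(1)] b3S[OF that(2)] by simp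
          show "greedy m p' ?ix {} ?J b1" "greedy m p' ?ix {?c} ?J b2" "greedy m p' ?ix ?S ?J b3"
            using greedy_scale[OF gr1 Cpos] greedy_scale[OF gr2 Cpos] greedy_scale[OF gr3 Cpos]
            unfolding p'_eq by blast+
          show "1 + excess m < sum p' {j\<in>?J. b1 j = b1 ?c}" by (rule True)
        qed
        then show ?thesis
        proof
          assume "\<forall>h. sum p' {j\<in>?J. b2 j = h} \<le> 1 + excess m"
          then have "makespan m p A2 \<le> (1 + excess m) * C" using le[OF b2(2,3)] by blast
          then show ?thesis using min(2) by (simp add: C_def)
        next
          assume "\<forall>h. sum p' {j\<in>?J. b3 j = h} \<le> 1 + excess m"
          then have "makespan m p A3 \<le> (1 + excess m) * C" using le[OF b3(2,3)] by blast
          then show ?thesis using min(3) by (simp add: C_def)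
        qed
      qed
    qed
  qed
qed

section \<open>Running time\<close>

lemma steps_merge_sort_real:
  "real (steps (merge_sort p n xs)) \<le> real n * (2 * (ln (real n) / ln 2) + 3) + 1"
\<comment> \<open>The summand 1 covers \<open>n = 0\<close>, where the product vanishes.\<close>
proof (cases "n = 0")
  case False
  \<comment> \<open>Rounding the logarithm up adds at most 1 to it, whence 3 in place of 1.\<close>
  define k where "k = nat \<lceil>log 2 (real n)\<rceil>"
  have log0: "0 \<le> log 2 (real n)" using False by simp
  have k: "log 2 (real n) \<le> real k" "real k \<le> log 2 (real n) + 1"
    using log0 by (simp_all add: k_def)
  have "real n = 2 powr log 2 (real n)" using False by simp
  also have "\<dots> \<le> 2 powr real k" using k(1) by simp
  finally have "n \<le> 2 ^ k" by (simp add: powr_realpow)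
  then have "steps (merge_sort p n xs) \<le> n * (2 * k + 1)" using steps_merge_sort False by simp
  then have "real (steps (merge_sort p n xs)) \<le> real (n * (2 * k + 1))" by linarith
  also have "\<dots> = real n * (2 * real k + 1)" by (simp add: distrib_left)
  also have "\<dots> \<le> real n * (2 * log 2 (real n) + 3)" using k(2) by (intro mult_left_mono) auto
  finally show ?thesis by (simp add: log_def)
qed (simp add: steps_merge_sort_0)

lemma lpt_rev_time:
  assumes "m \<ge> 1"
  shows "\<exists>f :: nat \<Rightarrow> real. f \<in> O(\<lambda>n. real n * ln (real n)) \<and>
    (\<forall>p J. valid_instance p J \<longrightarrow> real (steps (lpt_rev m p J)) \<le> f (length J))"
proof -
  \<comment> \<open>Three times the cost \<open>2 * m + 3\<close> that \<open>ls\<close> charges per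
    job.\<close>
  define E where "E = 6 * real m + 9"
  define f where "f n = real n * (2 * (ln (real n) / ln 2) + 3) + 1 + E * (real n + 1) + 8 * real n + 8 * real m + 32"
    for n :: nat
  have "f \<in> O(\<lambda>n. real n * ln (real n))"
  proof (rule bigoI)
    \<comment> \<open>From \<open>n = 3\<close> on \<open>n \<le> n * ln n\<close>, so linear and
      constant terms of \<open>f\<close> contribute their coefficients, \<open>E\<close> twice
      because of \<open>n + 1\<close>. Here \<open>m\<close> is a constant.\<close>
    let ?c = "2 / ln 2 + 12 + 2 * E + 8 * real m + 32"
    show "\<forall>\<^sub>F n in sequentially. norm (f n) \<le> ?c * norm (real n * ln (real n))"
      using eventually_ge_at_top[of 3]
    proof eventually_elim
      case (elim n)
      define x where "x = real n * ln (real n)"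
      have n: "real n \<ge> 3" using elim by simp
      then have "ln (real n) \<ge> 1" using exp_le by (subst ln_ge_iff) auto
      then have x: "real n \<le> x" using n unfolding x_def by simp
      have E: "0 \<le> E" by (simp add: E_def)
      have "f n = 2 / ln 2 * x + 3 * real n + 1 + E * (real n + 1) + 8 * real n + 8 * real m + 32"
        by (simp add: f_def x_def algebra_simps)
      moreover have "E * (real n + 1) \<le> E * (2 * x)" using E x n by (intro mult_left_mono) auto
      moreover have "8 * real m * 1 \<le> 8 * real m * x" using x n by (intro mult_left_mono) auto
      ultimately have "f n \<le> 2 / ln 2 * x + 3 * x + x + E * (2 * x) + 8 * x + 8 * real m * x + 32 * x"
        using x n by linarith
      also have "\<dots> = ?c * x" by (simp add: algebra_simps)
      finally have "f n \<le> ?c * x" .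
      moreover have "0 \<le> f n"
        using n \<open>ln (real n) \<ge> 1\<close> E unfolding f_def by (intro add_nonneg_nonneg mult_nonneg_nonneg) auto
      ultimately show ?case using x n unfolding x_def[symmetric] by simp
    qed
  qed
  moreover have "real (steps (lpt_rev m p J)) \<le> f (length J)" for p J
  proof -
    have "real (steps (lpt_rev m p J)) \<le> real (steps (merge_sort p (length J) J)) +
      (3 * ((real (length J) + 1) * (2 * real m + 3)) + 8 * real (length J) + 8 * real m + 32)"
      using of_nat_mono[OF lpt_rev_steps[OF assms, of p J], where 'a = real] by (simp add: algebra_simps)
    then show ?thesis using steps_merge_sort_real[of p "length J" J] by (simp add: f_def E_def algebra_simps)
  qed
  ultimately show ?thesis by blast
qed

text \<open>The middle conjunct links the other two: the implementation produces one of the outcomes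
  of \<open>LPT_REV\<close>, and the ratio holds for every outcome, however ties are broken.\<close>

theorem theorem1:
  fixes m :: nat
  assumes "m \<ge> 3"
  shows "(\<exists>f :: nat \<Rightarrow> real. f \<in> O(\<lambda>n. real n * ln (real n)) \<and>
           (\<forall>p J. valid_instance p J \<longrightarrow> real (steps (lpt_rev m p J)) \<le> f (length J)))
       \<and> (\<forall>p J. valid_instance p J \<longrightarrow>
           (\<exists>js. mset js = mset J \<and> non_increasing p js \<and>
              LPT_REV m p js (schedule_of (result (lpt_rev m p J)))))
       \<and> (\<forall>p js B. valid_instance p js \<longrightarrow> non_increasing p js \<longrightarrow> LPT_REV m p js B \<longrightarrow>
           makespan m p B \<le> (4 / 3 - 1 / (3 * (real m - 1))) * opt_makespan m p (set js))"
proof -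
  have m1: "m \<ge> 1" using assms by simp
  have "1 + excess m = 4 / 3 - 1 / (3 * (real m - 1))"
    using assms unfolding excess_def by (simp add: field_simps)
  moreover have "\<exists>js. mset js = mset J \<and> non_increasing p js \<and>
      LPT_REV m p js (schedule_of (result (lpt_rev m p J)))" if "valid_instance p J" for p J
    using lpt_rev_correct[OF m1 that] by blast
  ultimately show ?thesis
    using lpt_rev_time[OF m1] LPT_REV_ratio[OF assms] by (intro conjI allI impI) simp_all
qed

end
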